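(* Let $a:\mathbb{N}\to\mathbb{C}$ be an arithmetic function satisfying $a(1)=1$ and $\sum_{n=2}^\infty \frac{|a(n)|}{n}\log\log n<\infty$. Let $\mu*a$ be the Dirichlet convolution of the Möbius function $\mu$ and $a$. Let $S$ be a set of primes having a natural density $\delta(S)$. Then $$-\sum_{\substack{n\geq 2\\ p(n)\in S}}\frac{(\mu*a)(n)}{n}=\delta(S),$$ where $p(n)$ denotes the smallest prime divisor of $n$.
   Context: $\mathbb{N}$ is the set of positive integers. The Dirichlet convolution is $(\mu*a)(n)=\sum_{d\mid n}\mu(d)\,a(n/d)$. For $n\ge 2$, $p(n)$ is the smallest prime divisor of $n$. A set $S$ of primes has natural density $\delta(S)$ if the limit $\delta(S):=\lim_{x\to\infty}\pi_S(x)/\pi(x)$ exists, where $\pi_S(x)=\#\{p\in S: p\leq x\}$ and $\pi(x)$ is the number of all primes $p\le x$. Infinite sums over $n$ are understood as limits of the partial sums over $n\le x$ as $x\to\infty$; the claim includes convergence of the sum in this sense. *)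

theory Defs
  imports "HOL-Analysis.Analysis" "HOL-Computational_Algebra.Computational_Algebra"
begin

text \<open>
  Arithmetic functions live on the positive integers. They are represented as functions on
  \<^typ>\<open>nat\<close> whose value at 0 is never used: \<^term>\<open>n div d\<close> is positive for every divisor
  \<^term>\<open>d\<close> of a positive \<^term>\<open>n\<close>.
\<close>

definition moebius_mu :: "nat \<Rightarrow> int" where
  "moebius_mu n = (if squarefree n then (- 1) ^ card (prime_factors n) else 0)"

definition dirichlet_conv ::
  "(nat \<Rightarrow> 'a) \<Rightarrow> (nat \<Rightarrow> 'a) \<Rightarrow> nat \<Rightarrow> 'a :: comm_semiring_1" where
  "dirichlet_conv f g n = (\<Sum>d | d dvd n. f d * g (n div d))"

text \<open>Only meaningful for \<^term>\<open>n \<ge> 2\<close>.\<close>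

definition least_prime_divisor :: "nat \<Rightarrow> nat" where
  "least_prime_divisor n = (LEAST p. prime p \<and> p dvd n)"

definition prime_count_in :: "nat set \<Rightarrow> real \<Rightarrow> nat" where
  "prime_count_in S x = card {p \<in> S. prime p \<and> real p \<le> x}"

definition prime_count :: "real \<Rightarrow> nat" where
  "prime_count x = card {p :: nat. prime p \<and> real p \<le> x}"

text \<open>The set \<^term>\<open>S\<close> of primes has natural density (relative to the primes) equal to
  \<^term>\<open>\<delta>\<close>.\<close>

definition has_prime_density :: "nat set \<Rightarrow> real \<Rightarrow> bool" where
  "has_prime_density S \<delta> \<longleftrightarrow>
     ((\<lambda>x. real (prime_count_in S x) / real (prime_count x)) \<longlongrightarrow> \<delta>) at_top"

end

(*
  Put f = 1_S and let P(n), p(n) be the largest and smallest prime factor of n. Splitting off the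
  smallest prime of n turns every sum of mu(n) f(p(n)) into sums of mu over integers free of small
  primes. Two consequences drive the proof.

  Alladi's duality: the sum of mu(n) f(p(n)) floor(N/n) over 2 <= n <= N is minus the number of
  n <= N with P(n) in S. This number is asymptotically delta N: writing n = m P(n), one may discard
  the n with P(n) < N^t, and for each m <= N^(1-t) the primes P(n) run through an interval, where S
  has density delta. Replacing floor(N/n) by N/n costs o(N): the n with p(n) <= z contribute sums
  of mu(m)/m over m free of a fixed finite set of primes, which tend to 0 by the prime number
  theorem, and the n with p(n) > z are few. This is the case a = 1_{n = 1}.

  For general a, write mu * a as a sum over the argument e of a. The term e = 1 gives the previous
  case. For e >= 2 the sum over d <= N/e tends to 0, and it is O(log log e) uniformly in N, so
  the hypothesis on a allows passing to the limit termwise.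

  The prime number theorem enters as the convergence of the sum of mu(n)/n to 0. It is proved by
  Newman's method, applied to 1/zeta(1 + z) on Re z >= 0.
*)
theory Submission
  imports Defs "HOL-Number_Theory.Prime_Powers" "HOL-Complex_Analysis.Complex_Analysis"
    "HOL-Real_Asymp.Real_Asymp"
begin

subsection \<open>Sifted and smooth integers\<close>

text \<open>The obstacle is uniformity. Splitting off primes produces sums of mu(n)/n over the n <=
  N free of a finite set P of primes, where P varies, and a bound growing with P would be useless.
  An exact identity helps: the sum of mu(n) floor(N/n) over these n is the number of n <= N composed
  of primes of P only. Hence \<open>sifted_mertens\<close> is at most 2 in absolute value, whatever
  P and N are. This bound is the source of the log log e: the term e is one such sum plus a sum over
  primes p below p(e), each costing at most 2/p. Convergence to 0, in contrast, is used only for one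
  fixed finite P at a time. The term e = 1 has no cut-off at p(e), so arbitrarily large primes take
  part. This is why it alone sees the density of S. Sifted and smooth sets are indexed by a set of
  primes and not by a bound. The identity and the passage from the prime number theorem to sifted
  sums are then both proved by inserting one prime at a time, each insertion giving a recursion from
  N to \<open>N div p\<close>.\<close>

lemma moebius_mu_1 [simp]: "moebius_mu (Suc 0) = 1"
  by (simp add: moebius_mu_def)

lemma abs_moebius_mu_le: "\<bar>moebius_mu n\<bar> \<le> 1"
  by (simp add: moebius_mu_def power_abs)

lemma moebius_mu_prime_times:
  assumes "prime p" "n > 0"
  shows "moebius_mu (p * n) = (if p dvd n then 0 else - moebius_mu n)"
proof (cases "p dvd n")
  case True
  then have "p ^ 2 dvd p * n"
    by (simp add: power2_eq_square mult_dvd_mono)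
  moreover have "\<not> is_unit p"
    using assms not_prime_unit by blast
  ultimately have "\<not> squarefree (p * n)"
    unfolding squarefree_def by blast
  with True show ?thesis by (simp add: moebius_mu_def)
next
  case False
  then have cop: "coprime p n"
    using assms prime_imp_coprime by blast
  have "prime_factors (p * n) = insert p (prime_factors n)"
    using assms by (subst prime_factors_product) (auto simp: prime_prime_factors)
  moreover have "p \<notin> prime_factors n"
    using False by auto
  moreover have "squarefree (p * n) \<longleftrightarrow> squarefree n"
    using cop assms squarefree_prime[of p]
    by (auto intro: squarefree_mult_coprime dest: squarefree_multD)
  ultimately show ?thesis
    using False by (simp add: moebius_mu_def)
qed

text \<open>Fix a prime p dividing n. The divisors not divisible by p pair off with their multiples
  by p, with opposite signs; every remaining divisor is divisible by p^2 and has Moebius value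
  0.\<close>

lemma sum_moebius_mu_divisors:
  assumes "n > 0"
  shows "(\<Sum>d | d dvd n. moebius_mu d) = (if n = 1 then 1 else 0)"
proof (cases "n = 1")
  case False
  then obtain p where p: "prime p" "p dvd n"
    using prime_factor_nat by blast
  let ?A = "{d. d dvd n \<and> \<not> p dvd d}"
  have fin: "finite {d. d dvd n}"
    using assms by simp
  have "(\<Sum>d | d dvd n. moebius_mu d) = (\<Sum>d\<in>?A \<union> (*) p ` ?A. moebius_mu d)"
  proof (rule sum.mono_neutral_right)
    have "p * d dvd n" if "d dvd n" "\<not> p dvd d" for d
      using that p by (simp add: divides_mult prime_imp_coprime)
    then show "?A \<union> (*) p ` ?A \<subseteq> {d. d dvd n}" by auto
    show "\<forall>d\<in>{d. d dvd n} - (?A \<union> (*) p ` ?A). moebius_mu d = 0"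
    proof
      fix d assume d: "d \<in> {d. d dvd n} - (?A \<union> (*) p ` ?A)"
      then obtain e where e: "d = p * e" by auto
      then have "e dvd n" "e > 0" using d assms by (auto dest: dvd_mult_right intro: Nat.gr0I)
      then show "moebius_mu d = 0"
        using d e p by (auto simp: moebius_mu_prime_times)
    qed
  qed (use fin in auto)
  also have "\<dots> = (\<Sum>d\<in>?A. moebius_mu d) + (\<Sum>d\<in>(*) p ` ?A. moebius_mu d)"
    using fin by (intro sum.union_disjoint) auto
  also have "(\<Sum>d\<in>(*) p ` ?A. moebius_mu d) = (\<Sum>d\<in>?A. moebius_mu (p * d))"
    using p by (subst sum.reindex) (auto simp: inj_on_def)
  also have "\<dots> = (\<Sum>d\<in>?A. - moebius_mu d)"
    using p assms by (intro sum.cong) (auto simp: moebius_mu_prime_times intro: Nat.gr0I)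
  finally show ?thesis using False by (simp add: sum_negf)
qed simp

definition sifted_upto :: "nat set \<Rightarrow> nat \<Rightarrow> nat set" where
  "sifted_upto P N = {n \<in> {1..N}. \<forall>p\<in>P. \<not> p dvd n}"

definition smooth_upto :: "nat set \<Rightarrow> nat \<Rightarrow> nat set" where
  "smooth_upto P N = {n \<in> {1..N}. prime_factors n \<subseteq> P}"

lemma finite_sifted_upto [simp]: "finite (sifted_upto P N)"
  by (simp add: sifted_upto_def)

lemma finite_smooth_upto [simp]: "finite (smooth_upto P N)"
  by (simp add: smooth_upto_def)

lemma sifted_upto_0 [simp]: "sifted_upto P 0 = {}"
  by (simp add: sifted_upto_def)

lemma smooth_upto_0 [simp]: "smooth_upto P 0 = {}"
  by (simp add: smooth_upto_def)

lemma card_sifted_upto_le: "card (sifted_upto P N) \<le> N"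
proof -
  have "sifted_upto P N \<subseteq> {1..N}" by (auto simp: sifted_upto_def)
  from card_mono[OF _ this] show ?thesis by simp
qed

lemma card_smooth_upto_le: "card (smooth_upto P N) \<le> N"
proof -
  have "smooth_upto P N \<subseteq> {1..N}" by (auto simp: smooth_upto_def)
  from card_mono[OF _ this] show ?thesis by simp
qed

lemma prime_dvd_prime_mult_iff:
  fixes p q n :: nat
  assumes "prime p" "prime q" "p \<noteq> q"
  shows "q dvd p * n \<longleftrightarrow> q dvd n"
  using assms by (metis prime_dvd_mult_iff primes_dvd_imp_eq)

lemma times_le_iff_le_div: "(p::nat) > 0 \<Longrightarrow> p * m \<le> N \<longleftrightarrow> m \<le> N div p"
  by (simp add: less_eq_div_iff_mult_less_eq mult.commute)

lemma sifted_upto_insert: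
  assumes "prime p" "p \<notin> P" "P \<subseteq> {p. prime p}"
  shows "sifted_upto P N = sifted_upto (insert p P) N \<union> (*) p ` sifted_upto P (N div p)"
    and "sifted_upto (insert p P) N \<inter> (*) p ` sifted_upto P (N div p) = {}"
proof -
  have *: "q dvd p * n \<longleftrightarrow> q dvd n" if "q \<in> P" for q n
    using that assms by (intro prime_dvd_prime_mult_iff) auto
  have "p > 0" using assms prime_gt_0_nat by blast
  then show "sifted_upto P N = sifted_upto (insert p P) N \<union> (*) p ` sifted_upto P (N div p)"
    using * by (auto simp: sifted_upto_def times_le_iff_le_div image_iff Suc_le_eq dvd_def[of p])
  show "sifted_upto (insert p P) N \<inter> (*) p ` sifted_upto P (N div p) = {}"
    by (auto simp: sifted_upto_def)
qed

lemma sum_sifted_upto_insert: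
  fixes f :: "nat \<Rightarrow> 'a :: comm_monoid_add"
  assumes "prime p" "p \<notin> P" "P \<subseteq> {p. prime p}"
  shows "sum f (sifted_upto P N) =
    sum f (sifted_upto (insert p P) N) + (\<Sum>m\<in>sifted_upto P (N div p). f (p * m))"
proof -
  have "inj_on ((*) p) (sifted_upto P (N div p))"
    using assms by (intro inj_onI) auto
  then show ?thesis
    using sifted_upto_insert[OF assms, of N]
    by (simp add: sum.union_disjoint sum.reindex)
qed

text \<open>The multiples of p among the sifted integers are p m with m in
  \<open>sifted_upto P (N div p)\<close>. Those with p dividing m have mu(p m) = 0, so m may be
  required to avoid p as well. Solved for its first sum on the right, this is a recursion for
  \<open>insert p P\<close> that refers to itself at \<open>N div p\<close>.\<close>

lemma sum_moebius_sifted_upto_insert: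
  fixes h :: "nat \<Rightarrow> real"
  assumes "prime p" "p \<notin> P" "P \<subseteq> {p. prime p}"
  shows "(\<Sum>n\<in>sifted_upto P N. moebius_mu n * h n) =
    (\<Sum>n\<in>sifted_upto (insert p P) N. moebius_mu n * h n) -
    (\<Sum>m\<in>sifted_upto (insert p P) (N div p). moebius_mu m * h (p * m))"
proof -
  have "(\<Sum>m\<in>sifted_upto P (N div p). moebius_mu (p * m) * h (p * m)) =
    (\<Sum>m\<in>sifted_upto (insert p P) (N div p). - (moebius_mu m * h (p * m)))"
    by (rule sum.mono_neutral_cong_right)
      (auto simp: sifted_upto_def moebius_mu_prime_times assms(1))
  then show ?thesis
    by (subst sum_sifted_upto_insert[OF assms]) (simp add: sum_negf)
qed

lemma smooth_upto_insert:
  assumes "prime p" "p \<notin> P"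
  shows "smooth_upto (insert p P) N = smooth_upto P N \<union> (*) p ` smooth_upto (insert p P) (N div p)"
    and "smooth_upto P N \<inter> (*) p ` smooth_upto (insert p P) (N div p) = {}"
proof -
  have "p > 0" using assms prime_gt_0_nat by blast
  have pf: "prime_factors (p * n) = insert p (prime_factors n)" if "n > 0" for n
    using assms that by (subst prime_factors_product) (auto simp: prime_prime_factors)
  show "smooth_upto P N \<inter> (*) p ` smooth_upto (insert p P) (N div p) = {}"
    using assms pf by (auto simp: smooth_upto_def Suc_le_eq)
  have "n \<in> smooth_upto P N \<or> n \<in> (*) p ` smooth_upto (insert p P) (N div p)"
    if n: "n \<in> smooth_upto (insert p P) N" for n
  proof (cases "p dvd n")
    case True
    then obtain m where "n = p * m" by blast
    then have "m \<in> smooth_upto (insert p P) (N div p)"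
      using n \<open>p > 0\<close> pf[of m] by (auto simp: smooth_upto_def times_le_iff_le_div Suc_le_eq)
    then show ?thesis using \<open>n = p * m\<close> by blast
  next
    case False
    then show ?thesis using n by (auto simp: smooth_upto_def)
  qed
  moreover have "n \<in> smooth_upto (insert p P) N"
    if "n \<in> smooth_upto P N \<union> (*) p ` smooth_upto (insert p P) (N div p)" for n
    using that pf \<open>p > 0\<close> by (auto simp: smooth_upto_def times_le_iff_le_div Suc_le_eq)
  ultimately show "smooth_upto (insert p P) N = smooth_upto P N \<union> (*) p ` smooth_upto (insert p P) (N div p)"
    by blast
qed

text \<open>Split by whether p divides n. The recursion has the same shape as the one for the
  Moebius sums, with \<open>insert p P\<close> again on the right.\<close>

lemma card_smooth_upto_insert:
  assumes "prime p" "p \<notin> P"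
  shows "card (smooth_upto (insert p P) N) = card (smooth_upto P N) + card (smooth_upto (insert p P) (N div p))"
proof -
  have "inj_on ((*) p) (smooth_upto (insert p P) (N div p))"
    using assms by (intro inj_onI) auto
  then show ?thesis
    using smooth_upto_insert[OF assms, of N] by (simp add: card_Un_disjoint card_image)
qed

lemma smooth_upto_empty: "N > 0 \<Longrightarrow> smooth_upto {} N = {1}"
  by (auto simp: smooth_upto_def prime_factorization_empty_iff)

definition sifted_mertens :: "nat set \<Rightarrow> nat \<Rightarrow> real" where
  "sifted_mertens P N = (\<Sum>n\<in>sifted_upto P N. moebius_mu n / n)"

lemma sifted_mertens_0 [simp]: "sifted_mertens P 0 = 0"
  by (simp add: sifted_mertens_def)

lemma sifted_mertens_insert:
  assumes "prime p" "p \<notin> P" "P \<subseteq> {p. prime p}"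
  shows "sifted_mertens (insert p P) N = sifted_mertens P N + sifted_mertens (insert p P) (N div p) / p"
  using sum_moebius_sifted_upto_insert[OF assms, of "\<lambda>n. 1 / n" N]
  by (simp add: sifted_mertens_def sum_divide_distrib mult.commute)

text \<open>floor(N/n) counts the multiples k <= N of n. After exchanging the sums, the sum of mu
  over the divisors of k is nonzero only for k = 1.\<close>

lemma sum_moebius_div_sifted_upto_empty:
  assumes "N > 0"
  shows "(\<Sum>n\<in>sifted_upto {} N. moebius_mu n * real (N div n)) = 1"
proof -
  have "(\<Sum>n\<in>sifted_upto {} N. moebius_mu n * (N div n)) = (1::int)"
  proof -
    have "(\<Sum>n\<in>sifted_upto {} N. moebius_mu n * int (N div n)) = 
      (\<Sum>n=1..N. \<Sum>k=1..N. if n dvd k then moebius_mu n else 0)"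
    proof (intro sum.cong)
      fix n assume "n \<in> {1..N}"
      then have "(\<Sum>k=1..N. if n dvd k then moebius_mu n else 0) = (\<Sum>k | k\<in>{1..N} \<and> n dvd k. moebius_mu n)"
        by (subst sum.inter_filter) auto
      also have "{k. k\<in>{1..N} \<and> n dvd k} = (*) n ` {1..N div n}"
        using \<open>n \<in> {1..N}\<close> by (auto simp: image_iff times_le_iff_le_div elim!: dvdE)
      also have "(\<Sum>k\<in>(*) n ` {1..N div n}. moebius_mu n) = moebius_mu n * int (N div n)"
        using \<open>n \<in> {1..N}\<close> by (subst sum.reindex) (auto simp: inj_on_def)
      finally show "moebius_mu n * int (N div n) = (\<Sum>k=1..N. if n dvd k then moebius_mu n else 0)" ..
    qed (auto simp: sifted_upto_def)
    also have "\<dots> = (\<Sum>k=1..N. \<Sum>n=1..N. if n dvd k then moebius_mu n else 0)"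
      by (rule sum.swap)
    also have "\<dots> = (\<Sum>k=1..N. if k = 1 then 1 else 0)"
    proof (intro sum.cong)
      fix k assume k: "k \<in> {1..N}"
      then have "(\<Sum>n=1..N. if n dvd k then moebius_mu n else 0) = (\<Sum>n | n \<in> {1..N} \<and> n dvd k. moebius_mu n)"
        by (subst sum.inter_filter) auto
      also have "{n. n \<in> {1..N} \<and> n dvd k} = {n. n dvd k}"
        using k by (auto dest: dvd_imp_le simp: Suc_le_eq intro: Nat.gr0I)
      finally show "(\<Sum>n=1..N. if n dvd k then moebius_mu n else 0) = (if k = 1 then 1 else 0)"
        using sum_moebius_mu_divisors[of k] k by simp
    qed auto
    finally show ?thesis using assms by simp
  qed
  then have "real_of_int (\<Sum>n\<in>sifted_upto {} N. moebius_mu n * (N div n)) = 1"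
    by simp
  then show ?thesis by simp
qed

text \<open>In terms of Dirichlet convolution: 1 convolved with mu restricted to the integers free
  of P is the indicator of the integers composed of primes of P. The proof checks that both sides
  obey the same recursion when a prime is inserted.\<close>

lemma sum_moebius_div_sifted_upto:
  assumes "finite P" "P \<subseteq> {p. prime p}"
  shows "(\<Sum>n\<in>sifted_upto P N. moebius_mu n * real (N div n)) = card (smooth_upto P N)"
  using assms
proof (induction P arbitrary: N rule: finite_induct)
  case empty
  then show ?case
    by (cases "N = 0") (simp_all add: sum_moebius_div_sifted_upto_empty smooth_upto_empty)
next
  case (insert p P)
  have p: "prime p" "p \<notin> P" "P \<subseteq> {p. prime p}"
    using insert by auto
  show ?case
  \<comment> \<open>The recursion for \<open>insert p P\<close> refers to itself at
    \<open>N div p\<close>, hence an inner induction on N.\<close>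
  proof (induction N rule: less_induct)
    case (less N)
    show ?case
    proof (cases "N = 0")
      case False
      then have "N div p < N"
        using prime_gt_1_nat[OF p(1)] by simp
      from less[OF this] show ?thesis
        using sum_moebius_sifted_upto_insert[OF p, of "\<lambda>n. real (N div n)" N]
          insert.IH[of N] insert.prems card_smooth_upto_insert[OF p(1,2), of N]
        by (simp add: div_mult2_eq)
    qed simp
  qed
qed

subsection \<open>The zeta function near the line of convergence\<close>

lemma norm_of_nat_powr: "norm (of_nat n powr z :: complex) = real n powr Re z"
  by (subst norm_powr_real_powr) auto

text \<open>Stated as an unordered sum over pairs because the Dirichlet product regroups the pairs
  by m n.\<close>

lemma has_sum_mult_pairs:
  fixes f g :: "nat \<Rightarrow> complex"
  assumes "summable (\<lambda>n. norm (f n))" "summable (\<lambda>n. norm (g n))"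
  shows "((\<lambda>(m, n). f m * g n) has_sum (suminf f * suminf g)) UNIV"
proof -
  have f: "(f has_sum suminf f) UNIV" and g: "(g has_sum suminf g) UNIV"
    using assms by (auto intro!: norm_summable_imp_has_sum dest: summable_norm_cancel)
  have nf: "(\<lambda>n. norm (f n)) summable_on UNIV" and ng: "(\<lambda>n. norm (g n)) summable_on UNIV"
    using assms by (auto intro: norm_summable_imp_summable_on)
  have "(\<lambda>x. norm (f (fst x) * g (snd x))) summable_on (SIGMA m:UNIV. UNIV)"
  proof (rule summable_on_SigmaI)
    show "((\<lambda>n. norm (f (fst (m, n)) * g (snd (m, n)))) has_sum norm (f m) * infsum (\<lambda>n. norm (g n)) UNIV) UNIV" for m
      using has_sum_cmult_right[OF has_sum_infsum[OF ng]] by (simp add: norm_mult)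
    show "(\<lambda>m. norm (f m) * infsum (\<lambda>n. norm (g n)) UNIV) summable_on UNIV"
      using nf by (rule summable_on_cmult_left)
  qed auto
  then have "(\<lambda>x. f (fst x) * g (snd x)) summable_on (UNIV :: (nat \<times> nat) set)"
    by (rule_tac abs_summable_summable) simp
  then have "(\<lambda>(m, n). f m * g n) summable_on UNIV"
    by (simp add: case_prod_unfold)
  then obtain X where X: "((\<lambda>(m, n). f m * g n) has_sum X) UNIV"
    using summable_on_def by blast
  then have "((\<lambda>(m, n). f m * g n) has_sum X) (SIGMA m:UNIV. UNIV)"
    by simp
  then have "((\<lambda>m. f m * suminf g) has_sum X) UNIV"
    by (rule has_sum_SigmaD[where f = "\<lambda>(m, n). f m * g n" and A = UNIV and B = "\<lambda>_. UNIV"])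
      (use has_sum_cmult_right[OF g] in auto)
  then have "X = suminf f * suminf g"
    using has_sum_cmult_left[OF f] by (rule has_sum_unique)
  with X show "((\<lambda>(m, n). f m * g n) has_sum (suminf f * suminf g)) UNIV" by simp
qed

lemma dirichlet_series_mult:
  fixes a b :: "nat \<Rightarrow> complex" and s :: complex
  assumes "summable (\<lambda>n. norm (a n * of_nat n powr s))" "summable (\<lambda>n. norm (b n * of_nat n powr s))"
  shows "(\<lambda>n. dirichlet_conv a b n * of_nat n powr s) sums
    ((\<Sum>n. a n * of_nat n powr s) * (\<Sum>n. b n * of_nat n powr s))"
proof -
  let ?f = "\<lambda>n. a n * of_nat n powr s" and ?g = "\<lambda>n. b n * of_nat n powr s"
  let ?P = "{0<..} \<times> {0<..} :: (nat \<times> nat) set"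
  let ?D = "SIGMA n:{0<..}::nat set. {d::nat. d dvd n}"
  have "((\<lambda>(m, n). ?f m * ?g n) has_sum (suminf ?f * suminf ?g)) UNIV"
    using has_sum_mult_pairs[OF assms] .
  \<comment> \<open>Terms with an index 0 vanish because 0 powr s = 0. The remaining pairs (m, n)
    correspond to m n together with its divisor m.\<close>
  also have "?this \<longleftrightarrow> ((\<lambda>(m, n). ?f m * ?g n) has_sum (suminf ?f * suminf ?g)) ?P"
    by (rule has_sum_cong_neutral) auto
  also have "\<dots> \<longleftrightarrow> ((\<lambda>(n, d). ?f d * ?g (n div d)) has_sum (suminf ?f * suminf ?g)) ?D"
    by (rule has_sum_reindex_bij_witness[of _ "\<lambda>(n, d). (d, n div d)" "\<lambda>(m, n). (m * n, m)"])
      (auto elim!: dvdE)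
  finally have "((\<lambda>n. \<Sum>d | d dvd n. ?f d * ?g (n div d)) has_sum (suminf ?f * suminf ?g)) {0<..}"
    by (rule has_sum_SigmaD) (auto intro: has_sum_finiteI)
  also have "?this \<longleftrightarrow> ((\<lambda>n. dirichlet_conv a b n * of_nat n powr s) has_sum (suminf ?f * suminf ?g)) UNIV"
  proof (rule has_sum_cong_neutral)
    fix n :: nat assume n: "n \<in> {0<..} \<inter> UNIV"
    show "(\<Sum>d | d dvd n. ?f d * ?g (n div d)) = dirichlet_conv a b n * of_nat n powr s"
      unfolding dirichlet_conv_def sum_distrib_right
    proof (rule sum.cong[OF refl])
      fix d assume "d \<in> {d. d dvd n}"
      then obtain k where k: "n = d * k" by blast
      then have "d > 0" using n by (auto intro!: Nat.gr0I)
      have "(of_nat n :: complex) powr s = of_nat d powr s * of_nat k powr s"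
        unfolding k of_nat_mult by (rule powr_times_real) auto
      then show "?f d * ?g (n div d) = a d * b (n div d) * of_nat n powr s"
        using \<open>d > 0\<close> by (simp add: k)
    qed
  qed auto
  finally show ?thesis by (rule has_sum_imp_sums)
qed

lemma summable_norm_of_nat_powr:
  assumes "Re s < - 1" "\<And>n. norm (a n) \<le> B"
  shows "summable (\<lambda>n. norm (a n * of_nat n powr s :: complex))"
proof (rule summable_comparison_test)
  show "summable (\<lambda>n. B * real n powr Re s)"
    using assms by (intro summable_mult) (simp add: summable_real_powr_iff)
  show "\<exists>N. \<forall>n\<ge>N. norm (norm (a n * of_nat n powr s)) \<le> B * real n powr Re s"
    using assms(2) by (auto simp: norm_mult norm_of_nat_powr intro!: mult_right_mono)
qed

lemma summable_norm_ln_of_nat_powr: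
  assumes "Re s < - 1" "\<And>n. norm (a n) \<le> ln (real n)"
  shows "summable (\<lambda>n. norm (a n * of_nat n powr s :: complex))"
proof (rule summable_comparison_test)
  \<comment> \<open>Half of the room below -1 pays for the logarithm, through ln n <= n^e /
    e.\<close>
  define e where "e = (- 1 - Re s) / 2"
  have e: "e > 0" using assms(1) by (simp add: e_def)
  show "summable (\<lambda>n. 1 / e * real n powr (Re s + e))"
    using assms by (intro summable_mult) (simp add: summable_real_powr_iff e_def field_simps)
  show "\<exists>N. \<forall>n\<ge>N. norm (norm (a n * of_nat n powr s)) \<le> 1 / e * real n powr (Re s + e)"
  proof (intro exI allI impI)
    fix n :: nat assume n: "n \<ge> 1"
    have "norm (a n) \<le> real n powr e / e"
      using assms(2)[of n] ln_powr_bound[of "real n" e] n e by simp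
    then have "norm (a n) * real n powr Re s \<le> real n powr e / e * real n powr Re s"
      by (intro mult_right_mono) auto
    then show "norm (norm (a n * of_nat n powr s)) \<le> 1 / e * real n powr (Re s + e)"
      by (simp add: norm_mult norm_of_nat_powr powr_add mult.commute)
  qed
qed

text \<open>With n = k + 1 this is z times the difference between n^(-1-z) and the integral of
  t^(-1-z) over [n, n+1]. Writing the integral as a difference of powers avoids a division by
  z.\<close>

definition zeta_tail :: "nat \<Rightarrow> complex \<Rightarrow> complex" where
  "zeta_tail k z = z * of_nat (Suc k) powr (- 1 - z) +
    (of_nat (Suc (Suc k)) powr (- z) - of_nat (Suc k) powr (- z))"

text \<open>The mean value inequality, applied twice, gains two powers of n over n^(-z). This is
  what makes the tails summable as far as Re z > -1.\<close>

lemma norm_zeta_tail_le: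
  assumes "Re z > - 1"
  shows "norm (zeta_tail k z) \<le> norm z * norm (1 + z) * real (Suc k) powr (- 2 - Re z)"
proof -
  define n where "n = real (Suc k)"
  have n: "n \<ge> 1" by (simp add: n_def)
  let ?S = "closed_segment (of_real n) (of_real (n + 1)) :: complex set"
  have S: "\<exists>u. w = of_real u \<and> n \<le> u \<and> u \<le> n + 1" if "w \<in> ?S" for w
    using that unfolding closed_segment_of_real closed_segment_eq_real_ivl by auto
  have nonpos: "w \<notin> \<real>\<^sub>\<le>\<^sub>0" if "w \<in> ?S" for w
    using S[OF that] n by auto
  have norm_le: "norm (w powr (- 2 - z)) \<le> n powr (- 2 - Re z)" if w: "w \<in> ?S" for w
  proof -
    obtain u where u: "w = of_real u" "n \<le> u" using S[OF w] by blast
    then have "norm (w powr (- 2 - z)) = u powr (- 2 - Re z)"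
      using n by (subst norm_powr_real_powr) auto
    also have "\<dots> \<le> n powr (- 2 - Re z)"
      using n u assms by (intro powr_mono2') auto
    finally show ?thesis .
  qed
  have dist: "norm (w - of_real n) \<le> 1" if w: "w \<in> ?S" for w
  proof -
    obtain u where u: "w = of_real u" "n \<le> u" "u \<le> n + 1" using S[OF w] by blast
    then have "w - of_real n = of_real (u - n)" by simp
    then show ?thesis using u by (simp only: norm_of_real)
  qed
  have 1: "norm (w powr (- 1 - z) - of_real n powr (- 1 - z)) \<le> norm (1 + z) * n powr (- 2 - Re z)"
    if w: "w \<in> ?S" for w
  proof -
    have "norm (w powr (- 1 - z) - of_real n powr (- 1 - z)) \<le>
        norm (1 + z) * n powr (- 2 - Re z) * norm (w - of_real n)"
    proof (rule field_differentiable_bound[where S = ?S and f' = "\<lambda>w. (- 1 - z) * w powr (- 1 - z - 1)"])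
      fix v assume v: "v \<in> ?S"
      show "((\<lambda>w. w powr (- 1 - z)) has_field_derivative (- 1 - z) * v powr (- 1 - z - 1)) (at v within ?S)"
        using nonpos[OF v] by (rule has_field_derivative_at_within[OF has_field_derivative_powr])
      have "- 1 - z = - (1 + z)" by simp
      then have "norm (- 1 - z) = norm (1 + z)" by (simp only: norm_minus_cancel)
      moreover have "- 1 - z - 1 = - 2 - z" by simp
      ultimately show "norm ((- 1 - z) * v powr (- 1 - z - 1)) \<le> norm (1 + z) * n powr (- 2 - Re z)"
        using norm_le[OF v] by (simp only: norm_mult) (intro mult_left_mono, auto)
    qed (use w in auto)
    also have "\<dots> \<le> norm (1 + z) * n powr (- 2 - Re z) * 1"
      using dist[OF w] by (intro mult_left_mono) auto
    finally show ?thesis by simp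
  qed
  \<comment> \<open>Chosen so that the increment of \<psi> from n to n + 1 is
    \<open>zeta_tail k z\<close> and its derivative vanishes at n; the derivative is then bounded by
    the first application.\<close>
  define \<psi> where "\<psi> = (\<lambda>w. w powr (- z) + z * of_real n powr (- 1 - z) * w)"
  have "norm (\<psi> (of_real (n + 1)) - \<psi> (of_real n)) \<le>
      norm z * (norm (1 + z) * n powr (- 2 - Re z)) * norm (of_real (n + 1) - of_real n :: complex)"
  proof (rule field_differentiable_bound[where S = ?S and
        f' = "\<lambda>w. - z * w powr (- z - 1) + z * of_real n powr (- 1 - z)"])
    fix v assume v: "v \<in> ?S"
    show "(\<psi> has_field_derivative - z * v powr (- z - 1) + z * of_real n powr (- 1 - z)) (at v within ?S)"
      unfolding \<psi>_def using nonpos[OF v]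
      by (intro DERIV_add has_field_derivative_at_within[OF has_field_derivative_powr] DERIV_cmult_Id)
    have "- z * v powr (- z - 1) + z * of_real n powr (- 1 - z) =
        - z * (v powr (- 1 - z) - of_real n powr (- 1 - z))"
    proof -
      have "- z - 1 = - 1 - z" by simp
      then show ?thesis by (simp only: right_diff_distrib) simp
    qed
    then show "norm (- z * v powr (- z - 1) + z * of_real n powr (- 1 - z)) \<le>
        norm z * (norm (1 + z) * n powr (- 2 - Re z))"
      using 1[OF v] by (simp only: norm_mult norm_minus_cancel) (intro mult_left_mono, auto)
  qed auto
  also have "norm (of_real (n + 1) - of_real n :: complex) = 1" by simp
  also have "\<psi> (of_real (n + 1)) - \<psi> (of_real n) = zeta_tail k z"
    by (simp add: \<psi>_def zeta_tail_def n_def algebra_simps)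
  finally show ?thesis by (simp add: n_def)
qed

text \<open>The function \<open>z \<zeta>(1 + z)\<close>, continued beyond the half-plane \<open>Re z > 0\<close>.\<close>
definition zeta_reg :: "complex \<Rightarrow> complex" where
  "zeta_reg z = 1 + (\<Sum>k. zeta_tail k z)"

lemma holomorphic_zeta_reg: "zeta_reg holomorphic_on {z. Re z > - 1}"
proof (rule holomorphic_uniform_sequence)
  show "open {z. Re z > - 1}" by (rule open_halfspace_Re_gt)
  show "(\<lambda>z. 1 + (\<Sum>k<n. zeta_tail k z)) holomorphic_on {z. Re z > - 1}" for n
    unfolding zeta_tail_def by (intro holomorphic_intros)
  fix x assume x: "x \<in> {z. Re z > - 1}"
  \<comment> \<open>Half the distance to the line Re z = -1: on the disc of radius d the real part
    stays at least c = Re x - d > -1.\<close>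
  define d where "d = (Re x + 1) / 2"
  define c where "c = (Re x - 1) / 2"
  have d: "d > 0" using x by (simp add: d_def)
  have c: "c > - 1" using x by (simp add: c_def)
  have Re: "Re z \<ge> c" if "z \<in> cball x d" for z
    using that abs_Re_le_cmod[of "x - z"] by (simp add: dist_norm c_def d_def field_simps)
  show "\<exists>d>0. cball x d \<subseteq> {z. Re z > - 1} \<and>
      uniform_limit (cball x d) (\<lambda>n z. 1 + (\<Sum>k<n. zeta_tail k z)) zeta_reg sequentially"
  proof (intro exI conjI)
    show "d > 0" by (rule d)
    show "cball x d \<subseteq> {z. Re z > - 1}" using Re c by force
    have "uniform_limit (cball x d) (\<lambda>n z. \<Sum>k<n. zeta_tail k z) (\<lambda>z. \<Sum>k. zeta_tail k z) sequentially"
    proof (rule Weierstrass_m_test)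
      fix k z assume z: "z \<in> cball x d"
      have nz: "norm z \<le> norm x + d"
        using z norm_triangle_ineq4[of x "x - z"] by (simp add: dist_norm)
      have "norm (zeta_tail k z) \<le> norm z * norm (1 + z) * real (Suc k) powr (- 2 - Re z)"
        using Re[OF z] c by (intro norm_zeta_tail_le) simp
      also have "\<dots> \<le> (norm x + d) * (1 + (norm x + d)) * real (Suc k) powr (- 2 - c)"
        using nz d Re[OF z] norm_triangle_ineq[of 1 z]
        by (intro mult_mono powr_mono) auto
      finally show "norm (zeta_tail k z) \<le> (norm x + d) * (1 + (norm x + d)) * real (Suc k) powr (- 2 - c)" .
    next
      have "summable (\<lambda>k. real k powr (- 2 - c))"
        using c by (simp add: summable_real_powr_iff)
      then show "summable (\<lambda>k. (norm x + d) * (1 + (norm x + d)) * real (Suc k) powr (- 2 - c))"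
        by (intro summable_mult) (subst summable_Suc_iff)
    qed
    then show "uniform_limit (cball x d) (\<lambda>n z. 1 + (\<Sum>k<n. zeta_tail k z)) zeta_reg sequentially"
      unfolding zeta_reg_def by (intro uniform_limit_add uniform_limit_const)
  qed
qed

text \<open>The simple pole of zeta at 1 has residue 1.\<close>

lemma zeta_reg_0 [simp]: "zeta_reg 0 = 1"
proof -
  have "zeta_tail k 0 = 0" for k
    unfolding zeta_tail_def by (simp del: of_nat_Suc)
  then show ?thesis by (simp add: zeta_reg_def)
qed

lemma zeta_reg_eq:
  assumes "Re z > 0"
  shows "zeta_reg z = z * (\<Sum>n. of_nat n powr (- 1 - z))"
proof -
  have "summable (\<lambda>n. norm (1 * of_nat n powr (- 1 - z) :: complex))"
    using assms by (intro summable_norm_of_nat_powr[of _ _ 1]) auto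
  then have "summable (\<lambda>n. of_nat n powr (- 1 - z) :: complex)"
    by (auto dest: summable_norm_cancel)
  then have "(\<lambda>n. of_nat n powr (- 1 - z)) sums (\<Sum>n. of_nat n powr (- 1 - z) :: complex)"
    by (rule summable_sums)
  then have "(\<lambda>k. of_nat (Suc k) powr (- 1 - z)) sums (\<Sum>n. of_nat n powr (- 1 - z) :: complex)"
    by (subst sums_Suc_iff) simp
  then have 1: "(\<lambda>k. z * of_nat (Suc k) powr (- 1 - z)) sums (z * (\<Sum>n. of_nat n powr (- 1 - z)))"
    by (rule sums_mult)
  have "(\<lambda>k. of_nat (Suc k) powr (- z) :: complex) \<longlonglongrightarrow> 0"
  proof (rule Lim_null_comparison[OF always_eventually])
    show "\<forall>k. norm (of_nat (Suc k) powr (- z) :: complex) \<le> real (Suc k) powr (- Re z)"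
      by (simp add: norm_of_nat_powr del: of_nat_Suc)
    show "(\<lambda>k. real (Suc k) powr (- Re z)) \<longlonglongrightarrow> 0"
      using assms by real_asymp
  qed
  from telescope_sums[OF this]
  have "(\<lambda>k. of_nat (Suc (Suc k)) powr (- z) - of_nat (Suc k) powr (- z)) sums (0 - 1 :: complex)"
    by simp
  from sums_add[OF 1 this] have "(\<lambda>k. zeta_tail k z) sums (z * (\<Sum>n. of_nat n powr (- 1 - z)) - 1)"
    by (simp add: zeta_tail_def)
  then show ?thesis by (simp add: zeta_reg_def sums_iff)
qed

section \<open>The series of mu and of the von Mangoldt function to the right of the line\<close>

lemma norm_moebius_mu_le: "norm (of_int (moebius_mu n) :: complex) \<le> 1"
  using abs_moebius_mu_le[of n] by (simp add: norm_of_int)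

lemma dirichlet_conv_one:
  fixes f :: "nat \<Rightarrow> 'a :: comm_semiring_1"
  assumes "n > 0"
  shows "dirichlet_conv (\<lambda>_. 1) f n = (\<Sum>d | d dvd n. f d)"
  unfolding dirichlet_conv_def mult_1_left
  by (rule sum.reindex_bij_witness[of _ "\<lambda>d. n div d" "\<lambda>d. n div d"]) (use assms in auto)

lemma norm_mangoldt_le: "norm (mangoldt n :: complex) \<le> ln (real n)"
  using mangoldt_le[of n] by (cases "n = 0") auto

lemma summable_norm_zeta:
  assumes "Re z > 0"
  shows "summable (\<lambda>n. norm (1 * of_nat n powr (- 1 - z) :: complex))"
  using assms by (intro summable_norm_of_nat_powr[of _ _ 1]) auto

text \<open>The convolution of 1 with mu is the unit, so the product with the zeta series is 1. This
  gives the value 1 / zeta(1 + z) and, at the same time, nonvanishing for Re z > 0.\<close>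

lemma moebius_series_sums:
  assumes "Re z > 0"
  shows "zeta_reg z \<noteq> 0"
    and "(\<lambda>n. of_int (moebius_mu n) * of_nat n powr (- 1 - z)) sums (z / zeta_reg z)"
proof -
  let ?M = "\<Sum>n. of_int (moebius_mu n) * of_nat n powr (- 1 - z) :: complex"
  let ?Z = "\<Sum>n. 1 * of_nat n powr (- 1 - z) :: complex"
  have sm: "summable (\<lambda>n. norm (of_int (moebius_mu n) * of_nat n powr (- 1 - z) :: complex))"
    using assms norm_moebius_mu_le by (intro summable_norm_of_nat_powr[of _ _ 1]) auto
  have "dirichlet_conv (\<lambda>_. 1) (\<lambda>n. of_int (moebius_mu n)) n * of_nat n powr (- 1 - z) =
      (if n = 1 then 1 else 0 :: complex)" for n
  proof (cases "n = 0")
    case False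
    then have "dirichlet_conv (\<lambda>_. 1) (\<lambda>n. of_int (moebius_mu n) :: complex) n =
        of_int (\<Sum>d | d dvd n. moebius_mu d)"
      by (simp add: dirichlet_conv_one)
    then show ?thesis
      using sum_moebius_mu_divisors[of n] False by auto
  qed auto
  then have "(\<lambda>n. if n = 1 then 1 else 0 :: complex) sums (?Z * ?M)"
    using dirichlet_series_mult[OF summable_norm_zeta[OF assms] sm] by simp
  moreover have "(\<lambda>n. if n = 1 then 1 else 0 :: complex) sums 1"
    using sums_If_finite_set[of "{1}" "\<lambda>_. 1 :: complex"] by simp
  ultimately have "?Z * ?M = 1" using sums_unique2 by blast
  then have zM: "zeta_reg z * ?M = z"
    by (simp add: zeta_reg_eq[OF assms])
  have "z \<noteq> 0" using assms by auto
  then show nz: "zeta_reg z \<noteq> 0" using zM by auto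
  have "(\<lambda>n. of_int (moebius_mu n) * of_nat n powr (- 1 - z)) sums ?M"
    using sm by (rule summable_sums[OF summable_norm_cancel])
  also have "?M = z / zeta_reg z"
    using zM nz by (simp add: eq_divide_eq mult.commute)
  finally show "(\<lambda>n. of_int (moebius_mu n) * of_nat n powr (- 1 - z)) sums (z / zeta_reg z)" .
qed

lemma zeta_series_has_field_derivative:
  assumes "Re z > 0"
  shows "((\<lambda>z. \<Sum>n. of_nat n powr (- 1 - z)) has_field_derivative
    - (\<Sum>n. of_real (ln (real n)) * of_nat n powr (- 1 - z))) (at z :: complex filter)"
proof -
  let ?S = "{z::complex. Re z > 0}"
  let ?f = "\<lambda>n z. of_nat n powr (- 1 - z) :: complex"
  let ?f' = "\<lambda>n z. - (of_real (ln (real n)) * of_nat n powr (- 1 - z)) :: complex"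
  have "\<exists>g g'. \<forall>x\<in>?S. (\<lambda>n. ?f n x) sums g x \<and> (\<lambda>n. ?f' n x) sums g' x \<and> (g has_field_derivative g' x) (at x)"
  proof (rule series_and_derivative_comparison_complex)
    show "open ?S" by (rule open_halfspace_Re_gt)
    show "(?f n has_field_derivative ?f' n x) (at x)" for n x
    proof (cases "n = 0")
      case False
      have "(?f n has_field_derivative (Ln (of_nat n) * of_nat n powr (- 1 - x)) * (0 - 1)) (at x)"
        by (rule DERIV_chain'[where f = "\<lambda>x. - 1 - x"])
          (use False in \<open>auto intro!: derivative_eq_intros has_field_derivative_powr_right\<close>)
      moreover have "Ln (of_nat n :: complex) = of_real (ln (real n))"
        using False by (simp add: Ln_of_nat)
      ultimately show ?thesis by simp
    qed simp
    fix x assume x: "x \<in> ?S"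
    \<comment> \<open>On the disc of radius Re x / 2 about x the real part stays at least Re x / 2,
      which gives this majorant.\<close>
    let ?h = "\<lambda>n. of_real (real n powr (- 1 - Re x / 2)) :: complex"
    show "\<exists>d h. 0 < d \<and> summable h \<and> range h \<subseteq> \<real>\<^sub>\<ge>\<^sub>0 \<and>
        (\<forall>\<^sub>F n in sequentially. \<forall>y\<in>ball x d \<inter> ?S. norm (?f n y) \<le> norm (h n :: complex))"
    proof (intro exI conjI)
      show "Re x / 2 > 0" using x by simp
      show "summable ?h"
        using x by (subst summable_complex_of_real) (simp add: summable_real_powr_iff)
      show "range ?h \<subseteq> \<real>\<^sub>\<ge>\<^sub>0" by auto
      show "\<forall>\<^sub>F n in sequentially. \<forall>y\<in>ball x (Re x / 2) \<inter> ?S. norm (?f n y) \<le> norm (?h n)"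
        using eventually_ge_at_top[of 1]
      proof eventually_elim
        case (elim n)
        show ?case
        proof
          fix y assume y: "y \<in> ball x (Re x / 2) \<inter> ?S"
          then have "Re y \<ge> Re x / 2"
            using abs_Re_le_cmod[of "x - y"] by (simp add: dist_norm) linarith
          then have "real n powr (- 1 - Re y) \<le> real n powr (- 1 - Re x / 2)"
            using elim by (intro powr_mono) auto
          then show "norm (?f n y) \<le> norm (?h n)"
            by (simp add: norm_of_nat_powr)
        qed
      qed
    qed
  qed
  then obtain g g' where g: "\<And>x. x \<in> ?S \<Longrightarrow> (\<lambda>n. ?f n x) sums g x"
    "\<And>x. x \<in> ?S \<Longrightarrow> (\<lambda>n. ?f' n x) sums g' x"
    "\<And>x. x \<in> ?S \<Longrightarrow> (g has_field_derivative g' x) (at x)" by blast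
  have z: "z \<in> ?S" using assms by simp
  have "(\<lambda>n. - ?f' n z) sums (- g' z)" using g(2)[OF z] by (rule sums_minus)
  then have "g' z = - (\<Sum>n. of_real (ln (real n)) * of_nat n powr (- 1 - z))"
    by (simp add: sums_iff)
  moreover have "((\<lambda>z. \<Sum>n. ?f n z) has_field_derivative g' z) (at z)"
  proof (rule has_field_derivative_transform_within_open[OF g(3)[OF z]])
    show "open ?S" by (rule open_halfspace_Re_gt)
    show "g x = (\<Sum>n. ?f n x)" if "x \<in> ?S" for x
      using g(1)[OF that] by (simp add: sums_iff)
  qed (rule z)
  ultimately show ?thesis by simp
qed

text \<open>As 1 convolved with the von Mangoldt function is ln, the series is -zeta'/zeta at 1 + z.
  The summand 1 / z comes from the factor z in \<open>zeta_reg\<close>.\<close>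

lemma mangoldt_series_sums:
  assumes "Re z > 0"
  shows "(\<lambda>n. mangoldt n * of_nat n powr (- 1 - z)) sums (1 / z - deriv zeta_reg z / zeta_reg z)"
proof -
  let ?Z = "\<lambda>z. \<Sum>n. of_nat n powr (- 1 - z) :: complex"
  let ?L = "\<Sum>n. mangoldt n * of_nat n powr (- 1 - z) :: complex"
  let ?D = "\<Sum>n. of_real (ln (real n)) * of_nat n powr (- 1 - z) :: complex"
  have sm: "summable (\<lambda>n. norm (mangoldt n * of_nat n powr (- 1 - z) :: complex))"
    using assms norm_mangoldt_le by (intro summable_norm_ln_of_nat_powr) auto
  have "dirichlet_conv (\<lambda>_. 1) mangoldt n * of_nat n powr (- 1 - z) =
      of_real (ln (real n)) * of_nat n powr (- 1 - z)" for n
    by (cases "n = 0") (simp_all add: dirichlet_conv_one mangoldt_sum)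
  then have "(\<lambda>n. of_real (ln (real n)) * of_nat n powr (- 1 - z)) sums (?Z z * ?L)"
    using dirichlet_series_mult[OF summable_norm_zeta[OF assms] sm] by (simp only: mult_1_left)
  then have "?D = ?Z z * ?L" by (simp add: sums_iff)
  then have "(?Z has_field_derivative - (?Z z * ?L)) (at z)"
    using zeta_series_has_field_derivative[OF assms] by simp
  from DERIV_mult[OF DERIV_ident this]
  have "((\<lambda>z. z * ?Z z) has_field_derivative ?Z z - z * (?Z z * ?L)) (at z)"
    by (simp add: algebra_simps)
  then have "(zeta_reg has_field_derivative ?Z z - z * (?Z z * ?L)) (at z)"
    by (rule has_field_derivative_transform_within_open[OF _ open_halfspace_Re_gt[of 0]])
      (use assms in \<open>auto simp: zeta_reg_eq\<close>)
  then have "deriv zeta_reg z = ?Z z - z * (?Z z * ?L)"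
    by (rule DERIV_imp_deriv)
  moreover have "?Z z \<noteq> 0" "z \<noteq> 0"
    using moebius_series_sums(1)[OF assms] assms by (auto simp: zeta_reg_eq)
  ultimately have "1 / z - deriv zeta_reg z / zeta_reg z = ?L"
    using assms by (simp add: zeta_reg_eq field_simps)
  then show ?thesis
    using summable_sums[OF summable_norm_cancel[OF sm]] by simp
qed

subsection \<open>Nonvanishing on the line\<close>

lemma tendsto_of_real_at_right_0:
  assumes "isCont f w"
  shows "((\<lambda>x. f (w + of_real x)) \<longlongrightarrow> f (w :: complex)) (at_right 0)"
proof -
  have "((\<lambda>x. w + of_real x) \<longlongrightarrow> w + of_real 0) (at_right 0)"
    by (intro tendsto_intros)
  then have "((\<lambda>x. f (w + of_real x)) \<longlongrightarrow> f (w + of_real 0)) (at_right 0)"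
    by (rule isCont_tendsto_compose[rotated]) (use assms in simp)
  then show ?thesis by simp
qed

text \<open>The limit \<open>k\<close> is the order of vanishing of \<open>f\<close> at \<open>w\<close>.\<close>
lemma logarithmic_derivative_limit:
  assumes f: "f holomorphic_on S" "open S" "connected S" "w \<in> S" and "v \<in> S" "f v \<noteq> 0"
  obtains k :: nat where "f w = 0 \<Longrightarrow> k > 0" "f w \<noteq> 0 \<Longrightarrow> k = 0"
    "((\<lambda>x. of_real x * (deriv f (w + of_real x) / f (w + of_real x))) \<longlongrightarrow> of_nat k) (at_right 0)"
proof -
  \<comment> \<open>Near w, f(v) = (v - w)^k g(v) with g free of zeros. The logarithmic derivative
    is then k / (v - w) + g'/g, and multiplication by x = v - w leaves k in the limit.\<close>
  obtain g r k where r: "0 < r" "ball w r \<subseteq> S" and g: "g holomorphic_on ball w r"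
    and fg: "\<And>v. v \<in> ball w r \<Longrightarrow> f v = (v - w) ^ k * g v"
    and g0: "\<And>v. v \<in> ball w r \<Longrightarrow> g v \<noteq> 0"
    and k: "f w = 0 \<Longrightarrow> k > 0" "f w \<noteq> 0 \<Longrightarrow> k = 0"
  proof (cases "f w = 0")
    case True
    then have "\<not> f constant_on S"
      using f(4) assms(5,6) unfolding constant_on_def by metis
    from holomorphic_factor_zero_nonconstant[OF f(1-4) True this] show ?thesis
      using that True by metis
  next
    case False
    have "continuous_on S f" using f(1) by (rule holomorphic_on_imp_continuous_on)
    then have "open (S \<inter> f -` (- {0}))"
      using f(2) by (intro continuous_open_preimage) auto
    then obtain r where r: "r > 0" "ball w r \<subseteq> S \<inter> f -` (- {0})"
      using False f(4) open_contains_ball by blast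
    show ?thesis
    proof (rule that[where g = f and r = r and k = 0])
      show "f holomorphic_on ball w r"
        using f(1) r(2) by (auto elim: holomorphic_on_subset)
    qed (use r False in auto)
  qed
  have cont: "isCont (\<lambda>v. deriv g v / g v) w"
  proof (rule isCont_divide)
    show "isCont g w"
      using g r(1) by (intro holomorphic_on_imp_continuous_on[THEN continuous_on_interior]) auto
    show "isCont (deriv g) w"
      using g r(1) by (intro holomorphic_on_imp_continuous_on[THEN continuous_on_interior] holomorphic_deriv) auto
    show "g w \<noteq> 0" using g0 r(1) by simp
  qed
  have "((\<lambda>x. of_nat k + of_real x * (deriv g (w + of_real x) / g (w + of_real x))) \<longlongrightarrow>
      of_nat k + of_real 0 * (deriv g w / g w)) (at_right 0)"
    by (intro tendsto_intros tendsto_of_real_at_right_0[OF cont])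
  moreover have "\<forall>\<^sub>F x in at_right 0. of_nat k + of_real x * (deriv g (w + of_real x) / g (w + of_real x)) =
      of_real x * (deriv f (w + of_real x) / f (w + of_real x))"
    using eventually_at_right_real[OF r(1)]
  proof eventually_elim
    case (elim x)
    define v where "v = w + of_real x"
    have v: "v \<in> ball w r" "v \<noteq> w" using elim by (auto simp: v_def dist_norm)
    have "(g has_field_derivative deriv g v) (at v)"
      using g v by (intro holomorphic_derivI) auto
    then have "((\<lambda>v. (v - w) ^ k * g v) has_field_derivative
        (of_nat k * (v - w) ^ (k - 1)) * g v + (v - w) ^ k * deriv g v) (at v)"
      by (auto intro!: derivative_eq_intros)
    then have "(f has_field_derivative
        (of_nat k * (v - w) ^ (k - 1)) * g v + (v - w) ^ k * deriv g v) (at v)"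
      by (rule has_field_derivative_transform_within_open[where S = "ball w r"]) (use v fg in auto)
    then have df: "deriv f v = (of_nat k * (v - w) ^ (k - 1)) * g v + (v - w) ^ k * deriv g v"
      by (rule DERIV_imp_deriv)
    have fv: "f v = (v - w) ^ k * g v" "g v \<noteq> 0" using fg g0 v by auto
    have "(v - w) * (deriv f v / f v) =
        (of_nat k * ((v - w) * (v - w) ^ (k - 1))) / (v - w) ^ k + (v - w) * (deriv g v / g v)"
    proof -
      have "a * ((K * q * G + P * G') / (P * G)) = K * (a * q) / P + a * (G' / G)"
        if "P \<noteq> 0" "G \<noteq> 0" for a K q P G G' :: complex
        using that by (simp add: field_simps)
      then show ?thesis
        unfolding df fv(1) using fv(2) v by simp
    qed
    \<comment> \<open>For k = 0 the truncated exponent k - 1 does no harm, since the factor k is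
      0.\<close>
    also have "of_nat k * ((v - w) * (v - w) ^ (k - 1)) / (v - w) ^ k = of_nat k"
      using v by (cases k) auto
    finally show ?case unfolding v_def by simp
  qed
  ultimately have "((\<lambda>x. of_real x * (deriv f (w + of_real x) / f (w + of_real x))) \<longlongrightarrow> of_nat k) (at_right 0)"
    by (force intro: Lim_transform_eventually)
  with k that show ?thesis by blast
qed

lemma cos_3_4_1: "3 + 4 * cos t + cos (2 * t) \<ge> (0::real)"
proof -
  have "3 + 4 * cos t + cos (2 * t) = 2 * (1 + cos t) ^ 2"
    by (subst cos_double_cos) (simp add: power2_eq_square algebra_simps)
  then show ?thesis by simp
qed

text \<open>The real part of the n-th term is a nonnegative coefficient times 3 + 4 cos u + cos 2u =
  2 (1 + cos u)^2, where u = t ln n.\<close>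

lemma mangoldt_series_3_4_1:
  assumes "x > 0"
  defines "L \<equiv> \<lambda>z. \<Sum>n. mangoldt n * of_nat n powr (- 1 - z)"
  shows "Re (3 * L (of_real x) + 4 * L (of_real x + \<i> * of_real t) + L (of_real x + \<i> * of_real (2 * t))) \<ge> 0"
proof -
  let ?f = "\<lambda>z n. mangoldt n * of_nat n powr (- 1 - z) :: complex"
  let ?z0 = "complex_of_real x" and ?z1 = "of_real x + \<i> * of_real t" and ?z2 = "of_real x + \<i> * of_real (2 * t)"
  have s: "?f z sums L z" if "Re z > 0" for z
    using mangoldt_series_sums[OF that] by (simp add: L_def sums_iff)
  have "(\<lambda>n. 3 * ?f ?z0 n + 4 * ?f ?z1 n + ?f ?z2 n) sums (3 * L ?z0 + 4 * L ?z1 + L ?z2)"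
    using assms by (intro sums_add sums_mult s) auto
  then have "(\<lambda>n. Re (3 * ?f ?z0 n + 4 * ?f ?z1 n + ?f ?z2 n)) sums Re (3 * L ?z0 + 4 * L ?z1 + L ?z2)"
    by (rule sums_Re)
  moreover have "Re (3 * ?f ?z0 n + 4 * ?f ?z1 n + ?f ?z2 n) \<ge> 0" for n
  proof (cases "n = 0")
    case False
    define l where "l = ln (real n)"
    have powr: "of_nat n powr (- 1 - (of_real x + \<i> * of_real u)) =
        of_real (real n powr (- 1 - x)) * cis (- (u * l))" for u :: real
    proof -
      have "of_nat n powr (- 1 - (of_real x + \<i> * of_real u)) =
          exp (of_real ((- 1 - x) * l)) * exp (\<i> * of_real (- (u * l)))"
        using False by (simp add: powr_def l_def algebra_simps flip: exp_add)
      moreover have "real n powr (- 1 - x) = exp ((- 1 - x) * l)"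
        using False by (simp add: powr_def l_def)
      ultimately show ?thesis
        by (simp only: exp_of_real cis_conv_exp)
    qed
    have Re_f: "Re (?f (of_real x + \<i> * of_real u) n) = mangoldt n * real n powr (- 1 - x) * cos (u * l)"
      for u :: real
      unfolding powr of_real_mangoldt[symmetric, where 'a = complex] by simp
    have "Re (3 * ?f ?z0 n + 4 * ?f ?z1 n + ?f ?z2 n) =
        3 * Re (?f (of_real x + \<i> * of_real 0) n) + 4 * Re (?f ?z1 n) + Re (?f ?z2 n)"
      by simp
    also have "\<dots> = mangoldt n * real n powr (- 1 - x) * (3 + 4 * cos (t * l) + cos (2 * (t * l)))"
      unfolding Re_f by (simp add: algebra_simps)
    also have "\<dots> \<ge> 0"
      using cos_3_4_1 mangoldt_nonneg by (intro mult_nonneg_nonneg) auto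
    finally show ?thesis .
  qed auto
  ultimately show ?thesis by (metis (no_types, lifting) sums_le sums_zero)
qed

text \<open>Multiply the 3-4-1 inequality by x and let x tend to 0 from the right. The pole of zeta
  contributes 3, zeros of order k1 and k2 at i t and 2 i t contribute -4 k1 - k2, and 3 - 4 k1 - k2
  >= 0 forces k1 = 0.\<close>

lemma zeta_reg_nonzero_line: "zeta_reg (\<i> * of_real t) \<noteq> 0"
proof (cases "t = 0")
  case False
  let ?S = "{z. Re z > - 1}"
  have S: "zeta_reg holomorphic_on ?S" "open ?S" "connected ?S"
    by (auto intro: holomorphic_zeta_reg open_halfspace_Re_gt convex_connected convex_halfspace_Re_gt)
  let ?D = "\<lambda>w x. of_real x * (deriv zeta_reg (w + of_real x) / zeta_reg (w + of_real x))"
  define L where "L = (\<lambda>z. \<Sum>n. mangoldt n * of_nat n powr (- 1 - z) :: complex)"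
  have L: "L z = 1 / z - deriv zeta_reg z / zeta_reg z" if "Re z > 0" for z
    using mangoldt_series_sums[OF that] by (simp add: L_def sums_iff)
  obtain k0 :: nat where k0: "zeta_reg 0 \<noteq> 0 \<Longrightarrow> k0 = 0" "(?D 0 \<longlongrightarrow> of_nat k0) (at_right 0)"
    using logarithmic_derivative_limit[OF S, of 0 0] by auto
  obtain k1 :: nat where k1: "zeta_reg (\<i> * of_real t) = 0 \<Longrightarrow> k1 > 0"
    "(?D (\<i> * of_real t) \<longlongrightarrow> of_nat k1) (at_right 0)"
    using logarithmic_derivative_limit[OF S, of "\<i> * of_real t" 0] by auto
  obtain k2 :: nat where k2: "(?D (\<i> * of_real (2 * t)) \<longlongrightarrow> of_nat k2) (at_right 0)"
    using logarithmic_derivative_limit[OF S, of "\<i> * of_real (2 * t)" 0] by auto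
  have lim: "((\<lambda>x. of_real x * L (of_real x + \<i> * of_real u)) \<longlongrightarrow> (if u = 0 then 1 else 0) - c) (at_right 0)"
    if D: "(?D (\<i> * of_real u) \<longlongrightarrow> c) (at_right 0)" for u c
  proof -
    have "((\<lambda>x. of_real x / (of_real x + \<i> * of_real u)) \<longlongrightarrow> (if u = 0 then 1 else 0 :: complex)) (at_right 0)"
    proof (cases "u = 0")
      case True
      have "\<forall>\<^sub>F x in at_right 0. of_real x / (of_real x + \<i> * of_real u) = (1 :: complex)"
        using eventually_at_right_less[of "0::real"] by eventually_elim (simp add: True)
      then show ?thesis using True by (simp add: tendsto_eventually)
    next
      case False
      have "((\<lambda>x. of_real x / (of_real x + \<i> * of_real u)) \<longlongrightarrow> of_real 0 / (of_real 0 + \<i> * of_real u)) (at_right 0)"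
        using False by (intro tendsto_intros) auto
      then show ?thesis using False by simp
    qed
    from tendsto_diff[OF this D]
    have "((\<lambda>x. of_real x / (of_real x + \<i> * of_real u) - ?D (\<i> * of_real u) x) \<longlongrightarrow>
        (if u = 0 then 1 else 0) - c) (at_right 0)" .
    moreover have "\<forall>\<^sub>F x in at_right 0. of_real x / (of_real x + \<i> * of_real u) - ?D (\<i> * of_real u) x =
        of_real x * L (of_real x + \<i> * of_real u)"
      using eventually_at_right_less[of "0::real"]
      by eventually_elim (simp add: L algebra_simps)
    ultimately show ?thesis by (rule Lim_transform_eventually)
  qed
  let ?E = "\<lambda>x. 3 * (of_real x * L (of_real x + \<i> * of_real 0)) +
      4 * (of_real x * L (of_real x + \<i> * of_real t)) + of_real x * L (of_real x + \<i> * of_real (2 * t))"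
  have "(?E \<longlongrightarrow> 3 * (1 - 0) + 4 * (0 - of_nat k1) + (0 - of_nat k2)) (at_right 0)"
    using lim[of 0 "of_nat k0"] lim[of t "of_nat k1"] lim[of "2 * t" "of_nat k2"] k0 k1(2) k2 False
    by (intro tendsto_add tendsto_mult tendsto_const) auto
  then have "((\<lambda>x. Re (?E x)) \<longlongrightarrow> Re (3 * (1 - 0) + 4 * (0 - of_nat k1) + (0 - of_nat k2))) (at_right 0)"
    by (rule tendsto_Re)
  moreover have "\<forall>\<^sub>F x in at_right 0. 0 \<le> Re (?E x)"
    using eventually_at_right_less[of "0::real"]
  proof eventually_elim
    case (elim x)
    have "?E x = of_real x * (3 * L (of_real x) + 4 * L (of_real x + \<i> * of_real t) + L (of_real x + \<i> * of_real (2 * t)))"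
      by (simp add: algebra_simps)
    then show ?case
      using mangoldt_series_3_4_1[OF elim, of t] elim
      by (simp only: L_def Re_complex_of_real Im_complex_of_real times_complex.sel mult_zero_left diff_zero) simp
  qed
  ultimately have "0 \<le> Re (3 * (1 - 0) + 4 * (0 - of_nat k1) + (0 - of_nat k2))"
    by (rule tendsto_lowerbound) simp
  then have "k1 = 0" by (cases k1) auto
  then show ?thesis using k1(1) by auto
qed simp

lemma zeta_reg_nonzero:
  assumes "Re z \<ge> 0"
  shows "zeta_reg z \<noteq> 0"
proof (cases "Re z = 0")
  case True
  then have "z = \<i> * of_real (Im z)" by (simp add: complex_eq_iff)
  then show ?thesis using zeta_reg_nonzero_line by metis
next
  case False
  then show ?thesis using moebius_series_sums(1) assms by simp
qed

subsection \<open>Newman's contour argument\<close>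

text \<open>Cauchy's formula at 0 on |z| = R. The substitution z = -i w puts the right half circle
  at w = R cis t with 0 <= t <= pi. The left half is brought to the same t by z -> -z, so that both
  halves can later be estimated pointwise under one integral.\<close>

lemma half_circle_mean_value:
  fixes f :: "complex \<Rightarrow> complex" and R :: real
  assumes "f holomorphic_on UNIV" "R > 0"
  shows "((\<lambda>t. f (- \<i> * (R * cis t)) + f (\<i> * (R * cis t))) has_integral (2 * of_real pi * f 0)) {0..pi}"
proof -
  let ?g = "\<lambda>w. f (- \<i> * w)"
  have g: "?g holomorphic_on UNIV"
    by (rule holomorphic_on_compose_gen[of "\<lambda>w. - \<i> * w" UNIV f UNIV, unfolded o_def])
      (auto intro!: holomorphic_intros assms)
  have "((\<lambda>u. ?g u / (u - 0)) has_contour_integral (2 * of_real pi * \<i> * ?g 0)) (circlepath 0 R)"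
    using assms(2) g by (intro Cauchy_integral_circlepath_simple) (auto elim: holomorphic_on_subset)
  then have "((\<lambda>t. ?g (0 + R * cis t) / (0 + R * cis t - 0) * R * \<i> * cis t) has_integral (2 * of_real pi * \<i> * ?g 0)) {0..2*pi}"
    unfolding circlepath_def by (subst (asm) has_contour_integral_part_circlepath_iff) auto
  also have "(\<lambda>t. ?g (0 + R * cis t) / (0 + R * cis t - 0) * R * \<i> * cis t) = (\<lambda>t. \<i> * ?g (R * cis t))"
    using assms(2) by (auto simp: fun_eq_iff)
  finally have int': "((\<lambda>t. - \<i> * (\<i> * ?g (R * cis t))) has_integral - \<i> * (2 * of_real pi * \<i> * ?g 0)) {0..2*pi}"
    by (rule has_integral_mult_right)
  have eq1: "- \<i> * (2 * of_real pi * \<i> * ?g 0) = 2 * of_real pi * f 0"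
    by (simp add: algebra_simps)
  have eq2: "(\<lambda>t. - \<i> * (\<i> * ?g (R * cis t))) = (\<lambda>t. ?g (R * cis t))"
    by simp
  have int: "((\<lambda>t. ?g (R * cis t)) has_integral (2 * of_real pi * f 0)) {0..2*pi}"
    using int' unfolding eq1 eq2 .
  have cont: "continuous_on A (\<lambda>t. ?g (R * cis t))" for A
    by (rule continuous_on_compose2[OF holomorphic_on_imp_continuous_on[OF g]]) (auto intro!: continuous_intros)
  let ?I = "integral {0..pi} (\<lambda>t. ?g (R * cis t))" and ?J = "integral {pi..2*pi} (\<lambda>t. ?g (R * cis t))"
  have I: "((\<lambda>t. ?g (R * cis t)) has_integral ?I) {0..pi}" and J: "((\<lambda>t. ?g (R * cis t)) has_integral ?J) {pi..2*pi}"
    by (intro integrable_integral integrable_continuous_real cont)+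
  have "((\<lambda>t. ?g (R * cis t)) has_integral (?I + ?J)) {0..2*pi}"
    by (rule has_integral_combine[OF _ _ I J]) auto
  then have IJ: "?I + ?J = 2 * of_real pi * f 0"
    using int by (rule has_integral_unique)
  have "((\<lambda>t. ?g (R * cis (t + pi))) has_integral ?J) {pi - pi..2*pi - pi}"
    using J by (rule has_integral_shift_real_ivl)
  then have "((\<lambda>t. f (\<i> * (R * cis t))) has_integral ?J) {0..pi}"
    by (simp add: cis_mult[symmetric])
  from has_integral_add[OF I this] show ?thesis unfolding IJ .
qed

text \<open>The half circle and its diameter lie in the half-plane where g is holomorphic, so the
  arc can be traded for the segment, on which z = -i w is imaginary. The factor in front of g comes
  from dw = i w dt.\<close>

lemma half_circle_Cauchy:
  fixes g :: "complex \<Rightarrow> complex" and R :: real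
  assumes g: "g holomorphic_on U" "open U" "{z. Re z \<ge> 0} \<subseteq> U" and "R > 0"
  defines "J \<equiv> contour_integral (linepath (- of_real R) (of_real R)) (\<lambda>w. g (- \<i> * w))"
  shows "((\<lambda>t. - \<i> * (R * cis t) * g (- \<i> * (R * cis t))) has_integral J) {0..pi}"
proof -
  let ?g = "\<lambda>w. g (- \<i> * w)"
  let ?S = "{w::complex. Im w \<ge> 0}"
  let ?A = "part_circlepath 0 R 0 pi" and ?B = "linepath (- of_real R) (of_real R) :: real \<Rightarrow> complex"
  have hol: "?g holomorphic_on ?S"
    by (rule holomorphic_on_compose_gen[of "\<lambda>w. - \<i> * w" ?S g U, unfolded o_def])
      (use g in \<open>auto intro!: holomorphic_intros\<close>)
  have A: "path_image ?A \<subseteq> ?S"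
    using assms(4) by (auto simp: path_image_part_circlepath' closed_segment_eq_real_ivl sin_ge_zero)
  have "Im (- of_real R) = 0" "Im (of_real R) = 0" by auto
  then have B: "path_image ?B \<subseteq> ?S"
    unfolding path_image_linepath by (rule_tac closed_segment_subset) (auto simp: convex_halfspace_Im_ge)
  have cont: "continuous_on ?S ?g" using hol by (rule holomorphic_on_imp_continuous_on)
  have intA: "?g contour_integrable_on ?A"
    using cont A by (intro contour_integrable_continuous_part_circlepath) (auto elim: continuous_on_subset)
  have intB: "?g contour_integrable_on ?B"
    using cont B by (intro contour_integrable_continuous_linepath) (auto elim: continuous_on_subset)
  have "(?g has_contour_integral 0) (?A +++ ?B)"
    by (rule Cauchy_theorem_convex_simple[OF hol])
      (use A B in \<open>auto simp: convex_halfspace_Im_ge path_image_join exp_pi_i' intro!: valid_path_join\<close>)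
  then have "contour_integral (?A +++ ?B) ?g = 0" by (rule contour_integral_unique)
  then have "contour_integral ?A ?g + J = 0"
    using intA intB by (simp add: J_def)
  then have "(?g has_contour_integral (- J)) ?A"
    using has_contour_integral_integral[OF intA] by (simp add: add_eq_0_iff)
  then have "((\<lambda>t. ?g (0 + R * cis t) * R * \<i> * cis t) has_integral (- J)) {0..pi}"
    by (subst (asm) has_contour_integral_part_circlepath_iff) auto
  from has_integral_neg[OF this] show ?thesis
    by (simp add: mult_ac)
qed

text \<open>Riemann-Lebesgue by one integration by parts. The exponential has modulus 1 on the real
  segment, so the boundary terms and the integral of h' are bounded independently of l; division by
  l gives O(1/l).\<close>

lemma oscillating_integral_tendsto_0:
  fixes h :: "complex \<Rightarrow> complex" and R :: real
  assumes h: "h holomorphic_on U" "open U" "closed_segment (- of_real R) (of_real R) \<subseteq> U"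
  shows "((\<lambda>l. contour_integral (linepath (- of_real R) (of_real R)) (\<lambda>w. h w * exp (- \<i> * of_real l * w))) \<longlongrightarrow> 0) at_top"
proof -
  let ?\<gamma> = "linepath (- of_real R) (of_real R) :: real \<Rightarrow> complex"
  let ?K = "closed_segment (- of_real R) (of_real R) :: complex set"
  have dh: "deriv h holomorphic_on U" using h by (intro holomorphic_deriv)
  have "continuous_on ?K h" "continuous_on ?K (deriv h)"
    using h dh by (auto intro!: holomorphic_on_imp_continuous_on elim: holomorphic_on_subset)
  then have "bounded (h ` ?K)" "bounded (deriv h ` ?K)"
    by (auto intro!: compact_imp_bounded compact_continuous_image)
  then obtain B C where B: "\<And>w. w \<in> ?K \<Longrightarrow> norm (h w) \<le> B" and C: "\<And>w. w \<in> ?K \<Longrightarrow> norm (deriv h w) \<le> C"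
    unfolding bounded_iff by blast
  have real: "\<exists>u. w = of_real u" if "w \<in> ?K" for w
    using that unfolding closed_segment_of_real[of "- R" R, simplified] by blast
  have norm_exp: "norm (exp (- \<i> * of_real l * w)) = 1" if w: "w \<in> ?K" for l :: real and w
  proof -
    obtain u where "w = of_real u" using real[OF w] by blast
    then show ?thesis by simp
  qed
  have bound: "norm (contour_integral ?\<gamma> (\<lambda>w. h w * exp (- \<i> * of_real l * w))) \<le> (2 * B + C * (2 * \<bar>R\<bar>)) / l"
    if l: "l > 0" for l
  proof -
    let ?e = "\<lambda>w. exp (- \<i> * of_real l * w)"
    let ?I = "contour_integral ?\<gamma> (\<lambda>w. h w * ?e w)" and ?J = "contour_integral ?\<gamma> (\<lambda>w. deriv h w * ?e w)"
    have int: "(\<lambda>w. k w * ?e w) contour_integrable_on ?\<gamma>" if "k holomorphic_on U" for k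
      using that h by (intro contour_integrable_continuous_linepath holomorphic_on_imp_continuous_on holomorphic_intros)
        (auto elim: holomorphic_on_subset)
    have int1: "((\<lambda>w. deriv h w * ?e w + - \<i> * of_real l * (h w * ?e w)) has_contour_integral
        h (pathfinish ?\<gamma>) * ?e (pathfinish ?\<gamma>) - h (pathstart ?\<gamma>) * ?e (pathstart ?\<gamma>)) ?\<gamma>"
    proof (rule contour_integral_primitive[where S = U])
      fix w assume "w \<in> U"
      then have "(h has_field_derivative deriv h w) (at w)"
        using h by (intro holomorphic_derivI)
      moreover have "(?e has_field_derivative - \<i> * of_real l * ?e w) (at w)"
        by (auto intro!: derivative_eq_intros)
      ultimately have "((\<lambda>w. h w * ?e w) has_field_derivative deriv h w * ?e w + (- \<i> * of_real l * ?e w) * h w) (at w)"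
        by (rule DERIV_mult)
      then show "((\<lambda>w. h w * ?e w) has_field_derivative deriv h w * ?e w + - \<i> * of_real l * (h w * ?e w)) (at w within U)"
        by (intro has_field_derivative_at_within[of _ _ w U]) (simp add: mult_ac)
    qed (use h in auto)
    have int2: "((\<lambda>w. deriv h w * ?e w + - \<i> * of_real l * (h w * ?e w)) has_contour_integral
        ?J + - \<i> * of_real l * ?I) ?\<gamma>"
      using int[OF h(1)] int[OF dh]
      by (intro has_contour_integral_add has_contour_integral_lmul has_contour_integral_integral)
    have "h R * ?e R - h (- of_real R) * ?e (- of_real R) = ?J + - \<i> * of_real l * ?I"
      using has_contour_integral_unique[OF int1 int2] unfolding pathstart_linepath pathfinish_linepath .
    then have "\<i> * of_real l * ?I = ?J - h R * ?e R + h (- of_real R) * ?e (- of_real R)"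
      by (simp add: algebra_simps)
    moreover have "norm (a - b + c) \<le> norm a + norm b + norm c" for a b c :: complex
      using norm_triangle_ineq[of "a - b" c] norm_triangle_ineq4[of a b] by linarith
    ultimately have "norm (\<i> * of_real l * ?I) \<le> norm ?J + norm (h R * ?e R) + norm (h (- of_real R) * ?e (- of_real R))"
      by presburger
    moreover have "norm (\<i> * of_real l * ?I) = l * norm ?I"
      using l by (simp add: norm_mult)
    moreover have "norm ?J \<le> C * (2 * \<bar>R\<bar>)"
    proof -
      have "norm (deriv h (of_real R)) \<le> C" by (rule C) simp
      then have C0: "C \<ge> 0" by (rule order_trans[OF norm_ge_zero])
      have "norm ?J \<le> C * norm (complex_of_real R - (- of_real R))"
        by (rule contour_integral_bound_linepath[OF int[OF dh] C0]) (simp only: norm_mult norm_exp C mult_1_right)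
      also have "complex_of_real R - (- of_real R) = of_real (2 * R)" by simp
      finally show ?thesis by (simp only: norm_of_real abs_mult abs_numeral)
    qed
    moreover have "norm (h R * ?e R) \<le> B" "norm (h (- of_real R) * ?e (- of_real R)) \<le> B"
      using B[of "of_real R"] B[of "- of_real R"] norm_exp[of "of_real R" l] norm_exp[of "- of_real R" l]
      unfolding norm_mult by (simp_all only: ends_in_segment mult_1_right)
    ultimately have "l * norm ?I \<le> 2 * B + C * (2 * \<bar>R\<bar>)" by linarith
    then show ?thesis using l by (simp add: field_simps)
  qed
  show ?thesis
  proof (rule Lim_null_comparison)
    show "\<forall>\<^sub>F l in at_top. norm (contour_integral ?\<gamma> (\<lambda>w. h w * exp (- \<i> * of_real l * w))) \<le> (2 * B + C * (2 * \<bar>R\<bar>)) / l"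
      using eventually_gt_at_top[of "0::real"] by eventually_elim (rule bound)
    show "((\<lambda>l. (2 * B + C * (2 * \<bar>R\<bar>)) / l) \<longlongrightarrow> 0) at_top"
      by real_asymp
  qed
qed

section \<open>Tail and head of a Dirichlet series with bounded coefficients, and Newman's
  kernel\<close>

lemma powr_difference_mvt:
  fixes u p :: real
  assumes "u > 0"
  obtains c where "u < c" "c < u + 1" "(u + 1) powr p - u powr p = p * c powr (p - 1)"
proof -
  have "\<exists>c>u. c < u + 1 \<and> (u + 1) powr p - u powr p = (u + 1 - u) * (p * c powr (p - 1))"
  proof (rule MVT2)
    show "((\<lambda>u. u powr p) has_real_derivative p * c powr (p - 1)) (at c)" if "u \<le> c" for c
      using that assms by (intro has_real_derivative_powr) auto
  qed simp
  then show ?thesis using that by auto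
qed

lemma norm_dirichlet_tail_le:
  fixes a :: "nat \<Rightarrow> complex"
  assumes a: "\<And>n. norm (a n) \<le> 1" and "Re z > 0" "N \<ge> 1"
    and sums: "(\<lambda>n. a n * of_nat n powr (- 1 - z)) sums s"
  shows "norm (s - (\<Sum>n=1..N. a n * of_nat n powr (- 1 - z))) \<le> real N powr (- Re z) / Re z"
proof -
  let ?f = "\<lambda>n. a n * of_nat n powr (- 1 - z)" and ?x = "Re z"
  let ?b = "\<lambda>k. (real (k + N) powr (- ?x) - real (Suc k + N) powr (- ?x)) / ?x"
  have "(\<lambda>k. ?f (k + Suc N)) sums (s - (\<Sum>n<Suc N. ?f n))"
    using sums by (rule sums_split_initial_segment)
  also have "(\<Sum>n<Suc N. ?f n) = (\<Sum>n=1..N. ?f n)"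
    by (rule sum.mono_neutral_right) auto
  finally have tail: "(\<lambda>k. ?f (k + Suc N)) sums (s - (\<Sum>n=1..N. ?f n))" .
  have "(\<lambda>k. real (k + N) powr (- ?x)) \<longlonglongrightarrow> 0"
    using assms(2) by real_asymp
  from telescope_sums'[OF this]
  have "(\<lambda>k. real (k + N) powr (- ?x) - real (Suc k + N) powr (- ?x)) sums (real N powr (- ?x))"
    by simp
  then have b: "?b sums (real N powr (- ?x) / ?x)" by (rule sums_divide)
  have le: "norm (?f (k + Suc N)) \<le> ?b k" for k
  proof -
    define u where "u = real (k + N)"
    have u: "u > 0" using assms(3) by (simp add: u_def)
    obtain c where c: "u < c" "c < u + 1" "(u + 1) powr (- ?x) - u powr (- ?x) = - ?x * c powr (- ?x - 1)"
      using powr_difference_mvt[OF u] by blast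
    have "(u + 1) powr (- ?x - 1) \<le> c powr (- ?x - 1)"
      using c u assms(2) by (intro powr_mono2') auto
    then have "?x * (u + 1) powr (- ?x - 1) \<le> ?x * c powr (- ?x - 1)"
      using assms(2) by (intro mult_left_mono) auto
    then have "?x * (u + 1) powr (- ?x - 1) \<le> u powr (- ?x) - (u + 1) powr (- ?x)"
      using c(3) by simp
    then have "(u + 1) powr (- ?x - 1) \<le> (u powr (- ?x) - (u + 1) powr (- ?x)) / ?x"
      using assms(2) by (simp add: le_divide_eq mult.commute)
    moreover have "norm (?f (k + Suc N)) \<le> (u + 1) powr (- ?x - 1)"
    proof -
      have "norm (?f (k + Suc N)) \<le> 1 * real (k + Suc N) powr (- 1 - ?x)"
        unfolding norm_mult norm_of_nat_powr using a by (intro mult_mono) auto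
      also have "real (k + Suc N) = u + 1" by (simp add: u_def)
      also have "- 1 - ?x = - ?x - 1" by simp
      finally show ?thesis by simp
    qed
    moreover have "real (Suc k + N) = u + 1" by (simp add: u_def)
    ultimately show ?thesis unfolding u_def by (simp only:)
  qed
  have sm: "summable (\<lambda>k. norm (?f (k + Suc N)))"
    by (rule summable_comparison_test[OF _ sums_summable[OF b]]) (use le in auto)
  have "norm (s - (\<Sum>n=1..N. ?f n)) = norm (\<Sum>k. ?f (k + Suc N))"
    using sums_unique[OF tail] by simp
  also have "\<dots> \<le> (\<Sum>k. norm (?f (k + Suc N)))"
    by (rule summable_norm[OF sm])
  also have "\<dots> \<le> (\<Sum>k. ?b k)"
    by (rule suminf_le[OF le sm sums_summable[OF b]])
  also have "\<dots> = real N powr (- ?x) / ?x"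
    using sums_unique[OF b] by simp
  finally show ?thesis .
qed

text \<open>Comparison with the integral of t^(x-1). For x <= 1 the terms decrease and N^x / x
  suffices; for x > 1 they increase, and the last term has to be added.\<close>

lemma sum_powr_le:
  fixes x :: real
  assumes "x > 0" "N \<ge> 1"
  shows "(\<Sum>n=1..N. real n powr (x - 1)) \<le> real N powr x / x + real N powr (x - 1)"
proof (cases "x \<le> 1")
  case True
  have "(\<Sum>n=1..N. real n powr (x - 1)) \<le> real N powr x / x"
    using assms(2)
  proof (induction N rule: dec_induct)
    case base
    then show ?case using True assms(1) by simp
  next
    case (step N)
    define u where "u = real N"
    have u: "u > 0" using step by (simp add: u_def)
    obtain c where c: "u < c" "c < u + 1" "(u + 1) powr x - u powr x = x * c powr (x - 1)"
      using powr_difference_mvt[OF u] by blast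
    have "(u + 1) powr (x - 1) \<le> c powr (x - 1)"
      using c u True by (intro powr_mono2') auto
    then have "x * (u + 1) powr (x - 1) \<le> (u + 1) powr x - u powr x"
      using c(3) assms(1) by simp
    then have "(u + 1) powr (x - 1) \<le> (u + 1) powr x / x - u powr x / x"
      using assms(1) by (simp add: field_simps)
    then show ?case using step by (simp add: u_def add_ac)
  qed
  then show ?thesis by (simp add: add_increasing2)
next
  case False
  show ?thesis
    using assms(2)
  proof (induction N rule: dec_induct)
    case base
    then show ?case using assms(1) by simp
  next
    case (step N)
    define u where "u = real N"
    have u: "u > 0" using step by (simp add: u_def)
    obtain c where c: "u < c" "c < u + 1" "(u + 1) powr x - u powr x = x * c powr (x - 1)"
      using powr_difference_mvt[OF u] by blast
    have "u powr (x - 1) \<le> c powr (x - 1)"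
      using c u False by (intro powr_mono2) auto
    then have "x * u powr (x - 1) \<le> (u + 1) powr x - u powr x"
      using c(3) assms(1) by simp
    then have "u powr (x - 1) \<le> (u + 1) powr x / x - u powr x / x"
      using assms(1) by (simp add: field_simps)
    then show ?case using step by (simp add: u_def add_ac)
  qed
qed

lemma norm_dirichlet_head_le:
  fixes a :: "nat \<Rightarrow> complex"
  assumes a: "\<And>n. norm (a n) \<le> 1" and "Re z > 0" "N \<ge> 1"
  shows "norm (\<Sum>n=1..N. a n * of_nat n powr (- 1 + z)) \<le> real N powr Re z / Re z + real N powr (Re z - 1)"
proof -
  have "norm (\<Sum>n=1..N. a n * of_nat n powr (- 1 + z)) \<le> (\<Sum>n=1..N. real n powr (Re z - 1))"
  proof (rule norm_sum[THEN order_trans], rule sum_mono)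
    fix n
    show "norm (a n * of_nat n powr (- 1 + z)) \<le> real n powr (Re z - 1)"
      using mult_right_mono[OF a[of n], of "real n powr (- 1 + Re z)"]
      by (simp add: norm_mult norm_of_nat_powr)
  qed
  also have "\<dots> \<le> real N powr Re z / Re z + real N powr (Re z - 1)"
    using assms by (intro sum_powr_le)
  finally show ?thesis .
qed

text \<open>On the circle of radius R the kernel has modulus 2 |Re z| / R. This cancels the 1 / Re z
  in the estimates of tail and head.\<close>

lemma newman_kernel:
  fixes R t :: real
  assumes "R > 0" and "z = - \<i> * (R * cis t)"
  shows "1 + z\<^sup>2 / of_real R ^ 2 = - 2 * \<i> * of_real (sin t) * cis t"
proof -
  have "z\<^sup>2 / of_real R ^ 2 = - (cis t * cis t)"
    using assms by (simp add: power2_eq_square field_simps)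
  moreover have "1 - cis t * cis t = - 2 * \<i> * of_real (sin t) * cis t"
    using sin_cos_squared_add[of t] by (simp add: complex_eq_iff power2_eq_square algebra_simps)
  ultimately show ?thesis by simp
qed

text \<open>Newman's contour argument, with the kernel \<open>N\<^sup>z (1 + z\<^sup>2 / R\<^sup>2) / z\<close>. Since the limit function
  \<open>z G(z)\<close> vanishes at \<open>0\<close>, the part of the contour in the left half-plane can be replaced by a
  segment of the imaginary axis.\<close>
lemma newman_bound:
  fixes a :: "nat \<Rightarrow> complex" and R :: real
  assumes a: "\<And>n. norm (a n) \<le> 1"
    and G: "G holomorphic_on U" "open U" "{z. Re z \<ge> 0} \<subseteq> U"
    and sums: "\<And>z. Re z > 0 \<Longrightarrow> (\<lambda>n. a n * of_nat n powr (- 1 - z)) sums (z * G z)"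
    and R: "R > 0" and N: "N \<ge> 1"
  defines "J \<equiv> contour_integral (linepath (- of_real R) (of_real R))
    (\<lambda>w. (G (- \<i> * w) * (1 - w\<^sup>2 / of_real R ^ 2)) * exp (- \<i> * of_real (ln (real N)) * w))"
  shows "norm (\<Sum>n=1..N. a n / of_nat n) \<le> 2 / R + 1 / real N + norm J / (2 * pi)"
proof -
  define e where "e = (\<lambda>z::complex. exp (of_real (ln (real N)) * z))"
  define q where "q = (\<lambda>z::complex. 1 + z\<^sup>2 / of_real R ^ 2)"
  define s where "s = (\<lambda>z. \<Sum>n=1..N. a n * of_nat n powr (- 1 - z))"
  let ?f = "\<lambda>z. s z * e z * q z" and ?g = "\<lambda>z. G z * e z * q z"
  let ?z = "\<lambda>t. - \<i> * (R * cis t)"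
  have f: "?f holomorphic_on UNIV"
    unfolding s_def e_def q_def by (intro holomorphic_intros) (use R in auto)
  have g: "?g holomorphic_on U"
    unfolding e_def q_def by (intro holomorphic_intros G) (use R in auto)
  have J: "J = contour_integral (linepath (- of_real R) (of_real R)) (\<lambda>w. ?g (- \<i> * w))"
    unfolding J_def e_def q_def by (simp add: power_mult_distrib mult_ac)
  have f0: "?f 0 = (\<Sum>n=1..N. a n / of_nat n)"
    by (simp add: s_def e_def q_def powr_minus_divide)
  \<comment> \<open>On the right half circle the partial sum is compared with the limit function. On
    the left half, where z is replaced by -z, only the entire partial sum remains.\<close>
  have "((\<lambda>t. (?f (?z t) + ?f (\<i> * (R * cis t))) - ?z t * ?g (?z t)) has_integral (2 * of_real pi * ?f 0 - J)) {0..pi}"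
    unfolding J
    by (rule has_integral_diff[OF half_circle_mean_value[OF f R] half_circle_Cauchy[OF g G(2,3) R]])
  then have "norm (2 * of_real pi * ?f 0 - J) \<le> (4 / R + 2 / real N) * measure lborel (cbox 0 pi)"
  proof (intro has_integral_bound)
    fix t :: real assume t: "t \<in> cbox 0 pi"
    define z where "z = ?z t"
    have z': "\<i> * (R * cis t) = - z" by (simp add: z_def)
    have x: "Re z = R * sin t" by (simp add: z_def)
    have "sin t \<ge> 0" using t by (intro sin_ge_zero) auto
    have q: "norm (q z) = 2 * sin t" "q (- z) = q z"
      using newman_kernel[OF R, of z t] \<open>sin t \<ge> 0\<close> by (simp_all add: q_def z_def norm_mult)
    show "norm ((?f (?z t) + ?f (\<i> * (R * cis t))) - ?z t * ?g (?z t)) \<le> 4 / R + 2 / real N"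
    proof (cases "sin t = 0")
      case True
      then have "q z = 0" using q by simp
      then show ?thesis
        unfolding z' z_def[symmetric] using q R by simp
    next
      case False
      then have pos: "Re z > 0" using \<open>sin t \<ge> 0\<close> R by (simp add: x)
      have ne: "norm (e z) = real N powr Re z" "norm (e (- z)) = real N powr (- Re z)"
        using N by (simp_all add: e_def powr_def mult.commute)
      have "norm ((s z - z * G z) * e z * q z) \<le> real N powr (- Re z) / Re z * real N powr Re z * (2 * sin t)"
        unfolding norm_mult ne q(1)
        using norm_dirichlet_tail_le[OF a pos N sums[OF pos]] \<open>sin t \<ge> 0\<close>
        by (intro mult_right_mono) (auto simp: s_def norm_minus_commute)
      also have "\<dots> = 2 / R"
        using N False R by (simp add: x powr_minus field_simps)
      finally have 1: "norm ((s z - z * G z) * e z * q z) \<le> 2 / R" .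
      have "norm (?f (- z)) \<le> (real N powr Re z / Re z + real N powr (Re z - 1)) * real N powr (- Re z) * (2 * sin t)"
        unfolding norm_mult ne q
        using norm_dirichlet_head_le[OF a pos N] \<open>sin t \<ge> 0\<close>
        by (intro mult_right_mono) (auto simp: s_def)
      also have "\<dots> = 2 / R + 2 * sin t / real N"
        using N False R by (simp add: x powr_minus powr_diff field_simps)
      also have "\<dots> \<le> 2 / R + 2 / real N"
        by (intro add_left_mono divide_right_mono) auto
      finally have 2: "norm (?f (- z)) \<le> 2 / R + 2 / real N" .
      have eq: "(?f z + ?f (- z)) - z * ?g z = (s z - z * G z) * e z * q z + ?f (- z)"
        by (simp add: algebra_simps)
      show ?thesis
        unfolding z' z_def[symmetric] eq
        using norm_triangle_ineq[of "(s z - z * G z) * e z * q z" "?f (- z)"] 1 2 by linarith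
    qed
  qed (use R in auto)
  then have "norm (2 * of_real pi * ?f 0 - J) \<le> (4 / R + 2 / real N) * pi" by simp
  moreover have "norm (2 * of_real pi * ?f 0) \<le> norm (2 * of_real pi * ?f 0 - J) + norm J"
    using norm_triangle_ineq[of "2 * of_real pi * ?f 0 - J" J] by simp
  moreover have "norm (2 * of_real pi * ?f 0) = 2 * pi * norm (?f 0)"
    by (simp add: norm_mult)
  ultimately have "2 * pi * norm (?f 0) \<le> (4 / R + 2 / real N) * pi + norm J" by linarith
  then have "norm (?f 0) \<le> ((4 / R + 2 / real N) * pi + norm J) / (2 * pi)"
    by (simp add: field_simps)
  also have "\<dots> = 2 / R + 1 / real N + norm J / (2 * pi)"
    by (simp add: add_divide_distrib distrib_right)
  finally show ?thesis unfolding f0 .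
qed

lemma newman_tauberian:
  fixes a :: "nat \<Rightarrow> complex"
  assumes a: "\<And>n. norm (a n) \<le> 1"
    and G: "G holomorphic_on U" "open U" "{z. Re z \<ge> 0} \<subseteq> U"
    and sums: "\<And>z. Re z > 0 \<Longrightarrow> (\<lambda>n. a n * of_nat n powr (- 1 - z)) sums (z * G z)"
  shows "(\<lambda>N. \<Sum>n=1..N. a n / of_nat n) \<longlonglongrightarrow> 0"
proof (rule tendstoI)
  fix r :: real assume r: "r > 0"
  \<comment> \<open>R is fixed before N: the term 2 / R = r / 3 stays, and for this R the two other
    terms tend to 0.\<close>
  define R where "R = 6 / r"
  have R: "R > 0" using r by (simp add: R_def)
  let ?V = "(\<lambda>w. - \<i> * w) -` U"
  let ?J = "\<lambda>l. contour_integral (linepath (- of_real R) (of_real R))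
    (\<lambda>w. (G (- \<i> * w) * (1 - w\<^sup>2 / of_real R ^ 2)) * exp (- \<i> * of_real l * w))"
  have "(\<lambda>w. G (- \<i> * w)) holomorphic_on ?V"
    by (rule holomorphic_on_compose_gen[of "\<lambda>w. - \<i> * w" ?V G U, unfolded o_def])
      (use G in \<open>auto intro!: holomorphic_intros\<close>)
  then have h: "(\<lambda>w. G (- \<i> * w) * (1 - w\<^sup>2 / of_real R ^ 2)) holomorphic_on ?V"
    by (intro holomorphic_intros) (use R in auto)
  have V: "open ?V"
    by (rule open_vimage[OF G(2)]) (intro continuous_intros)
  have "closed_segment (- of_real R) (of_real R) \<subseteq> {w::complex. Im w \<ge> 0}"
    by (rule closed_segment_subset) (auto simp: convex_halfspace_Im_ge)
  moreover have "w \<in> ?V" if "Im w \<ge> 0" for w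
    using that by (intro vimageI2 subsetD[OF G(3)]) simp
  ultimately have "closed_segment (- of_real R) (of_real R) \<subseteq> ?V"
    by blast
  from oscillating_integral_tendsto_0[OF h V this]
  have "(?J \<longlongrightarrow> 0) at_top" .
  moreover have "filterlim (\<lambda>N. ln (real N)) at_top sequentially"
    by real_asymp
  ultimately have "(\<lambda>N. ?J (ln (real N))) \<longlonglongrightarrow> 0"
    by (rule filterlim_compose)
  then have "(\<lambda>N. norm (?J (ln (real N)))) \<longlonglongrightarrow> 0"
    by (rule tendsto_norm_zero)
  then have "(\<lambda>N. 1 / real N + norm (?J (ln (real N))) / (2 * pi)) \<longlonglongrightarrow> 0 + 0 / (2 * pi)"
    by (intro tendsto_intros lim_1_over_n) auto
  then have "\<forall>\<^sub>F N in sequentially. 1 / real N + norm (?J (ln (real N))) / (2 * pi) < r / 2"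
    using r by (intro order_tendstoD(2)) auto
  then show "\<forall>\<^sub>F N in sequentially. dist (\<Sum>n=1..N. a n / of_nat n) 0 < r"
    using eventually_ge_at_top[of 1]
  proof eventually_elim
    case (elim N)
    have "norm (\<Sum>n=1..N. a n / of_nat n) \<le> 2 / R + 1 / real N + norm (?J (ln (real N))) / (2 * pi)"
      by (rule newman_bound[OF a G sums R elim(2)])
    also have "2 / R = r / 3" by (simp add: R_def)
    finally show ?case using elim r by simp
  qed
qed

text \<open>The Tauberian theorem with G = 1 / \<open>zeta_reg\<close>. The nonvanishing of
  \<open>zeta_reg\<close> on Re z = 0 is what makes G holomorphic near the closed
  half-plane.\<close>

lemma mertens_tendsto_0: "sifted_mertens {} \<longlonglongrightarrow> 0"
proof -
  let ?U = "{z. Re z > - 1} \<inter> zeta_reg -` (- {0})"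
  have U: "open ?U"
    by (rule continuous_open_preimage[OF holomorphic_on_imp_continuous_on[OF holomorphic_zeta_reg]])
      (auto intro: open_halfspace_Re_gt)
  have G: "(\<lambda>z. 1 / zeta_reg z) holomorphic_on ?U"
    by (intro holomorphic_intros holomorphic_on_subset[OF holomorphic_zeta_reg]) auto
  have "{z. Re z \<ge> 0} \<subseteq> ?U"
    using zeta_reg_nonzero by auto
  have "(\<lambda>N. \<Sum>n=1..N. of_int (moebius_mu n) / of_nat n :: complex) \<longlonglongrightarrow> 0"
    by (rule newman_tauberian[OF norm_moebius_mu_le G U \<open>{z. Re z \<ge> 0} \<subseteq> ?U\<close>])
      (use moebius_series_sums(2) in simp)
  also have "(\<lambda>N. \<Sum>n=1..N. of_int (moebius_mu n) / of_nat n :: complex) = (\<lambda>N. of_real (sifted_mertens {} N))"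
    by (simp add: sifted_mertens_def sifted_upto_def atLeastAtMost_def atLeast_def atMost_def Int_def)
  finally have "(\<lambda>N. complex_of_real (sifted_mertens {} N)) \<longlonglongrightarrow> of_real 0"
    by simp
  then show ?thesis by (simp only: tendsto_of_real_iff)
qed

subsection \<open>Sums and densities over sifted integers\<close>

lemma abs_real_div_diff_le_1: "\<bar>real N / real n - real (N div n)\<bar> \<le> 1"
proof (cases "n = 0")
  case False
  have "real N = real n * real (N div n) + real (N mod n)"
    by (metis mult_div_mod_eq of_nat_add of_nat_mult)
  then have "real N / real n - real (N div n) = real (N mod n) / real n"
    using False by (simp add: field_simps)
  moreover have "N mod n < n" using False by simp
  ultimately show ?thesis by simp
qed simp

text \<open>Replacing floor(N/n) by N/n costs at most 1 for each n. So N times the sum differs by at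
  most N from a count of smooth integers, which is itself at most N.\<close>

lemma abs_sifted_mertens_le:
  assumes "finite P" "P \<subseteq> {p. prime p}"
  shows "\<bar>sifted_mertens P N\<bar> \<le> 2"
proof (cases "N = 0")
  case False
  have 1: "N * sifted_mertens P N =
      (\<Sum>n\<in>sifted_upto P N. moebius_mu n * real (N div n)) +
      (\<Sum>n\<in>sifted_upto P N. moebius_mu n * (real N / real n - real (N div n)))"
  proof -
    have "(\<Sum>n\<in>sifted_upto P N. moebius_mu n * real (N div n)) +
      (\<Sum>n\<in>sifted_upto P N. moebius_mu n * (real N / real n - real (N div n))) =
      (\<Sum>n\<in>sifted_upto P N. N * (moebius_mu n / n))"
      by (subst sum.distrib[symmetric]) (simp add: algebra_simps)
    then show ?thesis by (simp add: sifted_mertens_def sum_distrib_left)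
  qed
  have 2: "\<bar>\<Sum>n\<in>sifted_upto P N. moebius_mu n * (real N / real n - real (N div n))\<bar>
      \<le> (\<Sum>n\<in>sifted_upto P N. 1)"
  proof (rule sum_abs[THEN order_trans], rule sum_mono)
    fix n assume "n \<in> sifted_upto P N"
    show "\<bar>moebius_mu n * (real N / real n - real (N div n))\<bar> \<le> 1"
      using abs_moebius_mu_le[of n] abs_real_div_diff_le_1[of N n]
      by (simp add: abs_mult mult_le_one)
  qed
  have "\<bar>N * sifted_mertens P N\<bar> \<le> N + N"
    unfolding 1 using 2 sum_moebius_div_sifted_upto[OF assms, of N] card_sifted_upto_le[of P N] card_smooth_upto_le[of P N]
    by simp
  then show ?thesis using False by (simp add: abs_mult)
qed simp

text \<open>The limsup L of |f| satisfies L <= L / d, so L = 0. In place of the limsup, the bound (B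
  + 1) (3/4)^k is shown to hold from some point on, for each k.\<close>

lemma tendsto_0_of_div_recursion:
  fixes f g :: "nat \<Rightarrow> real"
  assumes f: "\<And>N. f N = g N + f (N div d) / d"
    and bound: "\<And>N. \<bar>f N\<bar> \<le> B" and g: "g \<longlonglongrightarrow> 0" and "d \<ge> 2"
  shows "f \<longlonglongrightarrow> 0"
proof -
  have B: "B \<ge> 0" using bound[of 0] by linarith
  have ev: "\<forall>\<^sub>F N in sequentially. \<bar>f N\<bar> \<le> (B + 1) * (3/4) ^ k" for k
  proof (induction k)
    case 0
    show ?case using bound by (intro always_eventually allI) (simp add: add_increasing2)
  next
    case (Suc k)
    \<comment> \<open>Of the new bound 3 c / 4, the share c / 4 is left for g and c / 2 for the
      recursive term, as d >= 2. Using B + 1 keeps c positive.\<close>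
    let ?c = "(B + 1) * (3/4) ^ k"
    have "?c / 4 > 0" using B by simp
    from tendstoD[OF g this] have "\<forall>\<^sub>F N in sequentially. \<bar>g N\<bar> < ?c / 4"
      by (simp add: dist_real_def)
    moreover have "\<forall>\<^sub>F N in sequentially. \<bar>f (N div d)\<bar> \<le> ?c"
      using eventually_compose_filterlim[OF Suc filterlim_at_top_div_const_nat[of d]] \<open>d \<ge> 2\<close> by simp
    ultimately show ?case
    proof eventually_elim
      case (elim N)
      have "\<bar>f (N div d) / d\<bar> \<le> \<bar>f (N div d)\<bar> / 2"
        using \<open>d \<ge> 2\<close> by (simp only: abs_divide abs_of_nat) (rule divide_left_mono, auto)
      moreover have "(B + 1) * (3/4) ^ Suc k = ?c / 4 + ?c / 2" by simp
      ultimately show ?case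
        unfolding f[of N] using elim abs_triangle_ineq[of "g N" "f (N div d) / d"] by linarith
    qed
  qed
  show ?thesis
  proof (rule tendstoI)
    fix e :: real assume "e > 0"
    have "(\<lambda>k. (B + 1) * (3/4) ^ k) \<longlonglongrightarrow> (B + 1) * 0"
      by (intro tendsto_mult tendsto_const LIMSEQ_realpow_zero) auto
    then have "\<forall>\<^sub>F k in sequentially. (B + 1) * (3/4) ^ k < e"
      using \<open>e > 0\<close> by (intro order_tendstoD(2)) auto
    then obtain k where "(B + 1) * (3/4) ^ k < e"
      by (auto simp: eventually_sequentially)
    with ev[of k] show "\<forall>\<^sub>F N in sequentially. dist (f N) 0 < e"
      by (auto elim!: eventually_mono)
  qed
qed

lemma sifted_mertens_tendsto_0:
  assumes "finite P" "P \<subseteq> {p. prime p}"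
  shows "sifted_mertens P \<longlonglongrightarrow> 0"
  using assms
proof (induction P rule: finite_induct)
  case (insert p P)
  then have p: "prime p" "p \<notin> P" "P \<subseteq> {p. prime p}" by auto
  show ?case
  proof (rule tendsto_0_of_div_recursion)
    show "sifted_mertens (insert p P) N = sifted_mertens P N + sifted_mertens (insert p P) (N div p) / p" for N
      using p by (rule sifted_mertens_insert)
    show "\<bar>sifted_mertens (insert p P) N\<bar> \<le> 2" for N
      using insert by (intro abs_sifted_mertens_le) auto
    show "sifted_mertens P \<longlonglongrightarrow> 0"
      using insert by auto
    show "p \<ge> 2" using p prime_ge_2_nat by blast
  qed
qed (rule mertens_tendsto_0)

section \<open>Natural density of the integers free of finitely many primes\<close>

lemma tendsto_div_ratio:
  assumes "(p::nat) > 0"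
  shows "(\<lambda>N. real (N div p) / real N) \<longlonglongrightarrow> 1 / p"
proof -
  have "(\<lambda>N. 1 / p - real (N div p) / N) \<longlonglongrightarrow> 0"
  proof (rule Lim_null_comparison)
    show "(\<lambda>N. 1 / real N) \<longlonglongrightarrow> 0" by (rule lim_1_over_n)
    show "\<forall>\<^sub>F N in sequentially. norm (1 / p - real (N div p) / N) \<le> 1 / real N"
      using eventually_gt_at_top[of 0]
    proof eventually_elim
      case (elim N)
      have "\<bar>1 / p - real (N div p) / N\<bar> = \<bar>real N / p - real (N div p)\<bar> / N"
      proof -
        have "1 / p - real (N div p) / N = (real N / p - real (N div p)) / N"
          using elim by (simp add: diff_divide_distrib)
        then show ?thesis by (simp add: abs_divide)
      qed
      also have "\<dots> \<le> 1 / N"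
        using abs_real_div_diff_le_1 by (intro divide_right_mono) auto
      finally show ?case by simp
    qed
  qed
  from tendsto_diff[OF tendsto_const this, of "1/p"] show ?thesis by simp
qed

text \<open>Sifting by one more prime p multiplies the density by 1 - 1/p: the integers removed are
  p times the sifted integers up to \<open>N div p\<close>.\<close>

lemma sifted_upto_density:
  assumes "finite P" "P \<subseteq> {p. prime p}"
  shows "\<exists>c. (\<lambda>N. card (sifted_upto P N) / N) \<longlonglongrightarrow> c"
  using assms
proof (induction P rule: finite_induct)
  case empty
  have "sifted_upto {} N = {1..N}" for N
    by (auto simp: sifted_upto_def)
  then have "(\<lambda>N. card (sifted_upto {} N) / N) \<longlonglongrightarrow> 1"
    by (intro tendsto_eventually eventually_mono[OF eventually_gt_at_top[of 0]]) simp
  then show ?case by blast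
next
  case (insert p P)
  then have p: "prime p" "p \<notin> P" "P \<subseteq> {p. prime p}" by auto
  obtain c where c: "(\<lambda>N. card (sifted_upto P N) / N) \<longlonglongrightarrow> c"
    using insert by auto
  have p0: "p > 0" using p prime_gt_0_nat by blast
  have "(\<lambda>N. card (sifted_upto P N) / N - card (sifted_upto P (N div p)) / real (N div p) * (real (N div p) / N)) \<longlonglongrightarrow> c - c * (1 / p)"
    using filterlim_compose[OF c filterlim_at_top_div_const_nat[OF p0]]
    by (intro tendsto_diff c tendsto_mult tendsto_div_ratio p0)
  moreover have "card (sifted_upto P N) / N - card (sifted_upto P (N div p)) / real (N div p) * (real (N div p) / N)
     = card (sifted_upto (insert p P) N) / N" for N
  proof -
    have "card (sifted_upto P N) = card (sifted_upto (insert p P) N) + card (sifted_upto P (N div p))"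
      using sum_sifted_upto_insert[OF p, of "\<lambda>_. 1::nat" N] by simp
    then show ?thesis
      by (cases "N div p = 0") (auto simp: add_divide_distrib)
  qed
  ultimately show ?case by auto
qed

text \<open>The products k m are pairwise distinct and at most N. Indeed every prime factor of k <=
  K lies in P, so k is coprime to every sifted m, and k m = k' m' makes k and k' divide each
  other.\<close>

lemma sum_card_sifted_upto_div_le:
  assumes "\<And>p. p \<in> P \<Longrightarrow> prime p" "\<And>p. prime p \<Longrightarrow> p \<le> K \<Longrightarrow> p \<in> P"
  shows "(\<Sum>k=1..K. card (sifted_upto P (N div k))) \<le> N"
proof -
  have inj: "inj_on (\<lambda>(k, m). k * m) (SIGMA k:{1..K}. sifted_upto P (N div k))"
  proof (rule inj_onI, clarify)
    fix k m k' m'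
    assume k: "k \<in> {1..K}" "k' \<in> {1..K}" and m: "m \<in> sifted_upto P (N div k)" "m' \<in> sifted_upto P (N div k')"
      and eq: "k * m = k' * m'"
    have cop: "coprime k m'" if "k \<in> {1..K}" "\<forall>p\<in>P. \<not> p dvd m'" for k m'
    proof (rule ccontr)
      assume "\<not> coprime k m'"
      then have "gcd k m' \<noteq> 1" by (simp add: coprime_iff_gcd_eq_1)
      then obtain p where p: "prime p" "p dvd k" "p dvd m'"
        using prime_factor_nat[of "gcd k m'"] by auto
      then have "p \<le> K" using that dvd_imp_le[of p k] by auto
      then show False using p that assms(2) by auto
    qed
    have "coprime k m'" "coprime k' m"
      using cop k m unfolding sifted_upto_def by blast+
    moreover have "k dvd k' * m'" "k' dvd k * m"
      using eq by (metis dvd_triv_left)+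
    ultimately have "k dvd k'" "k' dvd k"
      by (simp_all add: coprime_dvd_mult_left_iff)
    then have "k = k'" by (rule dvd_antisym)
    then show "k = k' \<and> m = m'" using eq k by auto
  qed
  have "(\<Sum>k=1..K. card (sifted_upto P (N div k))) = card (SIGMA k:{1..K}. sifted_upto P (N div k))"
    by simp
  also have "\<dots> = card ((\<lambda>(k, m). k * m) ` (SIGMA k:{1..K}. sifted_upto P (N div k)))"
    using inj by (simp add: card_image)
  also have "\<dots> \<le> card {1..N}"
    by (intro card_mono) (auto simp: sifted_upto_def times_le_iff_le_div)
  finally show ?thesis by simp
qed

text \<open>Let c be the density of the integers free of primes up to K. The preceding count,
  divided by N, gives c (1 + 1/2 + ... + 1/K) <= 1 in the limit, and the divergence of the harmonic
  series makes c small.\<close>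

lemma sifted_upto_density_small:
  fixes e :: real
  assumes "e > 0"
  obtains z where "\<forall>\<^sub>F N in sequentially. card (sifted_upto {p. prime p \<and> p \<le> z} N) \<le> e * N"
proof -
  have "\<exists>K. harm K > 2 / e"
    using harm_at_top unfolding filterlim_at_top_dense
    by (auto simp: eventually_sequentially)
  then obtain K where K: "harm K > 2 / e" by blast
  let ?P = "{p::nat. prime p \<and> p \<le> K}"
  have "finite ?P" by simp
  then obtain c where c: "(\<lambda>N. card (sifted_upto ?P N) / N) \<longlonglongrightarrow> c"
    using sifted_upto_density[of ?P] by auto
  have "(\<lambda>N. \<Sum>k=1..K. card (sifted_upto ?P (N div k)) / real (N div k) * (real (N div k) / N))
     \<longlonglongrightarrow> (\<Sum>k=1..K. c * (1 / k))"
    using filterlim_compose[OF c filterlim_at_top_div_const_nat]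
    by (intro tendsto_sum tendsto_mult tendsto_div_ratio) auto
  moreover have "(\<Sum>k=1..K. c * (1 / k)) = c * harm K"
    by (simp add: harm_def sum_distrib_left divide_inverse)
  moreover have "(\<Sum>k=1..K. card (sifted_upto ?P (N div k)) / real (N div k) * (real (N div k) / N)) \<le> 1" for N
  proof -
    have "(\<Sum>k=1..K. card (sifted_upto ?P (N div k)) / real (N div k) * (real (N div k) / N)) =
      (\<Sum>k=1..K. card (sifted_upto ?P (N div k)) / N)"
    proof (intro sum.cong refl)
      fix k
      show "card (sifted_upto ?P (N div k)) / real (N div k) * (real (N div k) / N) =
          card (sifted_upto ?P (N div k)) / N"
        by (cases "N div k = 0") auto
    qed
    also have "\<dots> = real (\<Sum>k=1..K. card (sifted_upto ?P (N div k))) / N"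
      by (simp add: sum_divide_distrib)
    also have "\<dots> \<le> 1"
    proof -
      have "real (\<Sum>k=1..K. card (sifted_upto ?P (N div k))) \<le> real N"
        using sum_card_sifted_upto_div_le[of ?P K N] by (intro of_nat_mono) auto
      then show ?thesis by (cases "N = 0") (simp_all del: of_nat_sum)
    qed
    finally show ?thesis .
  qed
  ultimately have c_le: "c * harm K \<le> 1"
    by (intro LIMSEQ_le_const2) auto
  have "c < e"
  proof -
    have "e * (2 / e) < e * harm K"
      using K assms by (intro mult_strict_left_mono) auto
    then have "c * harm K < e * harm K"
      using assms c_le by simp
    then show ?thesis
      using harm_nonneg[of K] by (meson mult_right_mono not_le)
  qed
  then have "\<forall>\<^sub>F N in sequentially. card (sifted_upto ?P N) / N < e"
    using order_tendstoD(2)[OF c] by blast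
  then have "\<forall>\<^sub>F N in sequentially. card (sifted_upto ?P N) \<le> e * N"
    using eventually_gt_at_top[of 0] by eventually_elim (simp add: field_simps)
  then show ?thesis using that by blast
qed

subsection \<open>Mertens-type bounds and smooth integers\<close>

lemma sum_ln_prime_factors_le:
  assumes "n > 0"
  shows "(\<Sum>p\<in>prime_factors n. ln (real p)) \<le> ln (real n)"
proof -
  have "(\<Prod>p\<in>prime_factors n. p) \<le> (\<Prod>p\<in>prime_factors n. p ^ multiplicity p n)"
    by (intro prod_mono) (auto simp: prime_factors_multiplicity intro!: self_le_power prime_ge_1_nat Suc_leI)
  also have "\<dots> = n"
    using assms by (simp add: prod_prime_factors)
  finally have "(\<Prod>p\<in>prime_factors n. real p) \<le> real n"
    by (simp flip: of_nat_prod)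
  moreover have "(\<Prod>p\<in>prime_factors n. real p) > 0"
    by (intro prod_pos) (auto intro: prime_gt_0_nat)
  ultimately have "ln (\<Prod>p\<in>prime_factors n. real p) \<le> ln (real n)"
    using assms by simp
  moreover have "ln (\<Prod>p\<in>prime_factors n. real p) = (\<Sum>p\<in>prime_factors n. ln (real p))"
    by (rule ln_prod) (auto intro: prime_gt_0_nat)
  ultimately show ?thesis by simp
qed

lemma card_multiples_upto:
  assumes "(d::nat) > 0"
  shows "card {n \<in> {1..N}. d dvd n} = N div d"
proof -
  have "{n \<in> {1..N}. d dvd n} = (*) d ` {1..N div d}"
    using assms by (auto simp: image_iff times_le_iff_le_div Suc_le_eq elim!: dvdE intro: Nat.gr0I)
  moreover have "inj_on ((*) d) {1..N div d}"
    using assms by (intro inj_onI) auto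
  ultimately show ?thesis by (simp add: card_image)
qed

lemma div_ge_half:
  fixes N p :: nat
  assumes "p \<le> N" "p > 0"
  shows "real N / real p \<le> 2 * real (N div p)"
proof -
  have "N div p \<ge> 1"
    using assms by (simp add: Suc_le_eq div_greater_zero_iff)
  moreover have "N < p * (N div p) + p"
    using assms by (metis mult_div_mod_eq add_strict_left_mono mod_less_divisor)
  ultimately have "N \<le> p * (2 * (N div p))"
    by (smt (verit, best) add_le_mono le_trans less_imp_le_nat mult.left_commute mult_2 mult_le_mono2 mult_numeral_1_right nat_mult_1_right add_left_mono)
  then have "real N \<le> real p * (2 * real (N div p))"
    by (metis of_nat_le_iff of_nat_mult of_nat_numeral)
  then show ?thesis using assms by (simp add: divide_le_eq mult.commute)
qed

text \<open>The logarithms of the distinct primes dividing n sum to at most ln n, and summing over n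
  <= N gives at most N ln N. The constant 2 comes from N/p <= 2 floor(N/p).\<close>

lemma sum_ln_prime_over_prime_le:
  "(\<Sum>p | prime p \<and> p \<le> N. ln (real p) / real p) \<le> 2 * ln (real N)"
proof (cases "N = 0")
  case False
  let ?P = "{p::nat. prime p \<and> p \<le> N}"
  have ln_nonneg: "ln (real p) \<ge> 0" if "prime p" for p :: nat
    using prime_ge_1_nat[OF that] by simp
  have "(\<Sum>p\<in>?P. ln p * (N / p)) \<le> (\<Sum>p\<in>?P. ln p * (2 * real (N div p)))"
    by (intro sum_mono mult_left_mono div_ge_half ln_nonneg) (auto intro: prime_gt_0_nat)
  also have "\<dots> = 2 * (\<Sum>p\<in>?P. ln p * real (N div p))"
    by (simp add: sum_distrib_left algebra_simps)
  also have "(\<Sum>p\<in>?P. ln p * real (N div p)) = (\<Sum>p\<in>?P. \<Sum>n=1..N. if p dvd n then ln p else 0)"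
  proof (intro sum.cong refl)
    fix p assume "p \<in> ?P"
    then have "p > 0" using prime_gt_0_nat by blast
    have "(\<Sum>n=1..N. if p dvd n then ln p else 0) = (\<Sum>n | n \<in> {1..N} \<and> p dvd n. ln p)"
      by (subst sum.inter_filter) auto
    then show "ln p * real (N div p) = (\<Sum>n=1..N. if p dvd n then ln p else 0)"
      using card_multiples_upto[OF \<open>p > 0\<close>, of N] by simp
  qed
  also have "\<dots> = (\<Sum>n=1..N. \<Sum>p\<in>?P. if p dvd n then ln p else 0)"
    by (rule sum.swap)
  also have "\<dots> = (\<Sum>n=1..N. \<Sum>p\<in>prime_factors n. ln p)"
  proof (rule sum.cong[OF refl])
    fix n assume n: "n \<in> {1..N}"
    have "(\<Sum>p\<in>?P. if p dvd n then ln p else 0) = (\<Sum>p | p \<in> ?P \<and> p dvd n. ln p)"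
      by (subst sum.inter_filter) auto
    also have "{p. p \<in> ?P \<and> p dvd n} = prime_factors n"
      using n by (auto simp: in_prime_factors_iff intro: order_trans[OF dvd_imp_le])
    finally show "(\<Sum>p\<in>?P. if p dvd n then ln p else 0) = (\<Sum>p\<in>prime_factors n. ln p)" .
  qed
  also have "\<dots> \<le> (\<Sum>n=1..N. ln N)"
    by (intro sum_mono order_trans[OF sum_ln_prime_factors_le]) auto
  finally have "N * (\<Sum>p\<in>?P. ln p / p) \<le> N * (2 * ln N)"
    by (simp add: sum_distrib_left algebra_simps)
  then show ?thesis using False by simp
qed simp

text \<open>Primes in (z, z^2] satisfy 1/p <= (ln p / p) / ln z and so contribute at most 2 ln(z^2)
  / ln z = 4. Repeated squaring from 2 reaches 2^(2^k) after k blocks, which is a bound of order log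
  log.\<close>

lemma sum_prime_reciprocals_le:
  "(\<Sum>p | prime p \<and> p \<le> (2::nat) ^ 2 ^ k. 1 / real p) \<le> 1 + 4 * real k"
proof (induction k)
  case 0
  have "{p::nat. prime p \<and> p \<le> 2} = {2}"
    using prime_ge_2_nat by (auto intro: antisym)
  then show ?case by simp
next
  case (Suc k)
  let ?z = "(2::nat) ^ 2 ^ k"
  have lnz: "ln (real ?z) > 0" by simp
  have "?z \<le> 2 ^ 2 ^ Suc k"
    by (intro power_increasing) auto
  then have "{p::nat. prime p \<and> p \<le> 2 ^ 2 ^ Suc k} =
      {p. prime p \<and> p \<le> ?z} \<union> {p. prime p \<and> ?z < p \<and> p \<le> 2 ^ 2 ^ Suc k}"
    by (auto simp del: power_increasing_iff)
  then have "(\<Sum>p | prime p \<and> p \<le> (2::nat) ^ 2 ^ Suc k. 1 / real p) =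
      (\<Sum>p | prime p \<and> p \<le> ?z. 1 / real p) + (\<Sum>p | prime p \<and> ?z < p \<and> p \<le> 2 ^ 2 ^ Suc k. 1 / real p)"
    by (simp only:) (rule sum.union_disjoint, auto)
  moreover have "(\<Sum>p | prime p \<and> ?z < p \<and> p \<le> 2 ^ 2 ^ Suc k. 1 / real p) \<le>
      (\<Sum>p | prime p \<and> ?z < p \<and> p \<le> 2 ^ 2 ^ Suc k. ln (real p) / real p / ln (real ?z))"
  proof (rule sum_mono, clarify)
    fix p :: nat assume p: "prime p" "?z < p"
    have "ln (real ?z) \<le> ln (real p)"
      using p by (subst ln_le_cancel_iff) (auto simp: prime_gt_0_nat simp del: of_nat_power)
    then have "1 / real p * 1 \<le> 1 / real p * (ln (real p) / ln (real ?z))"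
      using lnz by (intro mult_left_mono) (auto simp: le_divide_eq_1)
    then show "1 / real p \<le> ln (real p) / real p / ln (real ?z)" by simp
  qed
  moreover have "\<dots> \<le> (\<Sum>p | prime p \<and> p \<le> (2::nat) ^ 2 ^ Suc k. ln (real p) / real p / ln (real ?z))"
    using lnz prime_ge_1_nat by (intro sum_mono2) (auto intro!: divide_nonneg_nonneg ln_ge_zero simp: Suc_le_eq prime_gt_0_nat)
  moreover have "\<dots> = (\<Sum>p | prime p \<and> p \<le> (2::nat) ^ 2 ^ Suc k. ln (real p) / real p) / ln (real ?z)"
    by (simp add: sum_divide_distrib)
  moreover have "\<dots> \<le> 2 * ln (real ((2::nat) ^ 2 ^ Suc k)) / ln (real ?z)"
    using lnz by (intro divide_right_mono sum_ln_prime_over_prime_le) auto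
  moreover have "\<dots> = 4"
    by (simp add: ln_realpow)
  ultimately show ?case using Suc by simp
qed

section \<open>Counting smooth integers\<close>

lemma sum_multiplicity_le:
  fixes p :: nat
  assumes "prime p"
  shows "(\<Sum>n=1..N. real (multiplicity p n)) \<le> real N / real (p - 1)"
proof (induction N rule: less_induct)
  case (less N)
  have p: "p \<ge> 2" using assms prime_ge_2_nat by blast
  show ?case
  proof (cases "N = 0")
    case False
    have "(\<Sum>n=1..N. real (multiplicity p n)) = (\<Sum>n\<in>(*) p ` {1..N div p}. real (multiplicity p n))"
    proof (rule sum.mono_neutral_right)
      show "(*) p ` {1..N div p} \<subseteq> {1..N}"
        using p by (auto simp: times_le_iff_le_div Suc_le_eq)
      show "\<forall>n\<in>{1..N} - (*) p ` {1..N div p}. real (multiplicity p n) = 0"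
      proof
        fix n assume n: "n \<in> {1..N} - (*) p ` {1..N div p}"
        have "\<not> p dvd n"
          using n p by (auto simp: image_iff times_le_iff_le_div Suc_le_eq elim!: dvdE)
        then show "real (multiplicity p n) = 0" by (simp add: not_dvd_imp_multiplicity_0)
      qed
    qed auto
    also have "\<dots> = (\<Sum>n=1..N div p. real (multiplicity p (p * n)))"
      using p by (subst sum.reindex) (auto simp: inj_on_def)
    also have "\<dots> = (\<Sum>n=1..N div p. 1 + real (multiplicity p n))"
      using assms p by (intro sum.cong) (auto simp: multiplicity_times_same)
    also have "\<dots> = real (N div p) + (\<Sum>n=1..N div p. real (multiplicity p n))"
      by (simp add: sum.distrib)
    also have "\<dots> \<le> real (N div p) + real (N div p) / real (p - 1)"
      using less[of "N div p"] p False by simp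
    also have "\<dots> = real (N div p) * real p / real (p - 1)"
      using p by (simp add: field_simps of_nat_diff)
    also have "\<dots> \<le> real N / real (p - 1)"
    proof (rule divide_right_mono)
      have "N div p * p \<le> N" by simp
      then show "real (N div p) * real p \<le> real N" by (metis of_nat_le_iff of_nat_mult)
    qed simp
    finally show ?thesis .
  qed simp
qed

text \<open>Expand ln n over the primes p <= z and exchange the sums. Of the factor 4, one 2 comes
  from N / (p - 1) <= 2 N / p and the other from the sum of ln p / p.\<close>

lemma sum_ln_smooth_upto_le:
  assumes "z > 0"
  shows "(\<Sum>n\<in>smooth_upto {p. prime p \<and> p \<le> z} N. ln (real n)) \<le> 4 * real N * ln z"
proof -
  let ?P = "{p::nat. prime p \<and> p \<le> z}"
  have ln_nonneg: "ln (real p) \<ge> 0" if "prime p" for p :: nat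
    using prime_ge_1_nat[OF that] by simp
  have "(\<Sum>n\<in>smooth_upto ?P N. ln (real n)) = (\<Sum>n\<in>smooth_upto ?P N. \<Sum>p\<in>?P. multiplicity p n * ln p)"
  proof (intro sum.cong refl)
    fix n assume n: "n \<in> smooth_upto ?P N"
    then have "n = (\<Prod>p\<in>prime_factors n. p ^ multiplicity p n)"
      using prod_prime_factors[of n] by (auto simp: smooth_upto_def)
    then have "real n = real (\<Prod>p\<in>prime_factors n. p ^ multiplicity p n)"
      by (rule arg_cong)
    also have "\<dots> = (\<Prod>p\<in>prime_factors n. real p ^ multiplicity p n)"
      by simp
    also have "\<dots> = (\<Prod>p\<in>?P. real p ^ multiplicity p n)"
      using n by (intro prod.mono_neutral_left)
        (auto simp: smooth_upto_def prime_factors_multiplicity)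
    also have "ln \<dots> = (\<Sum>p\<in>?P. ln (real p ^ multiplicity p n))"
      by (rule ln_prod) (auto simp: prime_gt_0_nat)
    also have "\<dots> = (\<Sum>p\<in>?P. multiplicity p n * ln p)"
      by (intro sum.cong) (auto simp: ln_realpow prime_gt_0_nat)
    finally show "ln (real n) = (\<Sum>p\<in>?P. multiplicity p n * ln p)" .
  qed
  also have "\<dots> \<le> (\<Sum>n=1..N. \<Sum>p\<in>?P. multiplicity p n * ln p)"
    by (intro sum_mono2) (auto simp: smooth_upto_def intro!: sum_nonneg mult_nonneg_nonneg ln_nonneg)
  also have "\<dots> = (\<Sum>p\<in>?P. (\<Sum>n=1..N. real (multiplicity p n)) * ln p)"
    by (subst sum.swap) (simp add: sum_distrib_right)
  also have "\<dots> \<le> (\<Sum>p\<in>?P. 2 * real N * (ln p / p))"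
  proof (intro sum_mono)
    fix p assume p: "p \<in> ?P"
    then have p2: "p \<ge> 2" using prime_ge_2_nat by blast
    have "real N / real (p - 1) \<le> 2 * real N / p"
      using p2 by (simp add: field_simps of_nat_diff mult_left_mono)
    then have "(\<Sum>n=1..N. real (multiplicity p n)) * ln p \<le> 2 * real N / p * ln p"
      using p by (intro mult_right_mono ln_nonneg order_trans[OF sum_multiplicity_le]) auto
    then show "(\<Sum>n=1..N. real (multiplicity p n)) * ln p \<le> 2 * real N * (ln p / p)" by simp
  qed
  also have "\<dots> = 2 * real N * (\<Sum>p\<in>?P. ln p / p)"
    by (simp add: sum_distrib_left)
  also have "\<dots> \<le> 2 * real N * (2 * ln z)"
    by (intro mult_left_mono sum_ln_prime_over_prime_le) auto
  finally show ?thesis by simp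
qed

text \<open>Markov's inequality for the weight ln n: the smooth n > sqrt N have ln n >= (ln N) / 2,
  so their number is at most 2 / ln N times the previous sum. With z = N^t the bound is about 8 t N,
  small for small t.\<close>

lemma card_smooth_upto_bound:
  assumes "z > 0" "N > 1"
  shows "card (smooth_upto {p. prime p \<and> p \<le> z} N) \<le> sqrt N + 8 * real N * ln z / ln N"
proof -
  let ?A = "smooth_upto {p. prime p \<and> p \<le> z} N"
  let ?B = "{n \<in> ?A. real n \<le> sqrt N}" and ?C = "{n \<in> ?A. real n > sqrt N}"
  have "?B \<subseteq> {1..nat \<lfloor>sqrt N\<rfloor>}"
    by (auto simp: smooth_upto_def le_nat_floor)
  then have "card ?B \<le> card {1..nat \<lfloor>sqrt N\<rfloor>}"
    by (intro card_mono) auto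
  then have B: "real (card ?B) \<le> sqrt N"
    by (simp add: le_nat_iff le_floor_iff)
  have lnN: "ln (real N) > 0" using assms by simp
  have "(\<Sum>n\<in>?C. ln N / 2) \<le> (\<Sum>n\<in>?C. ln n)"
  proof (intro sum_mono)
    fix n assume "n \<in> ?C"
    then have "ln (sqrt N) \<le> ln n"
      using assms by (subst ln_le_cancel_iff) (auto simp: smooth_upto_def)
    then show "ln N / 2 \<le> ln n"
      using assms by (simp add: ln_sqrt)
  qed
  also have "\<dots> \<le> (\<Sum>n\<in>?A. ln n)"
    by (intro sum_mono2) (auto simp: smooth_upto_def)
  also have "\<dots> \<le> 4 * real N * ln z"
    using sum_ln_smooth_upto_le[OF assms(1), of N] by simp
  finally have C: "card ?C \<le> 8 * real N * ln z / ln N"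
    using lnN by (simp add: field_simps)
  have "?A = ?B \<union> ?C" by auto
  then have "card ?A = card (?B \<union> ?C)" by (rule arg_cong)
  also have "\<dots> = card ?B + card ?C"
    by (rule card_Un_disjoint) auto
  finally have "real (card ?A) = real (card ?B) + real (card ?C)"
    by linarith
  then show ?thesis using B C by linarith
qed

subsection \<open>Least prime divisors\<close>

lemma dvd_imp_le_trans: "d dvd n \<Longrightarrow> 0 < n \<Longrightarrow> n \<le> N \<Longrightarrow> d \<le> (N::nat)"
  by (meson dvd_imp_le order_trans)

abbreviation primes_upto :: "nat \<Rightarrow> nat set" where
  "primes_upto z \<equiv> {p. prime p \<and> p \<le> z}"

lemma least_prime_divisor:
  assumes "n \<ge> 2"
  shows prime_least_prime_divisor: "prime (least_prime_divisor n)"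
    and least_prime_divisor_dvd: "least_prime_divisor n dvd n"
    and least_prime_divisor_le: "\<And>p. prime p \<Longrightarrow> p dvd n \<Longrightarrow> least_prime_divisor n \<le> p"
proof -
  obtain p where "prime p \<and> p dvd n"
    using prime_factor_nat[of n] assms by auto
  from LeastI[of "\<lambda>p. prime p \<and> p dvd n", OF this]
  show "prime (least_prime_divisor n)" "least_prime_divisor n dvd n"
    by (simp_all add: least_prime_divisor_def)
  show "least_prime_divisor n \<le> p" if "prime p" "p dvd n" for p
    unfolding least_prime_divisor_def using that by (intro Least_le) auto
qed

lemma least_prime_divisor_eq_iff:
  assumes "prime p" "n \<ge> 2"
  shows "least_prime_divisor n = p \<longleftrightarrow> p dvd n \<and> (\<forall>q. prime q \<longrightarrow> q < p \<longrightarrow> \<not> q dvd n)"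
proof
  assume "least_prime_divisor n = p"
  then show "p dvd n \<and> (\<forall>q. prime q \<longrightarrow> q < p \<longrightarrow> \<not> q dvd n)"
    using least_prime_divisor_dvd[OF assms(2)] least_prime_divisor_le[OF assms(2)]
    by (auto simp flip: not_le)
next
  assume "p dvd n \<and> (\<forall>q. prime q \<longrightarrow> q < p \<longrightarrow> \<not> q dvd n)"
  then have "\<not> least_prime_divisor n < p" "least_prime_divisor n \<le> p"
    using least_prime_divisor[OF assms(2)] assms(1) by blast+
  then show "least_prime_divisor n = p" by simp
qed

lemma least_prime_divisor_vimage:
  assumes "prime p"
  shows "{n \<in> {2..N}. least_prime_divisor n = p} =
    (*) p ` sifted_upto {q. prime q \<and> q < p} (N div p)"
proof -
  have p: "p \<ge> 2" using assms prime_ge_2_nat by blast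
  have *: "q dvd p * m \<longleftrightarrow> q dvd m" if "prime q" "q < p" for q m
    using that assms by (intro prime_dvd_prime_mult_iff) auto
  have ge: "2 \<le> p * m" if "m > 0" for m
    using p that by (metis mult_le_mono Suc_leI nat_mult_1_right One_nat_def)
  show ?thesis
  proof (intro equalityI subsetI)
    fix n assume n: "n \<in> {n \<in> {2..N}. least_prime_divisor n = p}"
    then obtain m where "n = p * m"
      using least_prime_divisor_dvd[of n] by (auto elim!: dvdE)
    moreover have "\<forall>q. prime q \<longrightarrow> q < p \<longrightarrow> \<not> q dvd n"
      using n least_prime_divisor_eq_iff[OF assms, of n] by simp
    moreover have "m > 0" using n \<open>n = p * m\<close> by (intro Nat.gr0I) auto
    ultimately show "n \<in> (*) p ` sifted_upto {q. prime q \<and> q < p} (N div p)"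
      using n p * by (auto simp: sifted_upto_def times_le_iff_le_div)
  next
    fix n assume "n \<in> (*) p ` sifted_upto {q. prime q \<and> q < p} (N div p)"
    then obtain m where m: "n = p * m" "m \<in> sifted_upto {q. prime q \<and> q < p} (N div p)"
      by blast
    then have "n \<in> {2..N}"
      using p ge[of m] by (auto simp: sifted_upto_def times_le_iff_le_div)
    moreover have "least_prime_divisor n = p"
      using calculation m * by (subst least_prime_divisor_eq_iff[OF assms]) (auto simp: sifted_upto_def)
    ultimately show "n \<in> {n \<in> {2..N}. least_prime_divisor n = p}" by simp
  qed
qed

text \<open>Write n = p m with p the least prime. Then m has no prime below p, and m divisible by p
  contributes 0, so p joins the sifting set. The weight h is arbitrary because the identity serves
  for floor(N/n), for its rounding error and for 1/n.\<close>

lemma sum_moebius_least_prime_divisor: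
  fixes h :: "nat \<Rightarrow> real"
  shows "(\<Sum>n | n \<in> {2..N} \<and> least_prime_divisor n \<in> A. moebius_mu n * h n) =
    - (\<Sum>p\<in>A \<inter> primes_upto N. \<Sum>m\<in>sifted_upto (primes_upto p) (N div p). moebius_mu m * h (p * m))"
proof -
  let ?B = "A \<inter> primes_upto N"
  let ?C = "{n \<in> {2..N}. least_prime_divisor n \<in> A}"
  have sub: "least_prime_divisor ` ?C \<subseteq> ?B"
    using prime_least_prime_divisor by (auto intro: dvd_imp_le_trans[OF least_prime_divisor_dvd])
  have "(\<Sum>n\<in>?C. moebius_mu n * h n) =
      (\<Sum>p\<in>?B. \<Sum>n\<in>{n \<in> ?C. least_prime_divisor n = p}. moebius_mu n * h n)"
    by (rule sum.group[symmetric, OF _ _ sub]) auto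
  also have "\<dots> = (\<Sum>p\<in>?B. - (\<Sum>m\<in>sifted_upto (primes_upto p) (N div p). moebius_mu m * h (p * m)))"
  proof (rule sum.cong[OF refl])
    fix p assume p: "p \<in> ?B"
    then have prime: "prime p" by auto
    have "{n \<in> ?C. least_prime_divisor n = p} = (*) p ` sifted_upto {q. prime q \<and> q < p} (N div p)"
      using p by (subst least_prime_divisor_vimage[OF prime, symmetric]) auto
    then have "(\<Sum>n\<in>{n \<in> ?C. least_prime_divisor n = p}. moebius_mu n * h n) =
        (\<Sum>m\<in>sifted_upto {q. prime q \<and> q < p} (N div p). moebius_mu (p * m) * h (p * m))"
      using prime by (simp add: sum.reindex inj_on_def)
    also have "\<dots> = (\<Sum>m\<in>sifted_upto (primes_upto p) (N div p). - (moebius_mu m * h (p * m)))"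
    proof (rule sum.mono_neutral_cong_right)
      have "p dvd m" if "m \<in> sifted_upto {q. prime q \<and> q < p} (N div p) - sifted_upto (primes_upto p) (N div p)" for m
        using that by (auto simp: sifted_upto_def order_le_less)
      then show "\<forall>m\<in>sifted_upto {q. prime q \<and> q < p} (N div p) - sifted_upto (primes_upto p) (N div p).
          moebius_mu (p * m) * h (p * m) = 0"
        using prime by (auto simp: moebius_mu_prime_times sifted_upto_def)
    next
      fix m assume "m \<in> sifted_upto (primes_upto p) (N div p)"
      then have "\<not> p dvd m" "m > 0"
        using prime by (auto simp: sifted_upto_def)
      then show "moebius_mu (p * m) * h (p * m) = - (moebius_mu m * h (p * m))"
        using prime by (simp add: moebius_mu_prime_times)
    qed (auto simp: sifted_upto_def)
    finally show "(\<Sum>n\<in>{n \<in> ?C. least_prime_divisor n = p}. moebius_mu n * h n) =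
        - (\<Sum>m\<in>sifted_upto (primes_upto p) (N div p). moebius_mu m * h (p * m))"
      by (simp add: sum_negf)
  qed
  finally show ?thesis by (simp add: sum_negf)
qed

section \<open>Counting integers by their largest prime factor\<close>

lemma primes_upto_Suc:
  "primes_upto (Suc z) = (if prime (Suc z) then insert (Suc z) (primes_upto z) else primes_upto z)"
  by (auto simp: le_Suc_eq)

text \<open>A smooth n > 1 with largest prime factor p is p m with m composed of primes up to p.
  Each summand is thus the number of n <= N with P(n) = p, and P(n) is represented in this way from
  here on.\<close>

lemma card_smooth_upto_primes_upto:
  assumes "N > 0"
  shows "card (smooth_upto (primes_upto z) N) =
    1 + (\<Sum>p\<in>primes_upto z. card (smooth_upto (primes_upto p) (N div p)))"
proof (induction z)
  case 0
  have "primes_upto 0 = {}" by auto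
  then show ?case unfolding \<open>primes_upto 0 = {}\<close> using smooth_upto_empty[OF assms] by simp
next
  case (Suc z)
  show ?case
  proof (cases "prime (Suc z)")
    case True
    then show ?thesis
      using Suc card_smooth_upto_insert[OF True, of "primes_upto z" N]
      by (simp add: primes_upto_Suc)
  qed (use Suc in \<open>simp add: primes_upto_Suc\<close>)
qed

lemma sum_card_smooth_upto_eq:
  assumes "N > 0"
  shows "(\<Sum>p\<in>primes_upto N. card (smooth_upto (primes_upto p) (N div p))) = N - 1"
proof -
  have "smooth_upto (primes_upto N) N = {1..N}"
    by (auto simp: smooth_upto_def intro: dvd_imp_le_trans)
  then show ?thesis
    using card_smooth_upto_primes_upto[OF assms, of N] by simp
qed

text \<open>Primes up to z cost at most z in each of the \<open>N div z\<close> terms. For p > z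
  exchange the sums: p occurs for at most N/p values of m, and 1 <= ln p / ln z brings in the sum of
  ln p / p. For z = N^t the total is at most (1 + 2/t) N.\<close>

lemma sum_prime_count_le:
  assumes "z \<ge> 2"
  shows "(\<Sum>m=1..N div z. real (card (primes_upto (N div m)))) \<le> N + 2 * real N * ln N / ln z"
proof -
  let ?Q = "\<lambda>x. {p. prime p \<and> z < p \<and> p \<le> x}"
  have lnz: "ln (real z) > 0" using assms by simp
  have "(\<Sum>m=1..N div z. real (card (primes_upto (N div m)))) \<le>
      (\<Sum>m=1..N div z. real z + real (card (?Q (N div m))))"
  proof (rule sum_mono)
    fix m
    have "card (primes_upto (N div m)) \<le> card ({1..z} \<union> ?Q (N div m))"
      using prime_ge_1_nat by (intro card_mono) (auto simp: Suc_le_eq prime_gt_0_nat)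
    also have "\<dots> \<le> card {1..z} + card (?Q (N div m))"
      by (rule card_Un_le)
    finally show "real (card (primes_upto (N div m))) \<le> real z + real (card (?Q (N div m)))"
      by simp
  qed
  also have "\<dots> = real (N div z * z) + (\<Sum>m=1..N div z. \<Sum>p\<in>?Q N. if p * m \<le> N then 1 else 0)"
  proof -
    have "real (card (?Q (N div m))) = (\<Sum>p\<in>?Q N. if p * m \<le> N then 1 else 0)" if "m \<in> {1..N div z}" for m
    proof -
      have "(\<Sum>p\<in>?Q N. if p * m \<le> N then 1 else (0::real)) = (\<Sum>p | p \<in> ?Q N \<and> p * m \<le> N. 1)"
        by (subst sum.inter_filter) auto
      also have "{p. p \<in> ?Q N \<and> p * m \<le> N} = ?Q (N div m)"
      proof -
        have "p * m \<le> N \<longleftrightarrow> p \<le> N div m" for p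
          using that times_le_iff_le_div[of m p N] by (simp add: mult.commute)
        moreover have "p \<le> N" if "p \<le> N div m" for p
          using that div_le_dividend le_trans by blast
        ultimately show ?thesis by auto
      qed
      finally show ?thesis by simp
    qed
    then show ?thesis by (simp add: sum.distrib)
  qed
  also have "real (N div z * z) \<le> N"
    by (metis div_times_less_eq_dividend of_nat_le_iff)
  also have "(\<Sum>m=1..N div z. \<Sum>p\<in>?Q N. if p * m \<le> N then 1 else 0) =
      (\<Sum>p\<in>?Q N. \<Sum>m=1..N div z. if p * m \<le> N then 1 else (0::real))"
    by (rule sum.swap)
  also have "\<dots> \<le> (\<Sum>p\<in>?Q N. N / ln z * (ln p / p))"
  proof (rule sum_mono)
    fix p assume p: "p \<in> ?Q N"
    then have p0: "p > 0" by (auto simp: prime_gt_0_nat)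
    have "(\<Sum>m=1..N div z. if p * m \<le> N then 1 else (0::real)) = real (card {m \<in> {1..N div z}. p * m \<le> N})"
      by (simp add: sum.inter_filter[symmetric])
    also have "\<dots> \<le> real (card {1..N div p})"
      using p0 by (intro of_nat_mono card_mono) (auto simp: times_le_iff_le_div)
    also have "\<dots> \<le> real N / real p"
      by (simp add: of_nat_div_le_of_nat)
    also have "\<dots> \<le> real N / real p * (ln p / ln z)"
    proof -
      have "ln (real z) \<le> ln (real p)"
        using p assms by (subst ln_le_cancel_iff) auto
      then have "1 \<le> ln p / ln z" using lnz by simp
      then have "real N / real p * 1 \<le> real N / real p * (ln p / ln z)"
        by (intro mult_left_mono) auto
      then show ?thesis by simp
    qed
    finally show "(\<Sum>m=1..N div z. if p * m \<le> N then 1 else 0) \<le> N / ln z * (ln p / p)"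
      by (simp add: field_simps)
  qed
  also have "\<dots> \<le> (\<Sum>p\<in>primes_upto N. N / ln z * (ln p / p))"
    using lnz by (intro sum_mono2) (auto intro!: mult_nonneg_nonneg divide_nonneg_nonneg ln_ge_zero simp: Suc_le_eq prime_gt_0_nat)
  also have "\<dots> = N / ln z * (\<Sum>p\<in>primes_upto N. ln p / p)"
    by (simp add: sum_distrib_left)
  also have "\<dots> \<le> N / ln z * (2 * ln N)"
    using lnz by (intro mult_left_mono sum_ln_prime_over_prime_le) auto
  finally show ?thesis by (simp add: algebra_simps)
qed

subsection \<open>Equidistribution of the largest prime factor\<close>

text \<open>Exchange the largest prime p with its cofactor m = n / p. As p > z, only m <= N/z occur,
  and for fixed m the admissible p are the primes of an interval.\<close>

lemma sum_largest_prime_regroup: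
  fixes g :: "nat \<Rightarrow> real"
  assumes "z \<ge> 1"
  shows "(\<Sum>p | prime p \<and> z < p \<and> p \<le> N. g p * card (smooth_upto (primes_upto p) (N div p))) =
    (\<Sum>m=1..N div z. \<Sum>p | prime p \<and> z < p \<and> p \<le> N div m \<and> (\<forall>q\<in>prime_factors m. q \<le> p). g p)"
proof -
  let ?Q = "{p. prime p \<and> z < p \<and> p \<le> N}"
  let ?R = "\<lambda>p m. p * m \<le> N \<and> (\<forall>q\<in>prime_factors m. q \<le> p)"
  have "(\<Sum>p\<in>?Q. g p * card (smooth_upto (primes_upto p) (N div p))) =
      (\<Sum>p\<in>?Q. \<Sum>m=1..N div z. if ?R p m then g p else 0)"
  proof (rule sum.cong[OF refl])
    fix p assume p: "p \<in> ?Q"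
    then have p0: "p > 0" by (auto simp: prime_gt_0_nat)
    have "m \<le> N div z" if "p * m \<le> N" for m
    proof -
      have "z * m \<le> p * m" using p by auto
      then have "z * m \<le> N" using that by linarith
      then show ?thesis using assms times_le_iff_le_div[of z m N] by simp
    qed
    then have "smooth_upto (primes_upto p) (N div p) = {m \<in> {1..N div z}. ?R p m}"
      using p0 by (auto simp: smooth_upto_def times_le_iff_le_div)
    then show "g p * card (smooth_upto (primes_upto p) (N div p)) = (\<Sum>m=1..N div z. if ?R p m then g p else 0)"
      by (simp flip: sum.inter_filter)
  qed
  also have "\<dots> = (\<Sum>m=1..N div z. \<Sum>p\<in>?Q. if ?R p m then g p else 0)"
    by (rule sum.swap)
  also have "\<dots> = (\<Sum>m=1..N div z. \<Sum>p | prime p \<and> z < p \<and> p \<le> N div m \<and> (\<forall>q\<in>prime_factors m. q \<le> p). g p)"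
  proof (rule sum.cong[OF refl])
    fix m assume m: "m \<in> {1..N div z}"
    have "p * m \<le> N \<longleftrightarrow> p \<le> N div m" for p
      using m times_le_iff_le_div[of m p N] by (simp add: mult.commute)
    moreover have "p \<le> N" if "p \<le> N div m" for p
      using that div_le_dividend le_trans by blast
    ultimately have "{p. prime p \<and> z < p \<and> p \<le> N div m \<and> (\<forall>q\<in>prime_factors m. q \<le> p)} = {p \<in> ?Q. ?R p m}"
      by auto
    then show "(\<Sum>p\<in>?Q. if ?R p m then g p else 0) =
        (\<Sum>p | prime p \<and> z < p \<and> p \<le> N div m \<and> (\<forall>q\<in>prime_factors m. q \<le> p). g p)"
      by (simp flip: sum.inter_filter)
  qed
  finally show ?thesis .
qed

text \<open>The primes in question are those in (L, M] for some L >= z. The sum is a difference of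
  two initial sums that obey the hypothesis, hence the factor 2.\<close>

lemma abs_sum_primes_between_le:
  fixes g :: "nat \<Rightarrow> real" and e :: real
  assumes G: "\<And>k. k \<ge> z \<Longrightarrow> \<bar>\<Sum>p\<in>primes_upto k. g p\<bar> \<le> e * card (primes_upto k)"
    and "e \<ge> 0" "finite A"
  shows "\<bar>\<Sum>p | prime p \<and> z < p \<and> p \<le> M \<and> (\<forall>q\<in>A. q \<le> p). g p\<bar> \<le> 2 * e * card (primes_upto M)"
proof -
  \<comment> \<open>For p > 0 the condition q <= p is q - 1 < p, so all lower bounds merge into L <
    p.\<close>
  define L where "L = Max (insert z ((\<lambda>q. q - 1) ` A))"
  have L: "L < p \<longleftrightarrow> z < p \<and> (\<forall>q\<in>A. q \<le> p)" if "prime p" for p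
    using assms(3) prime_gt_0_nat[OF that] by (force simp: L_def)
  have eq: "{p. prime p \<and> z < p \<and> p \<le> M \<and> (\<forall>q\<in>A. q \<le> p)} = primes_upto M - primes_upto L"
    by (auto simp: L simp flip: not_less)
  have zL: "z \<le> L" using assms(3) by (simp add: L_def)
  show ?thesis
  proof (cases "L \<le> M")
    case True
    then have sub: "primes_upto L \<subseteq> primes_upto M" by auto
    then have "card (primes_upto L) \<le> card (primes_upto M)"
      by (intro card_mono) auto
    then have "e * card (primes_upto L) \<le> e * card (primes_upto M)"
      using assms(2) by (intro mult_left_mono) auto
    moreover have "(\<Sum>p\<in>primes_upto M - primes_upto L. g p) = (\<Sum>p\<in>primes_upto M. g p) - (\<Sum>p\<in>primes_upto L. g p)"
      by (rule sum_diff[OF _ sub]) auto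
    ultimately show ?thesis
      unfolding eq using G[OF zL] G[of M] zL True by linarith
  next
    case False
    then have "primes_upto M - primes_upto L = {}" by auto
    then show ?thesis unfolding eq using assms(2) by (simp only: sum.empty) simp
  qed
qed

text \<open>The primes p <= z account only for z-smooth n, which are few. For p > z the sum is
  regrouped by the cofactor m, and the hypothesis on g controls each interval of primes.\<close>

lemma abs_sum_largest_prime_le:
  fixes g :: "nat \<Rightarrow> real" and e :: real and z N :: nat
  assumes bound: "\<And>p. \<bar>g p\<bar> \<le> B"
    and G: "\<And>k. k \<ge> z \<Longrightarrow> \<bar>\<Sum>p\<in>primes_upto k. g p\<bar> \<le> e * card (primes_upto k)"
    and "e \<ge> 0" "2 \<le> z" "z \<le> N"
  shows "\<bar>\<Sum>p\<in>primes_upto N. g p * card (smooth_upto (primes_upto p) (N div p))\<bar> \<le>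
    B * (sqrt N + 8 * real N * ln z / ln N) + 2 * e * (N + 2 * real N * ln N / ln z)"
proof -
  let ?c = "\<lambda>p. real (card (smooth_upto (primes_upto p) (N div p)))"
  have B: "B \<ge> 0" using bound[of 0] by linarith
  have "primes_upto N = primes_upto z \<union> {p. prime p \<and> z < p \<and> p \<le> N}"
    using assms by auto
  then have "(\<Sum>p\<in>primes_upto N. g p * ?c p) =
      (\<Sum>p\<in>primes_upto z. g p * ?c p) + (\<Sum>p | prime p \<and> z < p \<and> p \<le> N. g p * ?c p)"
    by (simp only:) (rule sum.union_disjoint, auto)
  moreover have "\<bar>\<Sum>p\<in>primes_upto z. g p * ?c p\<bar> \<le> B * (sqrt N + 8 * real N * ln z / ln N)"
  proof -
    have "\<bar>\<Sum>p\<in>primes_upto z. g p * ?c p\<bar> \<le> (\<Sum>p\<in>primes_upto z. B * ?c p)"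
      using bound by (intro sum_abs[THEN order_trans] sum_mono) (auto simp: abs_mult intro!: mult_right_mono)
    also have "\<dots> = B * real (\<Sum>p\<in>primes_upto z. card (smooth_upto (primes_upto p) (N div p)))"
      by (simp add: sum_distrib_left)
    also have "\<dots> \<le> B * real (card (smooth_upto (primes_upto z) N))"
      using card_smooth_upto_primes_upto[of N z] assms B by (intro mult_left_mono) auto
    also have "\<dots> \<le> B * (sqrt N + 8 * real N * ln z / ln N)"
      using assms B by (intro mult_left_mono card_smooth_upto_bound) auto
    finally show ?thesis .
  qed
  moreover have "\<bar>\<Sum>p | prime p \<and> z < p \<and> p \<le> N. g p * ?c p\<bar> \<le> 2 * e * (N + 2 * real N * ln N / ln z)"
  proof -
    have "\<bar>\<Sum>p | prime p \<and> z < p \<and> p \<le> N. g p * ?c p\<bar> \<le> (\<Sum>m=1..N div z. 2 * e * card (primes_upto (N div m)))"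
    proof (subst sum_largest_prime_regroup)
      show "\<bar>\<Sum>m=1..N div z. \<Sum>p | prime p \<and> z < p \<and> p \<le> N div m \<and> (\<forall>q\<in>prime_factors m. q \<le> p). g p\<bar>
          \<le> (\<Sum>m=1..N div z. 2 * e * card (primes_upto (N div m)))"
        using G \<open>e \<ge> 0\<close>
        by (rule_tac order_trans[OF sum_abs], intro sum_mono abs_sum_primes_between_le[where z = z]) auto
    qed (use assms in auto)
    also have "\<dots> = 2 * e * (\<Sum>m=1..N div z. real (card (primes_upto (N div m))))"
      by (simp add: sum_distrib_left)
    also have "\<dots> \<le> 2 * e * (N + 2 * real N * ln N / ln z)"
      using assms by (intro mult_left_mono sum_prime_count_le) auto
    finally show ?thesis .
  qed
  ultimately show ?thesis by linarith
qed

lemma sum_largest_prime_tendsto_0: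
  fixes g :: "nat \<Rightarrow> real"
  assumes bound: "\<And>p. \<bar>g p\<bar> \<le> B"
    and G: "\<And>e::real. e > 0 \<Longrightarrow> \<forall>\<^sub>F k in sequentially. \<bar>\<Sum>p\<in>primes_upto k. g p\<bar> \<le> e * card (primes_upto k)"
  shows "(\<lambda>N. (\<Sum>p\<in>primes_upto N. g p * card (smooth_upto (primes_upto p) (N div p))) / N) \<longlonglongrightarrow> 0"
proof (rule tendstoI)
  fix r :: real assume "r > 0"
  have B: "B \<ge> 0" using bound[of 0] by linarith
  \<comment> \<open>The order of choices matters. First t makes the smooth part at most 16 B t N <=
    r N / 4; then e is taken with 2 e (1 + 2 / t) = r / 4. The bound t <= 1/4 ensures N^(2 t) <=
    N.\<close>
  define t where "t = min (1/4) (r / (64 * (B + 1)))"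
  define e where "e = r / (8 * (1 + 2 * (1 / t)))"
  have t: "t > 0" "t \<le> 1/4" "t \<le> r / (64 * (B + 1))"
    using \<open>r > 0\<close> B unfolding t_def by (simp_all only: min.cobounded1 min.cobounded2) simp
  have e: "e > 0" using \<open>r > 0\<close> t by (simp add: e_def divide_pos_pos add_pos_pos)
  obtain K where K: "\<And>k. k \<ge> K \<Longrightarrow> \<bar>\<Sum>p\<in>primes_upto k. g p\<bar> \<le> e * card (primes_upto k)"
    using G[OF e] by (auto simp: eventually_sequentially)
  have "filterlim (\<lambda>N. real N powr t) at_top sequentially"
    using t by real_asymp
  then have "\<forall>\<^sub>F N in sequentially. real N powr t \<ge> max 2 (real K)"
    unfolding filterlim_at_top by blast
  moreover have "(\<lambda>N. B * (sqrt N / N)) \<longlonglongrightarrow> 0"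
    by real_asymp
  then have "\<forall>\<^sub>F N in sequentially. B * (sqrt N / N) < r / 4"
    using \<open>r > 0\<close> by (intro order_tendstoD(2)) auto
  ultimately show "\<forall>\<^sub>F N in sequentially.
      dist ((\<Sum>p\<in>primes_upto N. g p * card (smooth_upto (primes_upto p) (N div p))) / N) 0 < r"
    using eventually_ge_at_top[of 2]
  proof eventually_elim
    case (elim N)
    let ?S = "\<Sum>p\<in>primes_upto N. g p * card (smooth_upto (primes_upto p) (N div p))"
    \<comment> \<open>Rounding up: N^t <= z <= N^t + 1 <= N^(2 t), the last step because N^t >=
      2.\<close>
    define z where "z = nat \<lceil>real N powr t\<rceil>"
    have lnN: "ln (real N) > 0" using elim by simp
    have z1: "real N powr t \<le> z" and z2: "real z \<le> real N powr t + 1"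
    proof -
      have "\<lceil>real N powr t\<rceil> \<ge> 0" using powr_ge_zero[of "real N" t] by linarith
      then have "real z = of_int \<lceil>real N powr t\<rceil>" by (simp add: z_def)
      then show "real N powr t \<le> z" "real z \<le> real N powr t + 1" by linarith+
    qed
    have z: "z \<ge> 2" "z \<ge> K" using z1 elim by linarith+
    have "real z \<le> 2 * real N powr t" using z2 elim by linarith
    also have "\<dots> \<le> real N powr t * real N powr t"
      using elim by (intro mult_right_mono) auto
    also have "\<dots> = real N powr (2 * t)" by (simp flip: powr_add)
    finally have z3: "real z \<le> real N powr (2 * t)" .
    have "real N powr (2 * t) \<le> real N powr 1"
      using t elim by (intro powr_mono) auto
    then have "z \<le> N" using z3 elim by simp
    have "ln (real z) \<le> ln (real N powr (2 * t))"
      using z z3 elim by (subst ln_le_cancel_iff) auto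
    then have lnz1: "ln (real z) / ln (real N) \<le> 2 * t"
      using elim lnN by (simp add: ln_powr field_simps)
    have "ln (real N powr t) \<le> ln (real z)"
      using z z1 elim by (subst ln_le_cancel_iff) auto
    then have "t * ln (real N) \<le> ln (real z)"
      using elim by (simp add: ln_powr)
    then have lnz2: "ln (real N) / ln (real z) \<le> 1 / t"
      using z t by (simp add: field_simps)
    have "\<bar>?S\<bar> / N \<le> (B * (sqrt N + 8 * real N * ln z / ln N) + 2 * e * (N + 2 * real N * ln N / ln z)) / N"
      using bound K z e \<open>z \<le> N\<close> by (intro divide_right_mono abs_sum_largest_prime_le) auto
    also have "\<dots> = B * (sqrt N / N) + 8 * B * (ln z / ln N) + 2 * e * (1 + 2 * (ln N / ln z))"
      using elim by (simp add: add_divide_distrib distrib_left)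
    also have "8 * B * (ln z / ln N) \<le> 8 * B * (2 * t)"
      using lnz1 B by (intro mult_left_mono) auto
    also have "\<dots> \<le> 16 * (B + 1) * (r / (64 * (B + 1)))"
    proof -
      have "8 * B * (2 * t) \<le> 16 * (B + 1) * t" using B t by (simp add: algebra_simps)
      also have "\<dots> \<le> 16 * (B + 1) * (r / (64 * (B + 1)))"
        using B t by (intro mult_left_mono) auto
      finally show ?thesis .
    qed
    also have "\<dots> = r / 4" using B by (simp add: field_simps)
    also have "2 * e * (1 + 2 * (ln N / ln z)) \<le> 2 * e * (1 + 2 * (1 / t))"
      using lnz2 e by (intro mult_left_mono) auto
    also have "\<dots> = r / 4"
    proof -
      have "2 * (r / (8 * c)) * c = r / 4" if "c > 0" for c :: real
        using that by simp
      moreover have "1 + 2 * (1 / t) > 0" using t by (simp add: add_pos_pos)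
      ultimately show ?thesis unfolding e_def by blast
    qed
    also have "B * (sqrt N / N) + r / 4 + r / 4 < r"
      using elim \<open>r > 0\<close> by linarith
    finally show ?case by (simp add: dist_real_def)
  qed
qed

subsection \<open>Alladi's formula\<close>

lemma smooth_upto_mono: "P \<subseteq> Q \<Longrightarrow> M \<le> N \<Longrightarrow> smooth_upto P M \<subseteq> smooth_upto Q N"
proof
  fix n assume "P \<subseteq> Q" "M \<le> N" "n \<in> smooth_upto P M"
  then have "n \<in> {1..N}" "prime_factors n \<subseteq> Q"
    unfolding smooth_upto_def mem_Collect_eq atLeastAtMost_iff by (metis order_trans)+
  then show "n \<in> smooth_upto Q N" by (simp add: smooth_upto_def)
qed

lemma smooth_upto_density_0:
  "(\<lambda>N. card (smooth_upto (primes_upto z) N) / N) \<longlonglongrightarrow> 0"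
proof (rule Lim_null_comparison)
  let ?z = "max 1 z"
  show "\<forall>\<^sub>F N in sequentially. norm (card (smooth_upto (primes_upto z) N) / N) \<le>
      (sqrt N + 8 * real N * ln ?z / ln N) / N"
    using eventually_gt_at_top[of 1]
  proof eventually_elim
    case (elim N)
    have "card (smooth_upto (primes_upto z) N) \<le> card (smooth_upto (primes_upto ?z) N)"
      by (intro card_mono smooth_upto_mono) auto
    also have "real \<dots> \<le> sqrt N + 8 * real N * ln ?z / ln N"
      using elim by (intro card_smooth_upto_bound) auto
    finally show ?case using elim by (simp add: divide_right_mono)
  qed
  show "(\<lambda>N. (sqrt N + 8 * real N * ln ?z / ln N) / N) \<longlonglongrightarrow> 0"
    by real_asymp
qed

definition moebius_error :: "nat set \<Rightarrow> nat \<Rightarrow> real" where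
  "moebius_error A N = (\<Sum>n | n \<in> {2..N} \<and> least_prime_divisor n \<in> A. 
     moebius_mu n * (real N / real n - real (N div n)))"

text \<open>For one prime p, the sum of mu(m) N / (p m) is N / p times a sifted sum, hence o(N), and
  the sum of mu(m) floor(N / (p m)) is the number of p-smooth integers up to N / p, which have
  density 0. Only finitely many p occur.\<close>

lemma moebius_error_upto_tendsto_0:
  "(\<lambda>N. moebius_error (A \<inter> primes_upto z) N / N) \<longlonglongrightarrow> 0"
proof -
  let ?f = "\<lambda>p N. sifted_mertens (primes_upto p) (N div p) / p"
  let ?s = "\<lambda>p N. card (smooth_upto (primes_upto p) (N div p)) / N"
  have "(\<lambda>N. ?f p N - ?s p N) \<longlonglongrightarrow> 0 / p - 0" if "p \<in> A \<inter> primes_upto z" for p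
  proof (intro tendsto_intros)
    have p: "p > 0" using that by (auto simp: prime_gt_0_nat)
    show "(\<lambda>N. sifted_mertens (primes_upto p) (N div p)) \<longlonglongrightarrow> 0"
      using p by (intro filterlim_compose[OF sifted_mertens_tendsto_0 filterlim_at_top_div_const_nat]) auto
    show "?s p \<longlonglongrightarrow> 0"
      by (rule Lim_null_comparison[OF always_eventually smooth_upto_density_0[of p]])
        (simp add: divide_right_mono card_mono smooth_upto_mono)
    show "real p \<noteq> 0" using p by simp
  qed
  then have "(\<lambda>N. - (\<Sum>p\<in>A \<inter> primes_upto z. ?f p N - ?s p N)) \<longlonglongrightarrow> - (\<Sum>p\<in>A \<inter> primes_upto z. 0 / p - 0)"
    by (intro tendsto_minus tendsto_sum) auto
  moreover have "\<forall>\<^sub>F N in sequentially.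
      - (\<Sum>p\<in>A \<inter> primes_upto z. ?f p N - ?s p N) = moebius_error (A \<inter> primes_upto z) N / N"
    \<comment> \<open>From N >= z on, the range of p does not depend on N.\<close>
    using eventually_ge_at_top[of "max 1 z"]
  proof eventually_elim
    case (elim N)
    have eq: "A \<inter> primes_upto z \<inter> primes_upto N = A \<inter> primes_upto z"
      using elim by auto
    have "(\<Sum>m\<in>sifted_upto (primes_upto p) (N div p).
        moebius_mu m * (real N / real (p * m) - real (N div (p * m)))) = N * (?f p N - ?s p N)" for p
    proof -
      have "(\<Sum>m\<in>sifted_upto (primes_upto p) (N div p).
          moebius_mu m * (real N / real (p * m) - real (N div (p * m)))) =
        N * ?f p N - (\<Sum>m\<in>sifted_upto (primes_upto p) (N div p). moebius_mu m * real (N div p div m))"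
        unfolding sifted_mertens_def sum_distrib_left sum_divide_distrib sum_subtractf[symmetric]
      proof (rule sum.cong[OF refl])
        fix m
        have "c * (real N / real (p * m)) = real N * (c / m / p)" for c
          by (simp add: field_simps)
        from this[of "moebius_mu m"] show "moebius_mu m * (real N / real (p * m) - real (N div (p * m))) =
            real N * (moebius_mu m / m / p) - moebius_mu m * real (N div p div m)"
          by (simp only: div_mult2_eq right_diff_distrib)
      qed
      then show ?thesis
        using elim by (subst (asm) sum_moebius_div_sifted_upto) (auto simp: right_diff_distrib)
    qed
    then show ?case
      using elim unfolding moebius_error_def sum_moebius_least_prime_divisor eq
      by (simp flip: sum_distrib_left)
  qed
  ultimately show ?thesis
    using filterlim_cong[OF refl refl, of "\<lambda>N. - (\<Sum>p\<in>A \<inter> primes_upto z. ?f p N - ?s p N)"] by simp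
qed

lemma abs_moebius_error_beyond_le:
  "\<bar>moebius_error (A - primes_upto z) N\<bar> \<le> card (sifted_upto (primes_upto z) N)"
proof -
  let ?C = "{n \<in> {2..N}. least_prime_divisor n \<in> A - primes_upto z}"
  have "\<bar>moebius_error (A - primes_upto z) N\<bar> \<le> (\<Sum>n\<in>?C. 1)"
    unfolding moebius_error_def
  proof (rule sum_abs[THEN order_trans], rule sum_mono)
    show "\<bar>moebius_mu n * (real N / real n - real (N div n))\<bar> \<le> 1" for n
      using abs_moebius_mu_le[of n] abs_real_div_diff_le_1[of N n]
      by (simp add: abs_mult mult_le_one)
  qed
  also have "\<dots> \<le> real (card (sifted_upto (primes_upto z) N))"
  proof -
    have "?C \<subseteq> sifted_upto (primes_upto z) N"
    proof
      fix n assume n: "n \<in> ?C"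
      then have "least_prime_divisor n > z"
        using prime_least_prime_divisor[of n] by auto
      then have "\<not> q dvd n" if "q \<in> primes_upto z" for q
        using least_prime_divisor_le[of n q] n that by auto
      then show "n \<in> sifted_upto (primes_upto z) N"
        using n by (simp add: sifted_upto_def)
    qed
    then have "card ?C \<le> card (sifted_upto (primes_upto z) N)"
      by (intro card_mono) auto
    then show ?thesis by simp
  qed
  finally show ?thesis .
qed

text \<open>The n whose least prime exceeds z cost at most 1 each, and z can be chosen from e alone
  so that they number at most e N / 2 eventually. For this z the previous limit handles the other
  n.\<close>

lemma moebius_error_tendsto_0:
  "(\<lambda>N. moebius_error A N / N) \<longlonglongrightarrow> 0"
proof (rule tendstoI)
  fix e :: real assume "e > 0"
  then obtain z where z: "\<forall>\<^sub>F N in sequentially. card (sifted_upto (primes_upto z) N) \<le> e / 2 * N"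
    using sifted_upto_density_small[of "e / 2"] by auto
  have "\<forall>\<^sub>F N in sequentially. \<bar>moebius_error (A \<inter> primes_upto z) N / N\<bar> < e / 2"
    using tendstoD[OF moebius_error_upto_tendsto_0, of "e / 2" A z] \<open>e > 0\<close> by simp
  then show "\<forall>\<^sub>F N in sequentially. dist (moebius_error A N / N) 0 < e"
    using z eventually_gt_at_top[of 0]
  proof eventually_elim
    case (elim N)
    have "moebius_error A N = moebius_error (A \<inter> primes_upto z) N + moebius_error (A - primes_upto z) N"
      unfolding moebius_error_def by (subst sum.union_disjoint[symmetric]) (auto intro!: sum.cong)
    then have "moebius_error A N / N =
        moebius_error (A \<inter> primes_upto z) N / N + moebius_error (A - primes_upto z) N / N"
      by (simp add: add_divide_distrib)
    moreover have "\<bar>moebius_error (A - primes_upto z) N / N\<bar> \<le> e / 2"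
      using abs_moebius_error_beyond_le[of A z N] elim by (simp add: divide_le_eq abs_divide)
    ultimately show ?case
      using elim unfolding dist_real_def by linarith
  qed
qed

lemma has_prime_density_sum:
  fixes e :: real
  assumes "has_prime_density S \<delta>" "e > 0"
  shows "\<forall>\<^sub>F k in sequentially.
    \<bar>\<Sum>p\<in>primes_upto k. (if p \<in> S then 1 else 0) - \<delta>\<bar> \<le> e * card (primes_upto k)"
proof -
  have "(\<lambda>k. real (prime_count_in S (real k)) / real (prime_count (real k))) \<longlonglongrightarrow> \<delta>"
    using assms(1) unfolding has_prime_density_def
    by (rule filterlim_compose) (rule filterlim_real_sequentially)
  from tendstoD[OF this assms(2)] eventually_ge_at_top[of 2]
  show ?thesis
  proof eventually_elim
    case (elim k)
    have "{p. prime p \<and> real p \<le> real k} = primes_upto k" by auto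
    then have c: "prime_count (real k) = card (primes_upto k)"
      by (simp add: prime_count_def)
    have "{p \<in> S. prime p \<and> real p \<le> real k} = {p \<in> primes_upto k. p \<in> S}" by auto
    then have d: "real (prime_count_in S (real k)) = (\<Sum>p\<in>primes_upto k. if p \<in> S then 1 else 0)"
      by (simp add: prime_count_in_def flip: sum.inter_filter)
    \<comment> \<open>For k >= 2 there is a prime, so the quotient in the definition of density is
      not a division by 0.\<close>
    have "2 \<in> primes_upto k" using elim by auto
    then have "primes_upto k \<noteq> {}" by blast
    then have "card (primes_upto k) > 0" by (subst card_gt_0_iff) (intro conjI, assumption, simp)
    moreover from this have "real (prime_count_in S (real k)) - \<delta> * card (primes_upto k) =
        (real (prime_count_in S (real k)) / prime_count (real k) - \<delta>) * card (primes_upto k)"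
    proof -
      have "x - \<delta> * y = (x / y - \<delta>) * y" if "y > 0" for x y :: real
        using that by (simp add: left_diff_distrib)
      then show ?thesis
        using \<open>card (primes_upto k) > 0\<close> unfolding c by simp
    qed
    ultimately have "\<bar>real (prime_count_in S (real k)) - \<delta> * card (primes_upto k)\<bar> \<le> e * card (primes_upto k)"
      using elim by (simp add: abs_mult dist_real_def)
    then show ?case by (simp add: d sum_subtractf mult.commute)
  qed
qed

theorem alladi_natural_density:
  assumes "has_prime_density S \<delta>"
  shows "(\<lambda>N. \<Sum>n | n \<in> {2..N} \<and> least_prime_divisor n \<in> S. moebius_mu n / n) \<longlonglongrightarrow> - \<delta>"
proof -
  \<comment> \<open>The indicator of S, centred at \<delta>. Its sum weighted by the counts of n
    with P(n) = p is o(N), while the constant \<delta> sees every n from 2 to N and gives \<delta>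
    (N - 1).\<close>
  define g where "g = (\<lambda>p. (if p \<in> S then 1 else 0) - \<delta>)"
  define L where "L = (\<lambda>N. \<Sum>p\<in>primes_upto N. g p * card (smooth_upto (primes_upto p) (N div p)))"
  have "\<bar>g p\<bar> \<le> 1 + \<bar>\<delta>\<bar>" for p unfolding g_def by (cases "p \<in> S") auto
  then have L: "(\<lambda>N. L N / N) \<longlonglongrightarrow> 0"
    unfolding L_def
    by (rule sum_largest_prime_tendsto_0) (use has_prime_density_sum[OF assms] in \<open>simp add: g_def\<close>)
  have "(\<lambda>N. moebius_error S N / N - L N / N - \<delta> * ((real N - 1) / N)) \<longlonglongrightarrow> 0 - 0 - \<delta> * 1"
  proof (intro tendsto_diff tendsto_mult tendsto_const L moebius_error_tendsto_0)
    show "(\<lambda>N. (real N - 1) / N) \<longlonglongrightarrow> 1" by real_asymp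
  qed
  moreover have "\<forall>\<^sub>F N in sequentially. moebius_error S N / N - L N / N - \<delta> * ((real N - 1) / N) =
      (\<Sum>n | n \<in> {2..N} \<and> least_prime_divisor n \<in> S. moebius_mu n / n)"
    using eventually_gt_at_top[of 0]
  proof eventually_elim
    case (elim N)
    let ?c = "\<lambda>p. real (card (smooth_upto (primes_upto p) (N div p)))"
    let ?A = "{n. n \<in> {2..N} \<and> least_prime_divisor n \<in> S}"
    have "N * (\<Sum>n\<in>?A. moebius_mu n / n) = moebius_error S N + (\<Sum>n\<in>?A. moebius_mu n * real (N div n))"
      by (simp add: moebius_error_def sum_distrib_left right_diff_distrib sum_subtractf mult.commute)
    also have "(\<Sum>n\<in>?A. moebius_mu n * real (N div n)) = - (\<Sum>p\<in>S \<inter> primes_upto N. ?c p)"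
      unfolding sum_moebius_least_prime_divisor
      unfolding div_mult2_eq
      by (intro arg_cong[of _ _ uminus] sum.cong refl sum_moebius_div_sifted_upto) auto
    also have "(\<Sum>p\<in>S \<inter> primes_upto N. ?c p) = (\<Sum>p\<in>primes_upto N. if p \<in> S then ?c p else 0)"
      by (simp add: sum.If_cases Int_commute)
    also have "\<dots> = L N + \<delta> * (\<Sum>p\<in>primes_upto N. ?c p)"
      unfolding L_def g_def sum_distrib_left sum.distrib[symmetric]
      by (intro sum.cong refl) (auto simp: algebra_simps)
    also have "(\<Sum>p\<in>primes_upto N. ?c p) = real N - 1"
      using sum_card_smooth_upto_eq[OF elim] elim by (simp flip: of_nat_sum)
    finally have "N * (\<Sum>n\<in>?A. moebius_mu n / n) =
        moebius_error S N - L N - \<delta> * (real N - 1)"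
      by simp
    then have "(\<Sum>n\<in>?A. moebius_mu n / n) = (moebius_error S N - L N - \<delta> * (real N - 1)) / N"
      using elim by (simp add: eq_divide_eq mult.commute)
    then show ?case
      by (simp only: diff_divide_distrib[of "moebius_error S N - L N"]
          diff_divide_distrib[of "moebius_error S N"] times_divide_eq_right)
  qed
  ultimately show ?thesis
    by (force intro: Lim_transform_eventually)
qed

subsection \<open>Convolution with an arithmetic function\<close>

text \<open>The factor of a(e) / e in the partial sum over n <= N, where n = d e and M =
  \<open>N div e\<close>. The condition 2 <= d e removes n = 1, which has no least prime
  divisor.\<close>

definition twisted_mertens :: "nat set \<Rightarrow> nat \<Rightarrow> nat \<Rightarrow> real" where
  "twisted_mertens S e M =
    (\<Sum>d | d \<in> {1..M} \<and> 2 \<le> d * e \<and> least_prime_divisor (d * e) \<in> S. moebius_mu d / d)"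

lemma least_prime_divisor_mult:
  assumes "d \<ge> 2" "e \<ge> 2"
  shows "least_prime_divisor (d * e) = min (least_prime_divisor d) (least_prime_divisor e)"
proof -
  have de: "d * e \<ge> 2" using assms by (simp add: order_trans[OF _ mult_le_mono[of 2 d 1 e]])
  have "least_prime_divisor (d * e) \<le> least_prime_divisor d" "least_prime_divisor (d * e) \<le> least_prime_divisor e"
    using assms least_prime_divisor[OF assms(1)] least_prime_divisor[OF assms(2)]
    by (intro least_prime_divisor_le[OF de]; simp)+
  moreover have "least_prime_divisor d \<le> least_prime_divisor (d * e) \<or> least_prime_divisor e \<le> least_prime_divisor (d * e)"
    using prime_least_prime_divisor[OF de] least_prime_divisor_dvd[OF de] assms
    by (auto simp: prime_dvd_mult_iff intro: least_prime_divisor_le)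
  ultimately show ?thesis by linarith
qed

text \<open>The least prime of d e is the smaller of p(d) and q. If d has no prime below q, it is q,
  which counts when q is in S. Otherwise it is p(d) < q, and splitting off this prime leads to the
  sum over p. All primes involved lie below q, whatever M is.\<close>

lemma twisted_mertens_eq:
  assumes "e \<ge> 2"
  defines "q \<equiv> least_prime_divisor e"
  shows "twisted_mertens S e M =
    (if q \<in> S then sifted_mertens {p. prime p \<and> p < q} M else 0) -
    (\<Sum>p\<in>S \<inter> {p. prime p \<and> p < q}. sifted_mertens (primes_upto p) (M div p) / p)"
proof -
  let ?A = "{d. d \<in> {1..M} \<and> 2 \<le> d * e \<and> least_prime_divisor (d * e) \<in> S}"
  let ?B = "if q \<in> S then sifted_upto {p. prime p \<and> p < q} M else {}"
  let ?C = "{d. d \<in> {2..M} \<and> least_prime_divisor d \<in> S \<inter> {p. prime p \<and> p < q}}"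
  have lpd1: "least_prime_divisor (1 * e) = q" by (simp add: q_def)
  \<comment> \<open>d = 1 belongs to the sifted class but must be listed separately, as
    \<open>least_prime_divisor 1\<close> is meaningless.\<close>
  have sift: "d \<in> sifted_upto {p. prime p \<and> p < q} M \<longleftrightarrow> d \<in> {1..M} \<and> (d = 1 \<or> least_prime_divisor d \<ge> q)" for d
  proof (cases "d \<ge> 2")
    case True
    then show ?thesis
      using least_prime_divisor[OF True] unfolding sifted_upto_def
      by (auto simp: not_less) (meson not_le order_trans)+
  next
    case False
    then have "d = 0 \<or> d = 1" by linarith
    then show ?thesis by (auto simp: sifted_upto_def)
  qed
  have A: "?A = ?B \<union> ?C"
  proof (rule set_eqI)
    fix d :: nat
    consider "d = 0" | "d = 1" | "d \<ge> 2" by linarith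
    then show "d \<in> ?A \<longleftrightarrow> d \<in> ?B \<union> ?C"
    proof cases
      case 1
      then show ?thesis by (simp add: sifted_upto_def)
    next
      case 2
      then show ?thesis using assms by (auto simp: sifted_upto_def)
    next
      case 3
      have "2 \<le> d * e" using 3 assms by (simp add: order_trans[OF _ mult_le_mono[of 2 d 1 e]])
      moreover have "least_prime_divisor (d * e) = min (least_prime_divisor d) q"
        using 3 assms least_prime_divisor_mult[of d e] by simp
      ultimately show ?thesis
        using 3 sift[of d] prime_least_prime_divisor[OF 3] by (auto simp: min_def)
    qed
  qed
  have "twisted_mertens S e M = (\<Sum>d\<in>?B. moebius_mu d / d) + (\<Sum>d\<in>?C. moebius_mu d / d)"
    unfolding twisted_mertens_def A
    by (rule sum.union_disjoint) (auto simp: sift)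
  also have "(\<Sum>d\<in>?B. moebius_mu d / d) = (if q \<in> S then sifted_mertens {p. prime p \<and> p < q} M else 0)"
    by (simp add: sifted_mertens_def)
  also have "(\<Sum>d\<in>?C. moebius_mu d / d) = (\<Sum>d\<in>?C. moebius_mu d * (1 / d))"
    by simp
  also have "\<dots> = - (\<Sum>p\<in>S \<inter> {p. prime p \<and> p < q} \<inter> primes_upto M. sifted_mertens (primes_upto p) (M div p) / p)"
    unfolding sum_moebius_least_prime_divisor sifted_mertens_def sum_divide_distrib
    by (intro arg_cong[of _ _ uminus] sum.cong refl) (simp add: mult.commute)
  also have "(\<Sum>p\<in>S \<inter> {p. prime p \<and> p < q} \<inter> primes_upto M. sifted_mertens (primes_upto p) (M div p) / p) =
      (\<Sum>p\<in>S \<inter> {p. prime p \<and> p < q}. sifted_mertens (primes_upto p) (M div p) / p)"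
  proof (rule sum.mono_neutral_left)
    show "\<forall>p\<in>S \<inter> {p. prime p \<and> p < q} - S \<inter> {p. prime p \<and> p < q} \<inter> primes_upto M.
        sifted_mertens (primes_upto p) (M div p) / p = 0"
    proof
      fix p assume "p \<in> S \<inter> {p. prime p \<and> p < q} - S \<inter> {p. prime p \<and> p < q} \<inter> primes_upto M"
      then have "M div p = 0" by auto
      then show "sifted_mertens (primes_upto p) (M div p) / p = 0" by simp
    qed
  qed auto
  finally show ?thesis by simp
qed

text \<open>For fixed e this is a fixed finite combination of sifted sums, each of which tends to
  0.\<close>

lemma twisted_mertens_tendsto_0:
  assumes "e \<ge> 2"
  shows "twisted_mertens S e \<longlonglongrightarrow> 0"
proof -
  define q where "q = least_prime_divisor e"
  have "(\<lambda>M. sifted_mertens (primes_upto p) (M div p) / p) \<longlonglongrightarrow> 0" if "prime p" for p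
    using that
    by (intro tendsto_divide_zero filterlim_compose[OF sifted_mertens_tendsto_0 filterlim_at_top_div_const_nat])
      (auto simp: prime_gt_0_nat)
  then have "(\<lambda>M. \<Sum>p\<in>S \<inter> {p. prime p \<and> p < q}. sifted_mertens (primes_upto p) (M div p) / p) \<longlonglongrightarrow> 0"
    by (intro tendsto_null_sum) auto
  moreover have "(\<lambda>M. if q \<in> S then sifted_mertens {p. prime p \<and> p < q} M else 0) \<longlonglongrightarrow> 0"
    by (cases "q \<in> S") (auto intro!: sifted_mertens_tendsto_0)
  ultimately have "(\<lambda>M. (if q \<in> S then sifted_mertens {p. prime p \<and> p < q} M else 0) -
      (\<Sum>p\<in>S \<inter> {p. prime p \<and> p < q}. sifted_mertens (primes_upto p) (M div p) / p)) \<longlonglongrightarrow> 0 - 0"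
    by (intro tendsto_diff)
  then show ?thesis
    unfolding q_def twisted_mertens_eq[OF assms, symmetric] by simp
qed

text \<open>Each sifted sum is at most 2 in absolute value, independently of its set of primes; q <=
  e then turns the range of p into one that depends on e.\<close>

lemma abs_twisted_mertens_le:
  assumes "e \<ge> 2"
  shows "\<bar>twisted_mertens S e M\<bar> \<le> 2 + 2 * (\<Sum>p\<in>primes_upto e. 1 / p)"
proof -
  define q where "q = least_prime_divisor e"
  have "q \<le> e"
    using least_prime_divisor_dvd[OF assms] assms unfolding q_def by (intro dvd_imp_le) auto
  have "\<bar>\<Sum>p\<in>S \<inter> {p. prime p \<and> p < q}. sifted_mertens (primes_upto p) (M div p) / p\<bar> \<le>
      (\<Sum>p\<in>S \<inter> {p. prime p \<and> p < q}. 2 * (1 / p))"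
  proof (rule sum_abs[THEN order_trans], rule sum_mono)
    fix p :: nat
    have "\<bar>sifted_mertens (primes_upto p) (M div p)\<bar> \<le> 2"
      by (rule abs_sifted_mertens_le) auto
    from divide_right_mono[OF this, of "real p"]
    show "\<bar>sifted_mertens (primes_upto p) (M div p) / p\<bar> \<le> 2 * (1 / p)" by simp
  qed
  also have "\<dots> \<le> (\<Sum>p\<in>primes_upto e. 2 * (1 / p))"
    using \<open>q \<le> e\<close> by (intro sum_mono2) auto
  also have "\<dots> = 2 * (\<Sum>p\<in>primes_upto e. 1 / p)"
    by (simp only: sum_distrib_left)
  finally have "\<bar>\<Sum>p\<in>S \<inter> {p. prime p \<and> p < q}. sifted_mertens (primes_upto p) (M div p) / p\<bar> \<le>
      2 * (\<Sum>p\<in>primes_upto e. 1 / p)" .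
  moreover have "\<bar>if q \<in> S then sifted_mertens {p. prime p \<and> p < q} M else 0\<bar> \<le> 2"
    using abs_sifted_mertens_le[of "{p. prime p \<and> p < q}" M] by auto
  ultimately show ?thesis
    using twisted_mertens_eq[OF assms, of S M] unfolding q_def by linarith
qed

text \<open>The range starts at 3 because ln (ln 2) < 0; from there on ln (ln e) is at least the
  positive number c and can absorb additive constants.\<close>

lemma sum_prime_reciprocals_le_ln_ln:
  obtains C :: real where "\<And>e. e \<ge> 3 \<Longrightarrow> 2 + 2 * (\<Sum>p\<in>primes_upto e. 1 / p) \<le> C * ln (ln (real e))"
proof -
  define c where "c = ln (ln (3::real))"
  have "ln (3::real) > 1" by (rule ln3_gt_1)
  then have c: "c > 0" by (simp add: c_def)
  define C where "C = (12 + 8 * \<bar>ln (ln 2)\<bar> / ln 2) / c + 8 / (ln 2 :: real)"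
  have "2 + 2 * (\<Sum>p\<in>primes_upto e. 1 / p) \<le> C * ln (ln (real e))" if e: "e \<ge> 3" for e :: nat
  proof -
    have "ln (3::real) \<le> ln (real e)"
      using e by (subst ln_le_cancel_iff) auto
    then have lne: "ln (real e) > 1" using \<open>ln 3 > 1\<close> by linarith
    have c_le: "c \<le> ln (ln (real e))"
      unfolding c_def using \<open>ln 3 \<le> ln (real e)\<close> \<open>ln 3 > 1\<close> by (subst ln_le_cancel_iff) linarith+
    \<comment> \<open>Chosen so that e <= 2^(2^k) with k at most X + 1, where X = log 2 (log 2 e).
      The block bound then gives 2 + 2 (1 + 4 (X + 1)) = 12 + 8 X.\<close>
    define k where "k = nat \<lceil>log 2 (log 2 (real e))\<rceil>"
    have "log 2 (real e) \<ge> log 2 2"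
      using e by (subst log_le_cancel_iff) auto
    then have log: "log 2 (real e) \<ge> 1" by simp
    then have "log 2 (log 2 (real e)) \<ge> 0" by simp
    then have k: "log 2 (log 2 (real e)) \<le> real k" "real k \<le> log 2 (log 2 (real e)) + 1"
      unfolding k_def by linarith+
    have "log 2 (real e) \<le> 2 powr real k"
      using k(1) log by (subst (asm) log_le_iff) auto
    then have "real e \<le> 2 powr (2 powr real k)"
      using e by (subst (asm) log_le_iff) auto
    also have "\<dots> = real (2 ^ 2 ^ k)"
    proof -
      have "(2::real) powr real k = real (2 ^ k)" by (simp add: powr_realpow)
      moreover have "(2::real) powr real (2 ^ k) = 2 ^ 2 ^ k" by (rule powr_realpow) simp
      ultimately show ?thesis by simp
    qed
    finally have "e \<le> 2 ^ 2 ^ k" by linarith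
    then have "(\<Sum>p\<in>primes_upto e. 1 / real p) \<le> (\<Sum>p\<in>primes_upto (2 ^ 2 ^ k). 1 / real p)"
      by (intro sum_mono2) auto
    also have "\<dots> \<le> 1 + 4 * real k"
      by (rule sum_prime_reciprocals_le)
    finally have "2 + 2 * (\<Sum>p\<in>primes_upto e. 1 / real p) \<le> 12 + 8 * log 2 (log 2 (real e))"
      using k by linarith
    also have "log 2 (log 2 (real e)) = (ln (ln (real e)) - ln (ln 2)) / ln 2"
      using lne by (simp add: log_def ln_div)
    also have "\<dots> \<le> (ln (ln (real e)) + \<bar>ln (ln 2)\<bar>) / ln 2"
      by (intro divide_right_mono) auto
    also have "12 + 8 * ((ln (ln (real e)) + \<bar>ln (ln 2)\<bar>) / ln 2) =
        (12 + 8 * \<bar>ln (ln 2)\<bar> / ln 2) * 1 + 8 / ln 2 * ln (ln (real e))"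
      by (simp add: add_divide_distrib)
    also have "(12 + 8 * \<bar>ln (ln 2)\<bar> / ln 2) * 1 \<le> (12 + 8 * \<bar>ln (ln 2)\<bar> / ln 2) * (ln (ln (real e)) / c)"
      using c c_le by (intro mult_left_mono) auto
    also have "(12 + 8 * \<bar>ln (ln 2)\<bar> / ln 2) * (ln (ln (real e)) / c) + 8 / ln 2 * ln (ln (real e)) =
        C * ln (ln (real e))"
      by (simp add: C_def distrib_right)
    finally show ?thesis by simp
  qed
  then show ?thesis using that by blast
qed

text \<open>Write n = d e with e the argument of a, and exchange the sums; d then runs up to
  \<open>N div e\<close>.\<close>

lemma sum_dirichlet_conv_twisted:
  fixes a :: "nat \<Rightarrow> complex"
  shows "(\<Sum>n | n \<in> {2..N} \<and> least_prime_divisor n \<in> S.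
      dirichlet_conv (\<lambda>d. of_int (moebius_mu d)) a n / of_nat n) =
    (\<Sum>e=1..N. a e / of_nat e * of_real (twisted_mertens S e (N div e)))"
proof -
  let ?P = "\<lambda>n. 2 \<le> n \<and> least_prime_divisor n \<in> S"
  let ?f = "\<lambda>d e. a e / of_nat e * (of_int (moebius_mu d) / of_nat d)"
  have "(\<Sum>n | n \<in> {2..N} \<and> least_prime_divisor n \<in> S.
      dirichlet_conv (\<lambda>d. of_int (moebius_mu d)) a n / of_nat n) =
    (\<Sum>n | n \<in> {1..N} \<and> ?P n. \<Sum>e | e \<in> {1..N} \<and> e dvd n. ?f (n div e) e)"
  proof (rule sum.cong)
    fix n assume n: "n \<in> {n. n \<in> {1..N} \<and> ?P n}"
    have "dirichlet_conv (\<lambda>d. of_int (moebius_mu d)) a n / of_nat n =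
        (\<Sum>d | d dvd n. ?f d (n div d))"
      unfolding dirichlet_conv_def sum_divide_distrib
    proof (rule sum.cong[OF refl])
      fix d assume "d \<in> {d. d dvd n}"
      then obtain k where k: "n = d * k" by blast
      then have "d > 0" "k > 0" using n by (auto intro!: Nat.gr0I)
      then show "of_int (moebius_mu d) * a (n div d) / of_nat n = ?f d (n div d)"
        by (simp add: k mult.commute)
    qed
    also have "\<dots> = (\<Sum>e | e dvd n. ?f (n div e) e)"
      by (rule sum.reindex_bij_witness[of _ "\<lambda>e. n div e" "\<lambda>d. n div d"]) (use n in auto)
    also have "{e. e dvd n} = {e. e \<in> {1..N} \<and> e dvd n}"
      using n by (auto intro: dvd_imp_le_trans simp: Suc_le_eq intro!: Nat.gr0I)
    finally show "dirichlet_conv (\<lambda>d. of_int (moebius_mu d)) a n / of_nat n =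
      (\<Sum>e | e \<in> {1..N} \<and> e dvd n. ?f (n div e) e)" .
  qed auto
  also have "\<dots> = (\<Sum>n=1..N. \<Sum>e=1..N. if ?P n \<and> e dvd n then ?f (n div e) e else 0)"
    unfolding sum.inter_filter[OF finite_atLeastAtMost]
    by (rule sum.cong[OF refl]) (auto intro: sum.neutral)
  also have "\<dots> = (\<Sum>e=1..N. \<Sum>n=1..N. if ?P n \<and> e dvd n then ?f (n div e) e else 0)"
    by (rule sum.swap)
  also have "\<dots> = (\<Sum>e=1..N. a e / of_nat e * of_real (twisted_mertens S e (N div e)))"
  proof (rule sum.cong[OF refl])
    fix e assume e: "e \<in> {1..N}"
    have "(\<Sum>n=1..N. if ?P n \<and> e dvd n then ?f (n div e) e else 0) =
        (\<Sum>n | n \<in> {1..N} \<and> ?P n \<and> e dvd n. ?f (n div e) e)"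
      by (subst sum.inter_filter) auto
    also have "\<dots> = (\<Sum>d | d \<in> {1..N div e} \<and> 2 \<le> d * e \<and> least_prime_divisor (d * e) \<in> S. ?f d e)"
      by (rule sum.reindex_bij_witness[of _ "\<lambda>d. d * e" "\<lambda>n. n div e"])
        (use e times_le_iff_le_div[of e] in \<open>auto simp: mult.commute Suc_le_eq elim!: dvdE intro!: Nat.gr0I\<close>)
    also have "\<dots> = a e / of_nat e * of_real (twisted_mertens S e (N div e))"
      by (simp add: twisted_mertens_def sum_distrib_left)
    finally show "(\<Sum>n=1..N. if ?P n \<and> e dvd n then ?f (n div e) e else 0) =
        a e / of_nat e * of_real (twisted_mertens S e (N div e))" .
  qed
  finally show ?thesis .
qed

lemma twisted_mertens_1:
  "twisted_mertens S 1 N = (\<Sum>n | n \<in> {2..N} \<and> least_prime_divisor n \<in> S. moebius_mu n / n)"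
  unfolding twisted_mertens_def by (rule sum.cong) auto

lemma twisted_mertens_1_tendsto:
  assumes "has_prime_density S \<delta>"
  shows "twisted_mertens S 1 \<longlonglongrightarrow> - \<delta>"
  unfolding twisted_mertens_1 using alladi_natural_density[OF assms] .

theorem theorem1p1:
  fixes a :: "nat \<Rightarrow> complex" and S :: "nat set" and \<delta> :: real
  assumes "a 1 = 1"
    and "summable (\<lambda>n. if n \<ge> 2 then cmod (a n) / real n * ln (ln (real n)) else 0)"
    and "S \<subseteq> {p. prime p}"
    and "has_prime_density S \<delta>"
  defines "b \<equiv> (\<lambda>n. if n \<ge> 2 \<and> least_prime_divisor n \<in> S
             then dirichlet_conv (\<lambda>d. of_int (moebius_mu d)) a n / of_nat n else 0)"
  shows "summable b \<and> - (\<Sum>n. b n) = complex_of_real \<delta>"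
proof -
  define u where "u = (\<lambda>e N. a e / of_nat e * complex_of_real (twisted_mertens S e (N div e)))"
  obtain C where C: "\<And>e. e \<ge> 3 \<Longrightarrow> 2 + 2 * (\<Sum>p\<in>primes_upto e. 1 / p) \<le> C * ln (ln (real e))"
    using sum_prime_reciprocals_le_ln_ln by blast
  \<comment> \<open>The explicit bound is for e >= 2; for e = 1 boundedness comes from
    convergence.\<close>
  have "Bseq (twisted_mertens S 1)"
    using twisted_mertens_1_tendsto[OF assms(4)] by (intro convergent_imp_Bseq convergentI)
  then obtain B where B: "\<And>N. \<bar>twisted_mertens S 1 N\<bar> \<le> B"
    by (auto simp: Bseq_def)
  define K where "K = (\<lambda>e. if e = 1 then B else 2 + 2 * (\<Sum>p\<in>primes_upto e. 1 / p))"
  have lim: "(\<lambda>N. u e N) \<longlonglongrightarrow> (if e = 1 then - of_real \<delta> else 0)" for e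
  proof -
    consider "e = 0" | "e = 1" | "e \<ge> 2" by linarith
    then show ?thesis
    proof cases
      case 1
      then show ?thesis by (simp add: u_def)
    next
      case 2
      then show ?thesis
        using tendsto_of_real[OF twisted_mertens_1_tendsto[OF assms(4)], where 'a = complex] assms(1)
        by (simp add: u_def)
    next
      case 3
      have "(\<lambda>N. u e N) \<longlonglongrightarrow> a e / of_nat e * of_real 0"
        unfolding u_def using 3
        by (intro tendsto_mult tendsto_const tendsto_of_real filterlim_compose[OF twisted_mertens_tendsto_0 filterlim_at_top_div_const_nat]) auto
      then show ?thesis using 3 by simp
    qed
  qed
  have bound: "norm (u e N) \<le> cmod (a e) / real e * K e" for e N
  proof (cases "e = 0")
    case False
    then have "\<bar>twisted_mertens S e (N div e)\<bar> \<le> K e"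
      using B abs_twisted_mertens_le[of e S] by (auto simp: K_def)
    then show ?thesis
      unfolding u_def norm_mult norm_divide by (intro mult_mono) (auto simp: norm_of_real)
  qed (simp add: u_def)
  have "summable (\<lambda>e. C * (if e \<ge> 2 then cmod (a e) / real e * ln (ln (real e)) else 0))"
    using assms(2) by (rule summable_mult)
  then have summable: "summable (\<lambda>e. cmod (a e) / real e * K e)"
  proof (rule summable_comparison_test_ev[rotated])
    show "\<forall>\<^sub>F e in sequentially. norm (cmod (a e) / real e * K e) \<le>
        C * (if e \<ge> 2 then cmod (a e) / real e * ln (ln (real e)) else 0)"
      \<comment> \<open>The comparison with C ln (ln e) is available from e = 3 on; finitely many
        terms do not affect summability.\<close>
      using eventually_ge_at_top[of 3]
    proof eventually_elim
      case (elim e)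
      have "0 \<le> K e" using elim by (auto simp: K_def intro!: add_nonneg_nonneg sum_nonneg)
      moreover have "K e \<le> C * ln (ln (real e))" using C elim by (auto simp: K_def)
      then have "cmod (a e) / real e * K e \<le> cmod (a e) / real e * (C * ln (ln (real e)))"
        by (intro mult_left_mono) auto
      ultimately show ?case using elim by (simp add: abs_mult mult.left_commute)
    qed
  qed
  \<comment> \<open>Dominated convergence for series: the majorant does not depend on N, and for
    each fixed e the quotient \<open>N div e\<close> tends to infinity.\<close>
  have "(\<lambda>N. \<Sum>e. u e N) \<longlonglongrightarrow> (\<Sum>e. if e = 1 then - of_real \<delta> else 0)"
  proof -
    have "\<forall>\<^sub>F (e, N) in sequentially \<times>\<^sub>F sequentially. norm (u e N) \<le> cmod (a e) / real e * K e"
      using bound by (intro always_eventually) auto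
    from tannerys_theorem[OF lim this summable] show ?thesis by simp
  qed
  also have "(\<Sum>e. if e = 1 then - of_real \<delta> else 0) = - complex_of_real \<delta>"
    by (subst suminf_finite[of "{1}"]) auto
  also have "(\<lambda>N. \<Sum>e. u e N) = (\<lambda>N. \<Sum>n\<le>N. b n)"
  proof
    fix N
    have "(\<Sum>n\<le>N. b n) = (\<Sum>n | n \<in> {2..N} \<and> least_prime_divisor n \<in> S.
        dirichlet_conv (\<lambda>d. of_int (moebius_mu d)) a n / of_nat n)"
      by (rule sum.mono_neutral_cong_right) (auto simp: b_def)
    also have "\<dots> = (\<Sum>e=1..N. u e N)"
      unfolding u_def by (rule sum_dirichlet_conv_twisted)
    \<comment> \<open>For e > N the quotient \<open>N div e\<close> is 0 and the twisted sum is
      empty, so the series over e is a finite sum.\<close>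
    also have "\<dots> = (\<Sum>e. u e N)"
    proof (rule suminf_finite[symmetric])
      fix e assume "e \<notin> {1..N}"
      then have "e = 0 \<or> N div e = 0" by auto
      then show "u e N = 0" by (auto simp: u_def twisted_mertens_def)
    qed simp
    finally show "(\<Sum>e. u e N) = (\<Sum>n\<le>N. b n)" by simp
  qed
  finally have "b sums (- complex_of_real \<delta>)"
    by (simp add: sums_def_le)
  then show ?thesis by (simp add: sums_iff)
qed

end
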